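(* Let $u\geq 10^5$ be an integer. There exists some integer $d\leq 5u/2$ and an infinite sequence $n_0<n_1<\cdots$ of positive integers, satisfying $n_{i+1}\leq 4n_i^9$ for all $i\ge 0$, such that for every $i\ge 1$ there exists a $d$-regular graph on $n_i$ vertices with second eigenvalue exactly $2\sqrt{u^2+1}-1$, of multiplicity at least $i$; moreover $i=\Omega(\log\log n_i)$.
   Context: Graphs are finite and simple. The eigenvalues of a graph $G$ are those of its adjacency matrix $A_G$, ordered decreasingly and counted with multiplicity; the second eigenvalue is $\lambda_2(A_G)$, the second largest in this ordering. *)

theory Defs
  imports
    Complex_Main
    "HOL-Library.Multiset"
    "HOL-Library.Landau_Symbols"
    "HOL-Computational_Algebra.Polynomial"
    "Jordan_Normal_Form.Char_Poly"
    "Graph_Theory.Pair_Digraph"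
begin

text \<open>
  A finite simple graph is a \<^locale>\<open>pair_graph\<close>: finite vertex set, no loops, and a symmetric
  arc relation, so that each undirected edge is a pair of opposite arcs.  The out-degree of a vertex
  is therefore its degree.
\<close>

definition regular :: "nat \<Rightarrow> 'a pair_pre_digraph \<Rightarrow> bool" where
  "regular d G \<longleftrightarrow> (\<forall>v\<in>pverts G. out_degree (with_proj G) v = d)"

text \<open>
  Rows and columns follow the increasing enumeration of the vertices; another enumeration would
  only conjugate the matrix by a permutation.
\<close>

definition adjacency_matrix :: "'a::linorder pair_pre_digraph \<Rightarrow> real mat" where
  "adjacency_matrix G =
     (let n = card (pverts G); vs = sorted_list_of_set (pverts G)
      in mat n n (\<lambda>(i, j). if (vs ! i, vs ! j) \<in> parcs G then 1 else 0))"

text \<open>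
  Real eigenvalues in decreasing order, each repeated according to its multiplicity as a root of the
  characteristic polynomial.  For a symmetric matrix these are all the eigenvalues, and algebraic and
  geometric multiplicities agree.
\<close>

definition eigenvalue_list :: "real mat \<Rightarrow> real list" where
  "eigenvalue_list A = rev (sorted_list_of_multiset (proots (char_poly A)))"

text \<open>List positions start at 0.  The value is meaningful only if there are at least two eigenvalues.\<close>

definition second_eigenvalue :: "real mat \<Rightarrow> real" where
  "second_eigenvalue A = eigenvalue_list A ! 1"

definition eigenvalue_multiplicity :: "real mat \<Rightarrow> real \<Rightarrow> nat" where
  "eigenvalue_multiplicity A x = count_list (eigenvalue_list A) x"

end

theory Submission
  imports Defs
begin

text \<open>
  Let \<open>\<tau> = 2 \<surd>(u\<^sup>2 + 1) - 1\<close>. On the four states \<open>{1,2} \<times> {+,-}\<close> there is a small regular weighted graph \<open>Q\<close> whose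
  action on sign-odd functions is \<open>[[2u-1, 2], [2, -2u-1]]\<close>, with top eigenvalue \<open>\<tau>\<close>. The normalised tensor power
  \<open>Q\<^sup>\<otimes>\<^sup>k\<close> has second eigenvalue exactly that of \<open>Q\<close>, with the \<open>k\<close> coordinate functions as eigenvectors, because
  all products of two nontrivial eigenvalues are much smaller. Its degree is unbounded, so it is sparsified: a
  second coordinate \<open>y\<close> lives on one side of a 64-regular bipartite expander, and an edge goes from \<open>y\<close> through
  a neighbour \<open>z\<close> to some \<open>y'\<close>, while each letter moves along one of four involutions, which involutions being
  prescribed by \<open>z\<close>. Every \<open>z\<close> uses each involution once in each letter, so functions of a single letter remain
  exact eigenvectors, while on everything else the expander makes the operator close to the tensor power.
  A last coordinate, with labels in a group of exponent two, makes the graph simple, and some edges that fix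
  \<open>y\<close> correct the weights of \<open>Q\<close> to depend on \<open>u\<close> exactly as required.

  The expanders come from the 2-lifts of Marcus, Spielman and Srivastava: the expected characteristic polynomial
  of a random signing is the matching polynomial, and interlacing yields a signing that is at least as good.
\<close>

subsection \<open>Spectral resolution of real symmetric matrices\<close>

text \<open>The eigenvalue has to be exact, whereas a generic sparsifier would perturb it. All
  errors are therefore confined to the complement of the one-letter functions, where there is slack.
  The \<open>r\<close> = 2u - 8189 edges at a vertex that fix \<open>y\<close> contribute at most
  \<open>r\<close> to a normalised quadratic form, and \<tau> exceeds 2u - 1. So the 64 * 4 * 64 =
  16384 edges through the expander may contribute up to 8188, slightly less than half their number.
  The ideal tensor power contributes a quarter, since two nontrivial eigenvalues of size at most 1/2
  get multiplied. The non-uniform labels, the expander error and the cross terms must fit into the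
  difference; with expander degree 64 the total is 7744.

  The degree is 16384 + \<open>r\<close> = 2u + 8195 whatever the number of letters, and u \<ge>
  10^5 gives 8195 \<le> u/2. Multiplicity is only bounded from below, so it suffices to exclude
  eigenvalues above \<tau> on mean-zero functions.\<close>

lemma mult_mat_vec_sum:
  assumes "A \<in> carrier_mat n m" "v \<in> carrier_vec m" "i < n"
  shows "(A *\<^sub>v v) $ i = (\<Sum>j<m. A $$ (i,j) * v $ j)"
  using assms by (auto simp: scalar_prod_def atLeast0LessThan intro!: sum.cong)

lemma symmetric_index:
  assumes "A \<in> carrier_mat n n" "transpose_mat A = A" "i < n" "j < n"
  shows "A $$ (i,j) = A $$ (j,i)"
  using assms by (metis carrier_matD index_transpose_mat(1))

text \<open>The characteristic polynomial has a complex root. Symmetry makes \<open>q\<close>, the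
  Hermitian form at an eigenvector \<open>v\<close>, equal to its own conjugate, and
  \<open>q\<close> is the root times the squared norm of \<open>v\<close>; so the root is real and
  has a real eigenvector.\<close>

lemma real_symmetric_has_eigenvector:
  fixes A :: "real mat"
  assumes A: "A \<in> carrier_mat n n" and sym: "transpose_mat A = A" and n: "0 < n"
  obtains g \<mu> where "g \<in> carrier_vec n" "g \<bullet> g = 1" "A *\<^sub>v g = \<mu> \<cdot>\<^sub>v g"
proof -
  define C where "C = map_mat complex_of_real A"
  have C: "C \<in> carrier_mat n n" unfolding C_def using A by auto
  have "\<not> constant (poly (char_poly C))"
    using degree_monic_char_poly[OF C] n by (simp add: constant_degree)
  then obtain z where z: "poly (char_poly C) z = 0"
    using fundamental_theorem_of_algebra by blast
  then have "eigenvalue C z" using eigenvalue_root_char_poly[OF C] by blast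
  then obtain v where v: "v \<in> carrier_vec n" "v \<noteq> 0\<^sub>v n" "C *\<^sub>v v = z \<cdot>\<^sub>v v"
    unfolding eigenvalue_def eigenvector_def using C by auto
  define q where "q = (\<Sum>i<n. \<Sum>j<n. cnj (v $ i) * of_real (A $$ (i,j)) * v $ j)"
  define r where "r = (\<Sum>i<n. (cmod (v $ i))\<^sup>2)"
  have "cnj q = (\<Sum>i<n. \<Sum>j<n. v $ i * of_real (A $$ (i,j)) * cnj (v $ j))"
    unfolding q_def by simp
  also have "\<dots> = (\<Sum>j<n. \<Sum>i<n. v $ i * of_real (A $$ (i,j)) * cnj (v $ j))"
    by (rule sum.swap)
  also have "\<dots> = q" unfolding q_def
    by (intro sum.cong refl) (use symmetric_index[OF A sym] in auto)
  finally have "q \<in> \<real>" by (simp add: Reals_cnj_iff)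
  have "q = (\<Sum>i<n. cnj (v $ i) * (\<Sum>j<n. of_real (A $$ (i,j)) * v $ j))"
    unfolding q_def by (simp add: sum_distrib_left mult.assoc)
  also have "\<dots> = (\<Sum>i<n. cnj (v $ i) * (C *\<^sub>v v) $ i)"
    by (intro sum.cong refl) (use A in \<open>simp add: mult_mat_vec_sum[OF C v(1)] del: index_mult_mat_vec, simp add: C_def\<close>)
  also have "\<dots> = (\<Sum>i<n. z * of_real ((cmod (v $ i))\<^sup>2))"
    unfolding v(3) by (intro sum.cong refl) (use v(1) in \<open>simp add: complex_norm_square mult_ac del: of_real_power\<close>)
  also have "\<dots> = z * of_real r"
    unfolding r_def by (simp add: sum_distrib_left)
  finally have qz: "q = z * of_real r" .
  have "r \<noteq> 0"
  proof
    assume "r = 0"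
    then have "\<forall>i<n. v $ i = 0" unfolding r_def by (subst (asm) sum_nonneg_eq_0_iff) auto
    with v show False by auto
  qed
  then have "z = q / of_real r" using qz by simp
  with \<open>q \<in> \<real>\<close> have "z \<in> \<real>" by simp
  then obtain \<mu> where \<mu>: "z = of_real \<mu>" by (auto elim: Reals_cases)
  have "poly (char_poly A) \<mu> = 0"
    using z unfolding \<mu> C_def of_real_hom.char_poly_hom[OF A] by simp
  then have "eigenvalue A \<mu>" using eigenvalue_root_char_poly[OF A] by blast
  then obtain w where w: "w \<in> carrier_vec n" "w \<noteq> 0\<^sub>v n" "A *\<^sub>v w = \<mu> \<cdot>\<^sub>v w"
    unfolding eigenvalue_def eigenvector_def using A by auto
  define s where "s = sqrt (w \<bullet> w)"
  have "w \<bullet> w > 0" using w conjugate_square_greater_0_vec[OF w(1)] by simp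
  then have s: "s > 0" "s * s = w \<bullet> w" unfolding s_def by auto
  show thesis
  proof (rule that)
    show "(1/s) \<cdot>\<^sub>v w \<in> carrier_vec n" using w by simp
    show "((1/s) \<cdot>\<^sub>v w) \<bullet> ((1/s) \<cdot>\<^sub>v w) = 1"
      using w s \<open>w \<bullet> w > 0\<close> by (simp add: field_simps)
    show "A *\<^sub>v ((1/s) \<cdot>\<^sub>v w) = \<mu> \<cdot>\<^sub>v ((1/s) \<cdot>\<^sub>v w)"
      using w A by (simp add: mult_mat_vec smult_smult_assoc mult.commute)
  qed
qed

text \<open>Householder reflection along the difference \<open>w\<close> of the first unit vector
  and \<open>g\<close>; both have norm 1, so it exchanges them. Being symmetric and its own inverse,
  it serves as an orthogonal change of basis.\<close>

lemma reflection_exists: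
  fixes g :: "real vec"
  assumes g: "g \<in> carrier_vec n" "g \<bullet> g = 1" and n: "0 < n"
  obtains H where "H \<in> carrier_mat n n" "transpose_mat H = H" "H * H = 1\<^sub>m n"
    "H *\<^sub>v unit_vec n 0 = g"
proof (cases "g = unit_vec n 0")
  case True
  show thesis by (rule that[of "1\<^sub>m n"]) (use True in auto)
next
  case False
  define w where "w = unit_vec n 0 - g"
  have w: "w \<in> carrier_vec n" using g unfolding w_def by auto
  have "w \<noteq> 0\<^sub>v n"
  proof
    assume w0: "w = 0\<^sub>v n"
    have "g = unit_vec n 0"
    proof (rule eq_vecI)
      fix i assume "i < dim_vec (unit_vec n 0 :: real vec)"
      then have i: "i < n" by simp
      have "w $ i = 0" using w0 i by simp
      then show "g $ i = unit_vec n 0 $ i" using i g unfolding w_def by simp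
    qed (use g in auto)
    with False show False by simp
  qed
  then have ww: "w \<bullet> w > 0" using conjugate_square_greater_0_vec[OF w] by simp
  define c where "c = 2 / (w \<bullet> w)"
  define H where "H = mat n n (\<lambda>(i,j). (if i = j then 1 else 0) - c * (w $ i * w $ j))"
  have sp: "x \<bullet> y = (\<Sum>i<n. x $ i * y $ i)" if "y \<in> carrier_vec n" for x y :: "real vec"
    using that by (auto simp: scalar_prod_def atLeast0LessThan)
  have Hv: "H *\<^sub>v x = x - (c * (w \<bullet> x)) \<cdot>\<^sub>v w" if x: "x \<in> carrier_vec n" for x
  proof (rule eq_vecI)
    fix i assume "i < dim_vec (x - (c * (w \<bullet> x)) \<cdot>\<^sub>v w)"
    then have i: "i < n" using w by simp
    have "(H *\<^sub>v x) $ i = (\<Sum>j<n. H $$ (i,j) * x $ j)"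
      by (rule mult_mat_vec_sum[OF _ x i]) (simp add: H_def)
    also have "\<dots> = (\<Sum>j<n. (if i = j then x $ j else 0) - c * w $ i * (w $ j * x $ j))"
      using i by (intro sum.cong) (auto simp: H_def algebra_simps)
    also have "\<dots> = x $ i - c * w $ i * (w \<bullet> x)"
      unfolding sum_subtractf using i by (simp add: sp[OF x] sum_distrib_left)
    finally show "(H *\<^sub>v x) $ i = (x - (c * (w \<bullet> x)) \<cdot>\<^sub>v w) $ i"
      using i x w by simp
  qed (use w in \<open>auto simp: H_def\<close>)
  have u: "unit_vec n 0 \<in> carrier_vec n" "unit_vec n 0 \<bullet> unit_vec n 0 = (1::real)"
    using n by auto
  have wu: "w \<bullet> unit_vec n 0 = 1 - g \<bullet> unit_vec n 0"
    unfolding w_def using g u by (simp add: minus_scalar_prod_distrib[of _ n])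
  have wwe: "w \<bullet> w = 2 * (1 - g \<bullet> unit_vec n 0)"
  proof -
    have "w \<bullet> g = g \<bullet> unit_vec n 0 - 1"
      unfolding w_def using g u n by (simp add: minus_scalar_prod_distrib[of _ n])
    moreover have "w \<bullet> w = w \<bullet> unit_vec n 0 - w \<bullet> g"
      using w_def w g u by (metis scalar_prod_minus_distrib)
    ultimately show ?thesis using wu by simp
  qed
  show thesis
  proof (rule that)
    show Hc: "H \<in> carrier_mat n n" by (simp add: H_def)
    show "transpose_mat H = H" by (rule eq_matI) (auto simp: H_def)
    have "c * (w \<bullet> unit_vec n 0) = 1" using wu wwe ww unfolding c_def by simp
    then show "H *\<^sub>v unit_vec n 0 = g"
      using g u unfolding Hv[OF u(1)] w_def by auto
    show "H * H = 1\<^sub>m n"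
    proof (rule mat_col_eqI)
      fix j assume "j < dim_col (1\<^sub>m n :: real mat)"
      then have j: "j < n" by simp
      define e where "e = (unit_vec n j :: real vec)"
      have e: "e \<in> carrier_vec n" unfolding e_def by simp
      have *: "c * (w \<bullet> w) = 2" unfolding c_def using ww by simp
      have "col H j = H *\<^sub>v e"
        using Hc j unfolding e_def by (intro eq_vecI) auto
      then have "col (H * H) j = H *\<^sub>v (H *\<^sub>v e)"
        using col_mult2[OF Hc Hc j] by simp
      also have "\<dots> = e"
      proof -
        have He: "H *\<^sub>v e \<in> carrier_vec n" using Hc e by auto
        have "w \<bullet> (H *\<^sub>v e) = w \<bullet> e - c * (w \<bullet> e) * (w \<bullet> w)"
          unfolding Hv[OF e] using w e by (simp add: scalar_prod_minus_distrib[of _ n])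
        also have "\<dots> = - (w \<bullet> e)" using * by (simp add: algebra_simps)
        finally have "H *\<^sub>v (H *\<^sub>v e) = H *\<^sub>v e - (c * - (w \<bullet> e)) \<cdot>\<^sub>v w" using Hv[OF He] by simp
        also have "\<dots> = e" unfolding Hv[OF e] using w e by (intro eq_vecI) auto
        finally show ?thesis .
      qed
      finally show "col (H * H) j = col (1\<^sub>m n) j" using j unfolding e_def by simp
    qed (use Hc in auto)
  qed
qed

text \<open>Deflation: conjugating by a reflection that carries the first unit vector to an
  eigenvector clears the first column of \<open>C\<close> below the diagonal, and symmetry clears
  the first row too. The remaining block \<open>B\<close> is again symmetric.\<close>

theorem real_symmetric_diagonalization:
  fixes A :: "real mat"
  assumes "A \<in> carrier_mat n n" "transpose_mat A = A"
  shows "\<exists>p \<epsilon>. (\<forall>j<n. p j \<in> carrier_vec n \<and> A *\<^sub>v p j = \<epsilon> j \<cdot>\<^sub>v p j) \<and>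
    (\<forall>j<n. \<forall>k<n. p j \<bullet> p k = (if j = k then 1 else 0)) \<and>
    char_poly A = (\<Prod>j<n. [:- \<epsilon> j, 1:])"
  using assms
proof (induction n arbitrary: A)
  case 0
  then have "char_poly A = 1"
    using degree_monic_char_poly[OF 0(1)] by (auto elim!: degree_eq_zeroE simp: one_pCons)
  then show ?case by auto
next
  case (Suc n)
  note A = Suc.prems(1) and sym = Suc.prems(2)
  note assoc = assoc_mult_mat[of _ "Suc n" "Suc n" _ "Suc n" _ "Suc n"]
    assoc_mult_mat_vec[of _ "Suc n" "Suc n" _ "Suc n"]
  obtain g \<mu> where g: "g \<in> carrier_vec (Suc n)" "g \<bullet> g = 1" "A *\<^sub>v g = \<mu> \<cdot>\<^sub>v g"
    using real_symmetric_has_eigenvector[OF A sym] by blast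
  obtain H where H: "H \<in> carrier_mat (Suc n) (Suc n)" "transpose_mat H = H" "H * H = 1\<^sub>m (Suc n)"
    "H *\<^sub>v unit_vec (Suc n) 0 = g"
    using reflection_exists[OF g(1,2)] by blast
  have HHv: "H *\<^sub>v (H *\<^sub>v x) = x" if "x \<in> carrier_vec (Suc n)" for x
    using that H by (metis assoc_mult_mat_vec one_mult_mat_vec)
  have HHsp: "(H *\<^sub>v x) \<bullet> (H *\<^sub>v y) = x \<bullet> y"
    if "x \<in> carrier_vec (Suc n)" "y \<in> carrier_vec (Suc n)" for x y
    using that H HHv
    by (metis mult_mat_vec_carrier transpose_vec_mult_scalar)
  define C where "C = H * A * H"
  have C: "C \<in> carrier_mat (Suc n) (Suc n)" unfolding C_def using H A by auto
  have symC: "transpose_mat C = C"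
    unfolding C_def using H A sym
    by (simp add: transpose_mult[of _ "Suc n" "Suc n" _ "Suc n"] assoc)
  have AC: "A = H * C * H"
  proof -
    have "H * C * H = (H * H) * A * (H * H)" unfolding C_def
      using H(1) A by (simp add: assoc)
    then show ?thesis using H A by simp
  qed
  have Ce: "C *\<^sub>v unit_vec (Suc n) 0 = \<mu> \<cdot>\<^sub>v unit_vec (Suc n) 0"
  proof -
    have "C *\<^sub>v unit_vec (Suc n) 0 = H *\<^sub>v (A *\<^sub>v g)"
      unfolding C_def H(4)[symmetric] using H(1) A
      by (simp add: assoc)
    also have "\<dots> = \<mu> \<cdot>\<^sub>v (H *\<^sub>v g)" using g H(1) by (simp add: mult_mat_vec)
    also have "H *\<^sub>v g = unit_vec (Suc n) 0" using HHv H(4) by (metis unit_vec_carrier)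
    finally show ?thesis .
  qed
  have C0: "C $$ (i,0) = (if i = 0 then \<mu> else 0)" if "i < Suc n" for i
    using arg_cong[OF Ce, of "\<lambda>v. v $ i"] that C by simp
  have C0': "C $$ (0,i) = (if i = 0 then \<mu> else 0)" if "i < Suc n" for i
    using C0[OF that] symmetric_index[OF C symC, of 0 i] that by simp
  define B where "B = mat n n (\<lambda>(i,j). C $$ (Suc i, Suc j))"
  have B: "B \<in> carrier_mat n n" unfolding B_def by simp
  have symB: "transpose_mat B = B"
    unfolding B_def using symmetric_index[OF C symC] by (intro eq_matI) auto
  have CB: "C = four_block_mat (mat 1 1 (\<lambda>_. \<mu>)) (0\<^sub>m 1 n) (0\<^sub>m n 1) B"
    using C by (intro eq_matI) (auto simp: C0 C0' B_def)
  have "similar_mat A C"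
    by (rule similar_matI[of A C H H "Suc n"]) (use A C H AC in auto)
  then have "char_poly A = char_poly C" by (rule char_poly_similar)
  also have "\<dots> = char_poly (mat 1 1 (\<lambda>_. \<mu>)) * char_poly B"
    unfolding CB by (rule char_poly_four_block_zeros_col) (use B in auto)
  also have "char_poly (mat 1 1 (\<lambda>_. \<mu>)) = [:- \<mu>, 1:]"
    by (subst char_poly_upper_triangular[of _ 1]) (auto simp: diag_mat_def)
  finally have cp: "char_poly A = [:- \<mu>, 1:] * char_poly B" .
  obtain p \<epsilon> where p: "\<And>j. j < n \<Longrightarrow> p j \<in> carrier_vec n" "\<And>j. j < n \<Longrightarrow> B *\<^sub>v p j = \<epsilon> j \<cdot>\<^sub>v p j"
    "\<And>j k. j < n \<Longrightarrow> k < n \<Longrightarrow> p j \<bullet> p k = (if j = k then 1 else 0)"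
    "char_poly B = (\<Prod>j<n. [:- \<epsilon> j, 1:])"
    using Suc.IH[OF B symB] by metis
  define q where "q j = (case j of 0 \<Rightarrow> unit_vec (Suc n) 0 | Suc j' \<Rightarrow> vCons 0 (p j'))" for j
  define \<delta> where "\<delta> j = (case j of 0 \<Rightarrow> \<mu> | Suc j' \<Rightarrow> \<epsilon> j')" for j
  have q: "q j \<in> carrier_vec (Suc n)" if "j < Suc n" for j
    using that p(1) by (cases j) (auto simp: q_def)
  have u0: "unit_vec (Suc n) 0 = vCons 1 (0\<^sub>v n)"
    by (rule eq_vecI) (auto simp: vCons_def nth_Cons' split: nat.splits)
  have qq: "q j \<bullet> q k = (if j = k then 1 else 0)" if "j < Suc n" "k < Suc n" for j k
    using that p(1,3) by (cases j; cases k) (auto simp: q_def u0)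
  have Cq: "C *\<^sub>v q j = \<delta> j \<cdot>\<^sub>v q j" if j: "j < Suc n" for j
  proof (cases j)
    case 0
    then show ?thesis using Ce by (simp add: q_def \<delta>_def)
  next
    case (Suc j')
    then have j': "j' < n" using j by simp
    show ?thesis
    proof (rule eq_vecI)
      fix i assume "i < dim_vec (\<delta> j \<cdot>\<^sub>v q j)"
      then have i: "i < Suc n" using q[OF j] by simp
      have e: "(C *\<^sub>v q j) $ i = (\<Sum>l<n. C $$ (i, Suc l) * p j' $ l)"
        unfolding mult_mat_vec_sum[OF C q[OF j] i] sum.lessThan_Suc_shift
        using Suc by (simp add: q_def)
      show "(C *\<^sub>v q j) $ i = (\<delta> j \<cdot>\<^sub>v q j) $ i"
      proof (cases i)
        case 0
        then show ?thesis unfolding e using C0' p(1)[OF j'] Suc by (simp add: q_def)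
      next
        case (Suc i')
        then have i': "i' < n" using i by simp
        have "(\<Sum>l<n. C $$ (i, Suc l) * p j' $ l) = (B *\<^sub>v p j') $ i'"
          unfolding mult_mat_vec_sum[OF B p(1)[OF j'] i'] using Suc i' by (simp add: B_def)
        then show ?thesis unfolding e p(2)[OF j'] using Suc i' p(1)[OF j'] \<open>j = Suc j'\<close>
          by (simp add: q_def \<delta>_def)
      qed
    qed (use q[OF j] C in auto)
  qed
  show ?case
  proof (intro exI[of _ "\<lambda>j. H *\<^sub>v q j"] exI[of _ \<delta>] conjI allI impI)
    fix j assume j: "j < Suc n"
    show "H *\<^sub>v q j \<in> carrier_vec (Suc n)" using H(1) q[OF j] by auto
    have "A *\<^sub>v (H *\<^sub>v q j) = H *\<^sub>v (C *\<^sub>v (H *\<^sub>v (H *\<^sub>v q j)))"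
      unfolding AC using H(1) C q[OF j]
      by (simp add: assoc)
    also have "\<dots> = \<delta> j \<cdot>\<^sub>v (H *\<^sub>v q j)"
      using H(1) q[OF j] by (simp add: HHv Cq[OF j] mult_mat_vec)
    finally show "A *\<^sub>v (H *\<^sub>v q j) = \<delta> j \<cdot>\<^sub>v (H *\<^sub>v q j)" .
    fix k assume k: "k < Suc n"
    show "(H *\<^sub>v q j) \<bullet> (H *\<^sub>v q k) = (if j = k then 1 else 0)"
      using HHsp[OF q[OF j] q[OF k]] qq[OF j k] by simp
  next
    show "char_poly A = (\<Prod>j<Suc n. [:- \<delta> j, 1:])"
      unfolding cp p(4) prod.lessThan_Suc_shift by (simp add: \<delta>_def)
  qed
qed

subsection \<open>The expected characteristic polynomial of a random signing\<close>

text \<open>Determinant of a principal submatrix without renumbering its indices, because the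
  recursion below deletes arbitrary vertices.\<close>

definition detS :: "nat set \<Rightarrow> (nat \<Rightarrow> nat \<Rightarrow> real) \<Rightarrow> real" where
  "detS S M = (\<Sum>p | p permutes S. of_int (sign p) * (\<Prod>i\<in>S. M i (p i)))"

text \<open>\<open>E\<close> is meant to contain one orientation of each edge, so both orders are
  looked up; the edges in \<open>X\<close> get the sign -1.\<close>

definition signing :: "(nat \<times> nat) set \<Rightarrow> (nat \<times> nat) set \<Rightarrow> nat \<Rightarrow> nat \<Rightarrow> real" where
  "signing E X i j = (if (i,j) \<in> E then if (i,j) \<in> X then -1 else 1
     else if (j,i) \<in> E then if (j,i) \<in> X then -1 else 1 else 0)"

text \<open>The sum over all signings, that is, \<open>2 ^ card E\<close> times the expectation.\<close>
definition expected_char :: "(nat \<times> nat) set \<Rightarrow> real \<Rightarrow> nat set \<Rightarrow> real" where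
  "expected_char E x S =
     (\<Sum>X\<in>Pow E. detS S (\<lambda>i j. (if i = j then x else 0) - signing E X i j))"

lemma sum_Pow_toggle:
  fixes f :: "'a set \<Rightarrow> real"
  assumes "finite E" "e \<in> E" and "\<And>X. X \<subseteq> E \<Longrightarrow> e \<notin> X \<Longrightarrow> f (insert e X) = - f X"
  shows "(\<Sum>X\<in>Pow E. f X) = 0"
proof -
  have E: "insert e (E - {e}) = E" using assms by auto
  have "Pow E = Pow (E - {e}) \<union> insert e ` Pow (E - {e})"
    using Pow_insert[of e "E - {e}"] unfolding E .
  moreover have "Pow (E - {e}) \<inter> insert e ` Pow (E - {e}) = {}" by auto
  moreover have "inj_on (insert e) (Pow (E - {e}))" by (rule inj_onI) auto
  ultimately have "(\<Sum>X\<in>Pow E. f X) = (\<Sum>X\<in>Pow (E-{e}). f X) + (\<Sum>X\<in>Pow (E-{e}). f (insert e X))"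
    using assms(1) by (simp add: sum.union_disjoint sum.reindex)
  also have "(\<Sum>X\<in>Pow (E-{e}). f (insert e X)) = (\<Sum>X\<in>Pow (E-{e}). - f X)"
    by (rule sum.cong) (auto intro!: assms(3))
  finally show ?thesis by (simp add: sum_negf)
qed

text \<open>An edge that a permutation traverses in one direction only has a sign that occurs once in the
  product, so it averages out.\<close>
lemma sum_signings_eq_0:
  fixes x :: real
  assumes E: "finite E" "\<And>i j. (i,j) \<in> E \<Longrightarrow> (j,i) \<notin> E" "\<And>i. (i,i) \<notin> E"
    and S: "finite S" "v \<in> S" and p: "p permutes S" "p v \<noteq> v" "p (p v) \<noteq> v"
  shows "(\<Sum>X\<in>Pow E. \<Prod>i\<in>S. (if i = p i then x else 0) - signing E X i (p i)) = 0"
proof (cases "(v, p v) \<in> E \<or> (p v, v) \<in> E")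
  case False
  then have z: "(if v = p v then x else 0) - signing E X v (p v) = 0" for X
    using p by (auto simp: signing_def)
  have "(\<Prod>i\<in>S. (if i = p i then x else 0) - signing E X i (p i)) = 0" for X
    by (rule prod_zero[OF S(1)], rule bexI[of _ v], rule z, rule S(2))
  then show ?thesis by simp
next
  case True
  then obtain e where e: "e \<in> E" "e = (v, p v) \<or> e = (p v, v)" by auto
  show ?thesis
  proof (rule sum_Pow_toggle[OF E(1) e(1)])
    fix X assume X: "X \<subseteq> E" "e \<notin> X"
    have neq: "{i, p i} \<noteq> {v, p v}" if "i \<in> S - {v}" for i
    proof
      assume *: "{i, p i} = {v, p v}"
      then have "i = p v" "p i = v" using that p(2) by (auto simp: doubleton_eq_iff)
      then show False using p by simp
    qed
    have same: "signing E (insert e X) i (p i) = signing E X i (p i)" if "i \<in> S - {v}" for i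
      using neq[OF that] e(2) by (auto simp: signing_def)
    have flip: "signing E (insert e X) v (p v) = - signing E X v (p v)"
      using e X by (auto simp: signing_def dest: E(2))
    let ?f = "\<lambda>X i. (if i = p i then x else 0) - signing E X i (p i)"
    have "prod (?f (insert e X)) S = ?f (insert e X) v * prod (?f (insert e X)) (S - {v})"
      using S by (rule prod.remove)
    also have "prod (?f (insert e X)) (S - {v}) = prod (?f X) (S - {v})"
      by (rule prod.cong) (use same in auto)
    also have "?f (insert e X) v = - ?f X v" using flip p by auto
    also have "- ?f X v * prod (?f X) (S - {v}) = - prod (?f X) S"
      by (simp only: prod.remove[OF S, of "?f X"] mult_minus_left)
    finally show "prod (?f (insert e X)) S = - prod (?f X) S" .
  qed
qed

lemma permutes_remove2:
  assumes "p permutes S" "p v = w" "p w = v" "v \<noteq> w"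
  shows "p \<circ> transpose v w permutes S - {v,w}"
proof -
  have "v \<in> S" "w \<in> S" using assms by (metis permutes_not_in)+
  then have 1: "p \<circ> transpose v w permutes S"
    using assms by (intro permutes_compose permutes_swap_id) auto
  show ?thesis
    by (rule permutes_superset[OF 1]) (use assms in \<open>auto simp: transpose_def\<close>)
qed

lemma detS_fix:
  assumes "finite S" "v \<in> S"
  shows "(\<Sum>p | p permutes S \<and> p v = v. of_int (sign p) * (\<Prod>i\<in>S. M i (p i)))
    = M v v * detS (S - {v}) M"
proof -
  have eq: "{p. p permutes S \<and> p v = v} = {p. p permutes (S - {v})}"
  proof (rule Set.set_eqI, rule iffI)
    fix p assume "p \<in> {p. p permutes S \<and> p v = v}"
    then show "p \<in> {p. p permutes (S - {v})}"
      by (auto intro!: permutes_superset[of p S])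
  next
    fix p assume "p \<in> {p. p permutes (S - {v})}"
    then show "p \<in> {p. p permutes S \<and> p v = v}"
      by (auto intro: permutes_subset permutes_not_in)
  qed
  have "(\<Prod>i\<in>S. M i (p i)) = M v v * (\<Prod>i\<in>S-{v}. M i (p i))" if "p permutes (S - {v})" for p
    using prod.remove[OF assms, of "\<lambda>i. M i (p i)"] permutes_not_in[OF that, of v] by simp
  then show ?thesis
    unfolding eq detS_def sum_distrib_left by (intro sum.cong) (auto simp: mult_ac)
qed

lemma detS_swap:
  assumes "finite S" "v \<in> S" "w \<in> S" "v \<noteq> w"
  shows "(\<Sum>p | p permutes S \<and> p v = w \<and> p w = v. of_int (sign p) * (\<Prod>i\<in>S. M i (p i)))
    = - (M v w * M w v * detS (S - {v,w}) M)"
proof -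
  let ?t = "transpose v w"
  have "(\<Sum>p | p permutes S \<and> p v = w \<and> p w = v. of_int (sign p) * (\<Prod>i\<in>S. M i (p i)))
    = (\<Sum>q | q permutes (S - {v,w}). - (M v w * M w v) * (of_int (sign q) * (\<Prod>i\<in>S-{v,w}. M i (q i))))"
  proof (rule sum.reindex_bij_witness[of _ "\<lambda>q. q \<circ> ?t" "\<lambda>p. p \<circ> ?t"])
    fix p assume "p \<in> {p. p permutes S \<and> p v = w \<and> p w = v}"
    then have p: "p permutes S" "p v = w" "p w = v" by auto
    show "p \<circ> ?t \<circ> ?t = p" by (simp add: comp_assoc)
    show "p \<circ> ?t \<in> {q. q permutes (S - {v,w})}" using permutes_remove2[OF p assms(4)] by simp
    have fp: "permutation p" using p(1) assms(1) unfolding permutation_permutes by blast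
    have ft: "permutation ?t" by (rule permutation_swap_id)
    have sg: "sign (p \<circ> ?t) = - sign p"
      using assms(4) by (simp add: sign_compose[OF fp ft] sign_swap_id)
    have "(\<Prod>i\<in>S. M i (p i)) = M v w * (M w v * (\<Prod>i\<in>S-{v}-{w}. M i (p i)))"
      using assms p prod.remove[of S v "\<lambda>i. M i (p i)"] prod.remove[of "S-{v}" w "\<lambda>i. M i (p i)"] by simp
    moreover have "(\<Prod>i\<in>S-{v}-{w}. M i (p i)) = (\<Prod>i\<in>S-{v,w}. M i ((p \<circ> ?t) i))"
      by (rule prod.cong) (auto simp: transpose_def)
    ultimately show "- (M v w * M w v) * (of_int (sign (p \<circ> ?t)) * (\<Prod>i\<in>S-{v,w}. M i ((p \<circ> ?t) i)))
      = of_int (sign p) * (\<Prod>i\<in>S. M i (p i))"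
      unfolding sg by simp
  next
    fix q assume "q \<in> {q. q permutes (S - {v,w})}"
    then have q: "q permutes (S - {v,w})" by auto
    show "q \<circ> ?t \<circ> ?t = q" by (simp add: comp_assoc)
    have "q permutes S" by (rule permutes_subset[OF q]) auto
    moreover have "q v = v" "q w = w" using q by (auto intro: permutes_not_in)
    ultimately show "q \<circ> ?t \<in> {p. p permutes S \<and> p v = w \<and> p w = v}"
      using assms by (auto intro!: permutes_compose permutes_swap_id)
  qed
  then show ?thesis unfolding detS_def sum_distrib_left[symmetric] by simp
qed

text \<open>This is the recursion of the matching polynomial.\<close>
lemma expected_char_rec:
  assumes E: "finite E" "\<And>i j. (i,j) \<in> E \<Longrightarrow> (j,i) \<notin> E" "\<And>i. (i,i) \<notin> E"
    and S: "finite S" "v \<in> S"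
  shows "expected_char E x S = x * expected_char E x (S - {v})
    - (\<Sum>w | w \<in> S \<and> ((v,w) \<in> E \<or> (w,v) \<in> E). expected_char E x (S - {v,w}))"
proof -
  define M where "M X i j = (if i = j then x else 0) - signing E X i j" for X i j
  define g where "g X p = of_int (sign p) * (\<Prod>i\<in>S. M X i (p i))" for X p
  define P1 where "P1 = {p. p permutes S \<and> p v = v}"
  define P2 where "P2 w = {p. p permutes S \<and> p v = w \<and> p w = v}" for w
  define P3 where "P3 = {p. p permutes S \<and> p v \<noteq> v \<and> p (p v) \<noteq> v}"
  have finP: "finite {p. p permutes S}" by (rule finite_permutations[OF S(1)])
  have fin: "finite P1" "finite (P2 w)" "finite P3" for w
    unfolding P1_def P2_def P3_def by (auto intro: finite_subset[OF _ finP])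
  \<comment> \<open>Permutations are sorted by the cycle through \<open>v\<close>: a fixed point, a
    transposition, or a longer cycle. The last kind averages out, so only matchings survive.\<close>
  have split: "{p. p permutes S} = P1 \<union> (\<Union>w\<in>S-{v}. P2 w) \<union> P3"
    unfolding P1_def P2_def P3_def using S by (auto simp: permutes_in_image)
  have "detS S (M X) = (\<Sum>p\<in>P1. g X p) + (\<Sum>w\<in>S-{v}. \<Sum>p\<in>P2 w. g X p) + (\<Sum>p\<in>P3. g X p)" for X
  proof -
    have "detS S (M X) = sum (g X) (P1 \<union> (\<Union>w\<in>S-{v}. P2 w) \<union> P3)"
      unfolding detS_def split[symmetric] g_def ..
    also have "\<dots> = sum (g X) (P1 \<union> (\<Union>w\<in>S-{v}. P2 w)) + sum (g X) P3"
      by (rule sum.union_disjoint) (use fin S in \<open>auto simp: P1_def P2_def P3_def\<close>)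
    also have "sum (g X) (P1 \<union> (\<Union>w\<in>S-{v}. P2 w)) = sum (g X) P1 + sum (g X) (\<Union>w\<in>S-{v}. P2 w)"
      by (rule sum.union_disjoint) (use fin S in \<open>auto simp: P1_def P2_def P3_def\<close>)
    also have "sum (g X) (\<Union>w\<in>S-{v}. P2 w) = (\<Sum>w\<in>S-{v}. sum (g X) (P2 w))"
      by (rule sum.UNION_disjoint) (use fin S in \<open>auto simp: P2_def\<close>)
    finally show ?thesis .
  qed
  then have "expected_char E x S = (\<Sum>X\<in>Pow E. \<Sum>p\<in>P1. g X p)
     + (\<Sum>X\<in>Pow E. \<Sum>w\<in>S-{v}. \<Sum>p\<in>P2 w. g X p) + (\<Sum>X\<in>Pow E. \<Sum>p\<in>P3. g X p)"
    unfolding expected_char_def M_def[symmetric] by (simp add: sum.distrib)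
  moreover have "(\<Sum>X\<in>Pow E. \<Sum>p\<in>P1. g X p) = x * expected_char E x (S - {v})"
  proof -
    have "(\<Sum>p\<in>P1. g X p) = x * detS (S - {v}) (M X)" for X
      unfolding P1_def g_def detS_fix[OF S] by (simp add: M_def signing_def E(3))
    then show ?thesis unfolding expected_char_def M_def[symmetric] by (simp add: sum_distrib_left)
  qed
  moreover have "(\<Sum>X\<in>Pow E. \<Sum>w\<in>S-{v}. \<Sum>p\<in>P2 w. g X p)
    = - (\<Sum>w | w \<in> S \<and> ((v,w) \<in> E \<or> (w,v) \<in> E). expected_char E x (S - {v,w}))"
  proof -
    have *: "(\<Sum>p\<in>P2 w. g X p) = (if (v,w) \<in> E \<or> (w,v) \<in> E then - detS (S - {v,w}) (M X) else 0)"
      if "w \<in> S - {v}" for X w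
    proof -
      have "(\<Sum>p\<in>P2 w. g X p) = - (M X v w * M X w v * detS (S - {v,w}) (M X))"
        unfolding P2_def g_def by (rule detS_swap) (use S that in auto)
      then show ?thesis using that by (auto simp: M_def signing_def dest: E(2))
    qed
    have "(\<Sum>X\<in>Pow E. \<Sum>w\<in>S-{v}. \<Sum>p\<in>P2 w. g X p)
      = (\<Sum>X\<in>Pow E. \<Sum>w\<in>S-{v}. if (v,w) \<in> E \<or> (w,v) \<in> E then - detS (S - {v,w}) (M X) else 0)"
      by (intro sum.cong refl *)
    also have "\<dots> = (\<Sum>w\<in>S-{v}. \<Sum>X\<in>Pow E. if (v,w) \<in> E \<or> (w,v) \<in> E then - detS (S - {v,w}) (M X) else 0)"
      by (rule sum.swap)
    also have "\<dots> = (\<Sum>w\<in>S-{v}. if (v,w) \<in> E \<or> (w,v) \<in> E then - expected_char E x (S - {v,w}) else 0)"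
      by (rule sum.cong) (auto simp: expected_char_def M_def[symmetric] sum_negf)
    also have "\<dots> = (\<Sum>w | w \<in> S - {v} \<and> ((v,w) \<in> E \<or> (w,v) \<in> E). - expected_char E x (S - {v,w}))"
      by (subst sum.inter_filter[symmetric]) (use S in auto)
    also have "{w. w \<in> S - {v} \<and> ((v,w) \<in> E \<or> (w,v) \<in> E)} = {w. w \<in> S \<and> ((v,w) \<in> E \<or> (w,v) \<in> E)}"
      using E by auto
    finally show ?thesis by (simp add: sum_negf)
  qed
  moreover have "(\<Sum>X\<in>Pow E. \<Sum>p\<in>P3. g X p) = 0"
  proof -
    have "(\<Sum>X\<in>Pow E. \<Sum>p\<in>P3. g X p) = (\<Sum>p\<in>P3. \<Sum>X\<in>Pow E. g X p)"
      by (rule sum.swap)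
    also have "\<dots> = 0"
    proof (rule sum.neutral, rule ballI)
      fix p assume "p \<in> P3"
      then have p: "p permutes S" "p v \<noteq> v" "p (p v) \<noteq> v" by (auto simp: P3_def)
      show "(\<Sum>X\<in>Pow E. g X p) = 0"
        unfolding g_def M_def sum_distrib_left[symmetric]
        using sum_signings_eq_0[OF E S p] by simp
    qed
    finally show ?thesis .
  qed
  ultimately show ?thesis by simp
qed

text \<open>The Heilmann-Lieb bound for the matching polynomial. Divided by the value at
  \<open>S - {v}\<close>, the recursion reads x minus a sum of reciprocal ratios. If
  \<open>v\<close> has a neighbour outside \<open>S\<close>, at most \<open>k\<close> terms remain,
  each at most 1/\<theta> by induction, so the ratio is at least 2 \<theta> - k/\<theta> =
  \<theta>.\<close>

lemma expected_char_ratio: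
  assumes E: "finite E" "\<And>i j. (i,j) \<in> E \<Longrightarrow> (j,i) \<notin> E" "\<And>i. (i,i) \<notin> E"
    and deg: "\<And>v. card {w. (v,w) \<in> E \<or> (w,v) \<in> E} \<le> Suc k"
    and x: "\<theta> > 1" "\<theta>\<^sup>2 = real k" "x \<ge> 2 * \<theta>" and S: "finite S"
  shows "expected_char E x S > 0 \<and> (\<forall>v\<in>S. (\<exists>w. w \<notin> S \<and> ((v,w) \<in> E \<or> (w,v) \<in> E)) \<longrightarrow>
      expected_char E x S \<ge> \<theta> * expected_char E x (S - {v}))"
  using S
proof (induction "card S" arbitrary: S rule: less_induct)
  case less
  define N where "N v = {w. (v,w) \<in> E \<or> (w,v) \<in> E}" for v
  have finN: "finite (N v)" for v
  proof -
    have "N v \<subseteq> fst ` E \<union> snd ` E" unfolding N_def by force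
    then show ?thesis using E(1) by (meson finite_UnI finite_imageI finite_subset)
  qed
  \<comment> \<open>Every neighbour \<open>w\<close> of \<open>v\<close> in \<open>S\<close> has the
    neighbour \<open>v\<close> outside \<open>S - {v}\<close>, so the inductive ratio bound applies
    to \<open>w\<close> there.\<close>
  have bound: "expected_char E x S \<ge> (x - m / \<theta>) * expected_char E x (S - {v})"
    if v: "v \<in> S" and m: "real (card (S \<inter> N v)) \<le> m" for v m
  proof -
    have pos: "expected_char E x (S - {v}) > 0"
      using less.hyps[OF card_Diff1_less[OF less.prems v]] less.prems by blast
    have "expected_char E x (S - {v,w}) \<le> expected_char E x (S - {v}) / \<theta>" if w: "w \<in> S \<inter> N v" for w
    proof -
      have "w \<noteq> v" using w E(3) by (auto simp: N_def)
      have IH: "\<forall>a\<in>S - {v}. (\<exists>w. w \<notin> S - {v} \<and> ((a, w) \<in> E \<or> (w, a) \<in> E)) \<longrightarrow>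
          expected_char E x (S - {v}) \<ge> \<theta> * expected_char E x (S - {v} - {a})"
        using less.hyps[OF card_Diff1_less[OF less.prems v]] less.prems by blast
      have "expected_char E x (S - {v}) \<ge> \<theta> * expected_char E x (S - {v} - {w})"
        using w \<open>w \<noteq> v\<close> by (intro IH[rule_format] exI[of _ v]) (auto simp: N_def)
      moreover have "S - {v} - {w} = S - {v,w}" by auto
      ultimately show ?thesis using x(1) by (simp add: field_simps)
    qed
    then have "(\<Sum>w\<in>S \<inter> N v. expected_char E x (S - {v,w})) \<le> card (S \<inter> N v) * (expected_char E x (S - {v}) / \<theta>)"
      by (rule sum_bounded_above)
    also have "\<dots> \<le> m * (expected_char E x (S - {v}) / \<theta>)"
      by (rule mult_right_mono[OF m]) (use pos x(1) in auto)
    finally have "(\<Sum>w\<in>S \<inter> N v. expected_char E x (S - {v,w})) \<le> m / \<theta> * expected_char E x (S - {v})"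
      by simp
    moreover have "{w. w \<in> S \<and> ((v,w) \<in> E \<or> (w,v) \<in> E)} = S \<inter> N v" by (auto simp: N_def)
    ultimately show ?thesis
      using expected_char_rec[OF E less.prems v, of x] by (simp add: algebra_simps)
  qed
  have kth: "real k / \<theta> = \<theta>" using x by (simp add: field_simps power2_eq_square)
  show ?case
  proof (intro conjI ballI impI)
    show "expected_char E x S > 0"
    proof (cases "S = {}")
      case True
      then show ?thesis
        using E(1) by (simp add: expected_char_def detS_def card_Pow)
    next
      case False
      then obtain v where v: "v \<in> S" by auto
      have "card (S \<inter> N v) \<le> Suc k"
        using deg[of v] finN[of v] card_mono[of "N v" "S \<inter> N v"] by (auto simp: N_def)
      then have "expected_char E x S \<ge> (x - real (Suc k) / \<theta>) * expected_char E x (S - {v})"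
        using bound[OF v, of "real (Suc k)"] by linarith
      \<comment> \<open>For positivity all \<open>Suc k\<close> neighbours may lie in
        \<open>S\<close>; what is left is at least \<theta> - 1/\<theta>, positive because \<theta>
        > 1.\<close>
      moreover have "x - real (Suc k) / \<theta> > 0"
      proof -
        have "real (Suc k) / \<theta> = \<theta> + 1 / \<theta>" using kth by (simp add: add_divide_distrib)
        moreover have "1 / \<theta> < \<theta>" using x(1) by (smt (verit) divide_less_eq_1_pos)
        ultimately show ?thesis using x by simp
      qed
      moreover have "expected_char E x (S - {v}) > 0"
        using less.hyps[OF card_Diff1_less[OF less.prems v]] less.prems by blast
      ultimately show ?thesis by (smt (verit) mult_pos_pos)
    qed
  next
    fix v assume v: "v \<in> S" and "\<exists>w. w \<notin> S \<and> ((v,w) \<in> E \<or> (w,v) \<in> E)"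
    then obtain w where w: "w \<in> N v" "w \<notin> S" by (auto simp: N_def)
    then have "card (S \<inter> N v) < card (N v)"
      using finN[of v] by (intro psubset_card_mono) auto
    then have "real (card (S \<inter> N v)) \<le> real k" using deg[of v] by (simp add: N_def)
    then have "expected_char E x S \<ge> (x - real k / \<theta>) * expected_char E x (S - {v})"
      using bound[OF v] by blast
    moreover have "expected_char E x (S - {v}) > 0"
      using less.hyps[OF card_Diff1_less[OF less.prems v]] less.prems by blast
    moreover have "x - real k / \<theta> \<ge> \<theta>" using kth x by simp
    ultimately show "expected_char E x S \<ge> \<theta> * expected_char E x (S - {v})"
      by (smt (verit) mult_right_mono)
  qed
qed

subsection \<open>Sums of independent rank-one matrices\<close>

definition outer :: "nat \<Rightarrow> (nat \<Rightarrow> 'a::comm_ring_1) \<Rightarrow> 'a mat" where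
  "outer n r = mat n n (\<lambda>(i,j). r i * r j)"

lemma outer_carrier [simp]: "outer n r \<in> carrier_mat n n"
  by (simp add: outer_def)

lemma outer_dim [simp]: "dim_row (outer n r) = n" "dim_col (outer n r) = n"
  by (simp_all add: outer_def)

text \<open>Border \<open>N\<close> by a row \<open>R\<close> and a column \<open>C z\<close> that
  is linear in \<open>z\<close>. The Schur complement of the corner is the updated matrix, and the
  cofactors along the first column do not involve that column, so the expansion is affine in
  \<open>z\<close>.\<close>

lemma det_rank_one_update:
  fixes N :: "complex mat"
  assumes N: "N \<in> carrier_mat n n"
  shows "\<exists>g. \<forall>z. det (N + z \<cdot>\<^sub>m outer n r) = det N + z * g"
proof -
  define R where "R = mat 1 n (\<lambda>(i::nat,j). r j)"
  define C where "C z = mat n 1 (\<lambda>(i,j::nat). - z * r i)" for z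
  define X where "X z = four_block_mat (1\<^sub>m 1) R (C z) N" for z
  have car: "R \<in> carrier_mat 1 n" "C z \<in> carrier_mat n 1" "X z \<in> carrier_mat (Suc n) (Suc n)" for z
    using N by (auto simp: R_def C_def X_def)
  have detX: "det (X z) = det (N + z \<cdot>\<^sub>m outer n r)" for z
  proof -
    let ?L = "four_block_mat (1\<^sub>m 1) (0\<^sub>m 1 n) (C z) (1\<^sub>m n)"
    let ?U = "four_block_mat (1\<^sub>m 1) R (0\<^sub>m n 1) (N + z \<cdot>\<^sub>m outer n r)"
    have CR: "C z * R + (N + z \<cdot>\<^sub>m outer n r) = N"
      using N by (intro eq_matI) (auto simp: C_def R_def outer_def scalar_prod_def)
    have "?L * ?U = four_block_mat (1\<^sub>m 1 * 1\<^sub>m 1 + 0\<^sub>m 1 n * 0\<^sub>m n 1) (1\<^sub>m 1 * R + 0\<^sub>m 1 n * (N + z \<cdot>\<^sub>m outer n r))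
        (C z * 1\<^sub>m 1 + 1\<^sub>m n * 0\<^sub>m n 1) (C z * R + 1\<^sub>m n * (N + z \<cdot>\<^sub>m outer n r))"
      by (rule mult_four_block_mat[where ?nr1.0=1 and ?n1.0=1 and ?n2.0=n and ?nr2.0=n and ?nc1.0=1 and ?nc2.0=n])
        (use N car in auto)
    also have "\<dots> = X z" unfolding X_def
      using N car CR right_mult_one_mat[OF car(2)[of z]] right_add_zero_mat[OF car(2)[of z]]
      by (simp add: left_mult_zero_mat[of _ n n])
    finally have LU: "?L * ?U = X z" .
    have "?L \<in> carrier_mat (1 + n) (1 + n)" "?U \<in> carrier_mat (1 + n) (1 + n)"
      by (rule four_block_carrier_mat; use N in simp)+
    from det_mult[OF this] have "det (X z) = det ?L * det ?U" unfolding LU .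
    moreover have "det ?L = 1"
      using det_four_block_mat_upper_right_zero[OF _ refl car(2), of "1\<^sub>m 1" "1\<^sub>m n"] by simp
    moreover have "det ?U = det (N + z \<cdot>\<^sub>m outer n r)"
      by (subst det_four_block_mat_lower_left_zero[of _ 1 _ n]) (use N car in auto)
    ultimately show ?thesis by simp
  qed
  have "mat_delete (X z) i 0 = mat_delete (X 0) i 0" for z i
    by (rule eq_matI) (auto simp: mat_delete_def X_def C_def R_def)
  then have cof: "cofactor (X z) i 0 = cofactor (X 0) i 0" for z i
    unfolding cofactor_def by metis
  have X0: "X z $$ (0,0) = 1" "i < n \<Longrightarrow> X z $$ (Suc i,0) = - z * r i" for z i
    using N by (auto simp: X_def C_def)
  have lap: "det (X z) = cofactor (X 0) 0 0 + z * (\<Sum>i<n. - r i * cofactor (X 0) (Suc i) 0)" for z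
  proof -
    have "det (X z) = (\<Sum>i<Suc n. X z $$ (i,0) * cofactor (X z) i 0)"
      by (rule laplace_expansion_column[OF car(3)]) simp
    also have "\<dots> = cofactor (X 0) 0 0 + (\<Sum>i<n. - z * r i * cofactor (X 0) (Suc i) 0)"
      unfolding sum.lessThan_Suc_shift cof[of z] X0(1)
      by (intro arg_cong2[of _ _ _ _ "(+)"] sum.cong refl) (simp_all add: X0(2))
    finally show ?thesis by (simp add: sum_distrib_left mult.assoc sum_negf)
  qed
  have "det N = cofactor (X 0) 0 0"
  proof -
    have "N + 0 \<cdot>\<^sub>m outer n r = N" using N by (intro eq_matI) auto
    then show ?thesis using lap[of 0] detX[of 0] by simp
  qed
  then have "det (N + z \<cdot>\<^sub>m outer n r) = det N + z * (\<Sum>i<n. - r i * cofactor (X 0) (Suc i) 0)" for z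
    using lap[of z] detX[of z] by simp
  then show ?thesis by blast
qed

text \<open>The Siegel upper half space: symmetric matrices with positive definite imaginary part.\<close>
definition siegel :: "nat \<Rightarrow> complex mat \<Rightarrow> bool" where
  "siegel n N \<longleftrightarrow> N \<in> carrier_mat n n \<and> (\<forall>i<n. \<forall>j<n. N $$ (i,j) = N $$ (j,i)) \<and>
    (\<forall>v. (\<exists>i<n. v i \<noteq> 0) \<longrightarrow> (\<Sum>i<n. \<Sum>j<n. Im (N $$ (i,j)) * (v i * v j)) > 0)"

text \<open>For a kernel vector \<open>v\<close> the sum \<open>T\<close> of conj(v_i) N_ij v_j
  vanishes. Adding \<open>T\<close> to its transposed version makes the coefficients of N_ij real,
  so the imaginary part is the form of Im N at the real and imaginary parts of \<open>v\<close>, one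
  of which is nonzero.\<close>

lemma siegel_det_nonzero:
  assumes "siegel n N"
  shows "det N \<noteq> 0"
proof
  have N: "N \<in> carrier_mat n n" and sym: "\<And>i j. i < n \<Longrightarrow> j < n \<Longrightarrow> N $$ (i,j) = N $$ (j,i)"
    and pos: "\<And>v. (\<exists>i<n. v i \<noteq> 0) \<Longrightarrow> (\<Sum>i<n. \<Sum>j<n. Im (N $$ (i,j)) * (v i * v j)) > 0"
    using assms by (auto simp: siegel_def)
  assume "det N = 0"
  then obtain v where v: "v \<in> carrier_vec n" "v \<noteq> 0\<^sub>v n" "N *\<^sub>v v = 0\<^sub>v n"
    using det_0_iff_vec_prod_zero[OF N] by auto
  define T where "T = (\<Sum>i<n. \<Sum>j<n. N $$ (i,j) * (cnj (v $ i) * v $ j))"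
  define q where "q f = (\<Sum>i<n. \<Sum>j<n. Im (N $$ (i,j)) * (f i * f j))" for f :: "nat \<Rightarrow> real"
  have "T = (\<Sum>i<n. cnj (v $ i) * (N *\<^sub>v v) $ i)"
    unfolding T_def
    by (intro sum.cong refl) (simp add: mult_mat_vec_sum[OF N v(1)] sum_distrib_left mult_ac del: index_mult_mat_vec)
  then have T0: "T = 0" unfolding v(3) by simp
  have "T = (\<Sum>j<n. \<Sum>i<n. N $$ (i,j) * (cnj (v $ i) * v $ j))"
    unfolding T_def by (rule sum.swap)
  also have "\<dots> = (\<Sum>i<n. \<Sum>j<n. N $$ (i,j) * (v $ i * cnj (v $ j)))"
    by (intro sum.cong refl) (use sym in \<open>auto simp: mult_ac\<close>)
  finally have "T + T = (\<Sum>i<n. \<Sum>j<n. N $$ (i,j) * (cnj (v $ i) * v $ j + v $ i * cnj (v $ j)))"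
    unfolding T_def by (simp add: sum.distrib distrib_left)
  also have "\<dots> = (\<Sum>i<n. \<Sum>j<n. N $$ (i,j) * of_real (2 * (Re (v $ i) * Re (v $ j) + Im (v $ i) * Im (v $ j))))"
    by (intro sum.cong refl arg_cong2[of _ _ _ _ "(*)"]) (auto simp: complex_eq_iff algebra_simps)
  finally have "Im (T + T) = 2 * (q (\<lambda>i. Re (v $ i)) + q (\<lambda>i. Im (v $ i)))"
    unfolding q_def by (simp add: sum.distrib sum_distrib_left algebra_simps)
  then have q0: "q (\<lambda>i. Re (v $ i)) + q (\<lambda>i. Im (v $ i)) = 0" using T0 by simp
  have nn: "q f \<ge> 0" for f
    using pos[of f] unfolding q_def by (cases "\<exists>i<n. f i \<noteq> 0") (auto intro: sum_nonneg)
  have "\<exists>i<n. v $ i \<noteq> 0"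
    using v by (metis carrier_vecD eq_vecI index_zero_vec(1) index_zero_vec(2))
  then obtain i where "i < n" "Re (v $ i) \<noteq> 0 \<or> Im (v $ i) \<noteq> 0"
    by (auto simp: complex_eq_iff)
  then have "q (\<lambda>i. Re (v $ i)) > 0 \<or> q (\<lambda>i. Im (v $ i)) > 0"
    using pos[of "\<lambda>i. Re (v $ i)", folded q_def] pos[of "\<lambda>i. Im (v $ i)", folded q_def] by blast
  with nn[of "\<lambda>i. Re (v $ i)"] nn[of "\<lambda>i. Im (v $ i)"] q0 show False by linarith
qed

lemma siegel_rank_one_update:
  assumes "siegel n N" "Im z \<ge> 0"
  shows "siegel n (N + z \<cdot>\<^sub>m outer n (\<lambda>i. of_real (r i)))"
proof -
  have N: "N \<in> carrier_mat n n" using assms by (auto simp: siegel_def)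
  have "(\<Sum>i<n. \<Sum>j<n. Im ((N + z \<cdot>\<^sub>m outer n (\<lambda>i. of_real (r i))) $$ (i,j)) * (v i * v j))
    = (\<Sum>i<n. \<Sum>j<n. Im (N $$ (i,j)) * (v i * v j)) + Im z * (\<Sum>i<n. r i * v i)\<^sup>2" for v
  proof -
    have "(\<Sum>i<n. \<Sum>j<n. Im ((N + z \<cdot>\<^sub>m outer n (\<lambda>i. of_real (r i))) $$ (i,j)) * (v i * v j))
      = (\<Sum>i<n. \<Sum>j<n. Im (N $$ (i,j)) * (v i * v j) + Im z * ((r i * v i) * (r j * v j)))"
      by (intro sum.cong refl) (use N in \<open>auto simp: outer_def algebra_simps\<close>)
    also have "\<dots> = (\<Sum>i<n. \<Sum>j<n. Im (N $$ (i,j)) * (v i * v j)) + Im z * (\<Sum>i<n. \<Sum>j<n. (r i * v i) * (r j * v j))"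
      by (simp add: sum.distrib sum_distrib_left)
    finally show ?thesis by (simp add: power2_eq_square sum_product)
  qed
  then show ?thesis
    using assms N unfolding siegel_def by (auto simp: outer_def mult.commute add_pos_nonneg)
qed

text \<open>Up to the factor \<open>2 ^ length es\<close>, this is the expected determinant of \<open>N - \<Sum>\<^sub>e r\<^sub>e r\<^sub>e\<^sup>T\<close>
  for independent unbiased choices of \<open>r\<^sub>e\<close>.\<close>
fun mixed :: "nat \<Rightarrow> ('e \<Rightarrow> bool \<Rightarrow> nat \<Rightarrow> real) \<Rightarrow> 'e list \<Rightarrow> complex mat \<Rightarrow> complex" where
  "mixed n r [] N = det N"
| "mixed n r (e # es) N = mixed n r es (N - outer n (\<lambda>i. of_real (r e False i)))
     + mixed n r es (N - outer n (\<lambda>i. of_real (r e True i)))"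

lemma mixed_affine:
  assumes "N \<in> carrier_mat n n"
  shows "\<exists>g. \<forall>z. mixed n r es (N + z \<cdot>\<^sub>m outer n s) = mixed n r es N + z * g"
  using assms
proof (induction es arbitrary: N)
  case Nil
  then show ?case using det_rank_one_update by simp
next
  case (Cons e es)
  define O' where "O' b = outer n (\<lambda>i. complex_of_real (r e b i))" for b
  have O': "O' b \<in> carrier_mat n n" for b unfolding O'_def by simp
  have *: "N + z \<cdot>\<^sub>m outer n s - O' b = (N - O' b) + z \<cdot>\<^sub>m outer n s" for z b
    using Cons.prems O' by (intro eq_matI) (auto simp: O'_def)
  have "N - O' b \<in> carrier_mat n n" for b by (rule minus_carrier_mat[OF O'])
  then have "\<forall>b. \<exists>g. \<forall>z. mixed n r es (N - O' b + z \<cdot>\<^sub>m outer n s) = mixed n r es (N - O' b) + z * g"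
    using Cons.IH by blast
  then obtain g where "\<And>b z. mixed n r es (N - O' b + z \<cdot>\<^sub>m outer n s) = mixed n r es (N - O' b) + z * g b"
    by metis
  then show ?case
    by (intro exI[of _ "g False + g True"]) (simp add: O'_def[symmetric] * algebra_simps)
qed

lemma minus_outer: "N \<in> carrier_mat n n \<Longrightarrow> N - outer n s = N + (-1) \<cdot>\<^sub>m outer n s"
  by (intro eq_matI) auto

text \<open>An affine function without zeros on the closed upper half plane has slope and constant term
  whose quotient lies in the closed lower half plane.\<close>
lemma mixed_slope:
  assumes N: "siegel n N" and nz: "\<And>N'. siegel n N' \<Longrightarrow> mixed n r es N' \<noteq> 0"
  obtains g where "mixed n r es (N - outer n (\<lambda>i. of_real (s i))) = mixed n r es N * (1 - g)"
    "Im g < 0 \<or> g = 0"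
proof -
  let ?a = "mixed n r es N"
  have Nc: "N \<in> carrier_mat n n" using N by (simp add: siegel_def)
  obtain g where g: "\<And>z. mixed n r es (N + z \<cdot>\<^sub>m outer n (\<lambda>i. of_real (s i))) = ?a + z * g"
    using mixed_affine[OF Nc] by metis
  have a: "?a \<noteq> 0" using nz N by blast
  show thesis
  proof (rule that[of "g / ?a"])
    show "mixed n r es (N - outer n (\<lambda>i. of_real (s i))) = ?a * (1 - g / ?a)"
      unfolding minus_outer[OF Nc] g using a by (simp add: field_simps)
    show "Im (g / ?a) < 0 \<or> g / ?a = 0"
    proof (cases "g = 0")
      case False
      \<comment> \<open>This point is the zero of the affine function; in the closed upper half
        plane it would give a matrix in \<open>siegel\<close> at which \<open>mixed\<close>
        vanishes.\<close>
      have "Im (- ?a / g) < 0"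
      proof (rule ccontr)
        assume "\<not> Im (- ?a / g) < 0"
        then have "siegel n (N + (- ?a / g) \<cdot>\<^sub>m outer n (\<lambda>i. of_real (s i)))"
          using siegel_rank_one_update[OF N] by simp
        then show False using nz g[of "- ?a / g"] False by fastforce
      qed
      moreover have "g / ?a = inverse (?a / g)" by simp
      ultimately have "Im (g / ?a) < 0"
        using a False by (simp only: inverse_complex.sel(2)) (auto simp: divide_less_0_iff sum_power2_gt_zero_iff complex_eq_iff)
      then show ?thesis ..
    qed simp
  qed
qed

text \<open>Relative to the shorter list the two branches contribute 1 - g and 1 - g', where the
  slopes are zero or have negative imaginary part. Hence 2 - g - g' can be real only if both slopes
  are zero, and then it is 2.\<close>

lemma mixed_nonzero: "siegel n N \<Longrightarrow> mixed n r es N \<noteq> 0"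
proof (induction es arbitrary: N)
  case Nil
  then show ?case using siegel_det_nonzero by simp
next
  case (Cons e es)
  obtain g where g: "mixed n r es (N - outer n (\<lambda>i. of_real (r e False i))) = mixed n r es N * (1 - g)"
    "Im g < 0 \<or> g = 0"
    by (rule mixed_slope[OF Cons.prems Cons.IH])
  obtain g' where g': "mixed n r es (N - outer n (\<lambda>i. of_real (r e True i))) = mixed n r es N * (1 - g')"
    "Im g' < 0 \<or> g' = 0"
    by (rule mixed_slope[OF Cons.prems Cons.IH])
  have "mixed n r (e # es) N = mixed n r es N * (2 - g - g')"
    by (simp add: g g' algebra_simps)
  moreover have "2 - g - g' \<noteq> 0"
    using g(2) g'(2) by (auto simp: complex_eq_iff)
  ultimately show ?case using Cons by simp
qed

text \<open>Interlacing in analytic form: along N = z I - M the quotient is a Pick function of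
  \<open>z\<close>, which forces monotonicity on real intervals without poles.\<close>

lemma mixed_Pick:
  assumes "siegel n N"
  shows "Im (mixed n r es (N - outer n (\<lambda>i. of_real (s i))) / mixed n r es N) \<ge> 0"
proof -
  obtain g where g: "mixed n r es (N - outer n (\<lambda>i. of_real (s i))) = mixed n r es N * (1 - g)"
    "Im g < 0 \<or> g = 0"
    by (rule mixed_slope[OF assms mixed_nonzero])
  have "mixed n r es N \<noteq> 0" by (rule mixed_nonzero[OF assms])
  then show ?thesis using g by auto
qed

section \<open>Interlacing of mixed characteristic polynomials on the real line\<close>

fun mixed_poly :: "nat \<Rightarrow> ('e \<Rightarrow> bool \<Rightarrow> nat \<Rightarrow> real) \<Rightarrow> 'e list \<Rightarrow> real mat \<Rightarrow> real poly" where
  "mixed_poly n r [] M = char_poly M"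
| "mixed_poly n r (e # es) M =
     mixed_poly n r es (M + outer n (r e False)) + mixed_poly n r es (M + outer n (r e True))"

lemma mixed_poly_degree:
  assumes "M \<in> carrier_mat n n"
  shows "degree (mixed_poly n r es M) = n \<and> lead_coeff (mixed_poly n r es M) = 2 ^ length es"
  using assms
proof (induction es arbitrary: M)
  case Nil
  then show ?case using degree_monic_char_poly by auto
next
  case (Cons e es)
  let ?p = "\<lambda>b. mixed_poly n r es (M + outer n (r e b))"
  have IH: "degree (?p b) = n" "coeff (?p b) n = 2 ^ length es" for b
    using Cons.IH[of "M + outer n (r e b)"] Cons.prems by auto
  then have "coeff (?p False + ?p True) n = 2 ^ length (e # es)" by simp
  moreover have "degree (?p False + ?p True) \<le> n" using IH by (intro degree_add_le) auto
  ultimately have "degree (?p False + ?p True) = n"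
    by (metis le_antisym le_degree power_not_zero zero_neq_numeral)
  then show ?case using \<open>coeff (?p False + ?p True) n = 2 ^ length (e # es)\<close> by simp
qed

abbreviation cpoly :: "real poly \<Rightarrow> complex \<Rightarrow> complex" where
  "cpoly p z \<equiv> poly (map_poly of_real p) z"

text \<open>The opposite signs in \<open>mixed\<close> and \<open>mixed_poly\<close> match: a
  rank-one matrix added to \<open>M\<close> is subtracted from z I - M.\<close>

lemma mixed_poly_eval:
  assumes "M \<in> carrier_mat n n"
  shows "cpoly (mixed_poly n r es M) z = mixed n r es (z \<cdot>\<^sub>m 1\<^sub>m n - map_mat of_real M)"
  using assms
proof (induction es arbitrary: M)
  case Nil
  then have "map_mat complex_of_real M \<in> carrier_mat n n" by simp
  from char_poly_matrix[OF this]
  have "cpoly (char_poly M) z = det (- char_matrix (map_mat of_real M) z)"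
    using of_real_hom.char_poly_hom[OF Nil] by metis
  also have "- char_matrix (map_mat of_real M) z = z \<cdot>\<^sub>m 1\<^sub>m n - map_mat of_real M"
    using Nil by (intro eq_matI) (auto simp: char_matrix_def)
  finally show ?case by simp
next
  case (Cons e es)
  have *: "z \<cdot>\<^sub>m 1\<^sub>m n - map_mat of_real (M + outer n s)
    = z \<cdot>\<^sub>m 1\<^sub>m n - map_mat of_real M - outer n (\<lambda>i. of_real (s i))" for s
    using Cons.prems by (intro eq_matI) (auto simp: outer_def)
  have "M + outer n s \<in> carrier_mat n n" for s using Cons.prems by auto
  then show ?case by (simp add: Cons.IH * map_poly_add)
qed

lemma siegel_resolvent:
  assumes M: "M \<in> carrier_mat n n" "transpose_mat M = M" and z: "Im z > 0"
  shows "siegel n (z \<cdot>\<^sub>m 1\<^sub>m n - map_mat of_real M)"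
  unfolding siegel_def
proof (intro conjI allI impI)
  show "z \<cdot>\<^sub>m 1\<^sub>m n - map_mat of_real M \<in> carrier_mat n n"
    by (rule minus_carrier_mat) (use M in simp)
  show "(z \<cdot>\<^sub>m 1\<^sub>m n - map_mat of_real M) $$ (i,j) = (z \<cdot>\<^sub>m 1\<^sub>m n - map_mat of_real M) $$ (j,i)"
    if "i < n" "j < n" for i j
    using M that symmetric_index[OF M that] by auto
  fix v :: "nat \<Rightarrow> real" assume "\<exists>i<n. v i \<noteq> 0"
  then have "(\<Sum>i<n. (v i)\<^sup>2) > 0" by (auto intro: sum_pos2)
  moreover have "(\<Sum>j<n. Im ((z \<cdot>\<^sub>m 1\<^sub>m n - map_mat of_real M) $$ (i,j)) * (v i * v j)) = Im z * (v i)\<^sup>2"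
    if "i < n" for i
  proof -
    have "(\<Sum>j<n. Im ((z \<cdot>\<^sub>m 1\<^sub>m n - map_mat of_real M) $$ (i,j)) * (v i * v j))
      = (\<Sum>j<n. if i = j then Im z * (v i)\<^sup>2 else 0)"
      by (rule sum.cong) (use M that in \<open>auto simp: power2_eq_square\<close>)
    then show ?thesis using that by simp
  qed
  ultimately show "0 < (\<Sum>i<n. \<Sum>j<n. Im ((z \<cdot>\<^sub>m 1\<^sub>m n - map_mat of_real M) $$ (i,j)) * (v i * v j))"
    using z by (simp flip: sum_distrib_left)
qed

text \<open>On the real axis the quotient is real. Approaching \<open>t\<close> vertically from
  height e, the real part of the difference quotient equals the imaginary part of f/a divided by e,
  which is nonnegative; its limit is the derivative.\<close>

lemma Pick_mono:
  fixes f a :: "real poly"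
  assumes pick: "\<And>z. Im z > 0 \<Longrightarrow> Im (cpoly f z / cpoly a z) \<ge> 0"
    and xy: "x \<le> y" and nz: "\<And>t. x \<le> t \<Longrightarrow> t \<le> y \<Longrightarrow> poly a t \<noteq> 0"
  shows "poly f x / poly a x \<le> poly f y / poly a y"
proof (rule DERIV_nonneg_imp_nondecreasing[OF xy])
  fix t assume t: "x \<le> t" "t \<le> y"
  define D where "D = (poly (pderiv f) t * poly a t - poly f t * poly (pderiv a) t) / (poly a t * poly a t)"
  have "((\<lambda>x. poly f x / poly a x) has_real_derivative D) (at t)"
    unfolding D_def by (rule DERIV_divide) (use nz t in \<open>auto intro: poly_DERIV\<close>)
  moreover have "D \<ge> 0"
  proof -
    have c: "cpoly p (of_real t) = of_real (poly p t)" for p by simp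
    have pd: "cpoly (pderiv p) z = poly (pderiv (map_poly of_real p)) z" for p z
      by (simp add: of_real_hom.map_poly_pderiv)
    have "((\<lambda>z. cpoly f z / cpoly a z) has_field_derivative of_real D) (at (of_real t))"
      unfolding D_def of_real_divide of_real_mult of_real_diff c[symmetric] pd
      by (rule DERIV_divide) (use nz[OF t] c in \<open>auto intro: poly_DERIV\<close>)
    then have lim: "((\<lambda>h. (cpoly f (of_real t + h) / cpoly a (of_real t + h) - of_real (poly f t / poly a t)) / h) \<longlongrightarrow> of_real D) (at 0)"
      unfolding DERIV_def by (simp add: c)
    let ?Q = "\<lambda>e. Re ((cpoly f (of_real t + \<i> * of_real e) / cpoly a (of_real t + \<i> * of_real e) - of_real (poly f t / poly a t)) / (\<i> * of_real e))"
    have "filterlim (\<lambda>e. \<i> * of_real e) (at 0) (at_right (0::real))"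
      unfolding filterlim_at
      by (intro conjI) (auto intro!: tendsto_eq_intros eventually_at_right_less[THEN eventually_mono])
    from filterlim_compose[OF lim this]
    have "((\<lambda>e. ?Q e) \<longlongrightarrow> Re (of_real D)) (at_right 0)"
      by (rule tendsto_Re)
    moreover have "\<forall>\<^sub>F e in at_right (0::real). 0 \<le> ?Q e"
      using eventually_at_right_less
    proof eventually_elim
      case (elim e)
      have *: "Re ((w - of_real b) / (\<i> * of_real e)) = Im w / e" for w b
        using elim by (simp add: complex_eq_iff Re_divide field_simps power2_eq_square)
      show ?case unfolding * using pick[of "of_real t + \<i> * of_real e"] elim by simp
    qed
    ultimately have "0 \<le> Re (of_real D)"
      by (intro tendsto_lowerbound) auto
    then show ?thesis by simp
  qed
  ultimately show "\<exists>d. ((\<lambda>x. poly f x / poly a x) has_real_derivative d) (at t) \<and> 0 \<le> d" by blast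
qed


lemma lead_coeff_pos_eventually:
  fixes p :: "real poly"
  assumes "lead_coeff p > 0"
  obtains x where "x > y" "poly p x > 0"
proof -
  obtain n where n: "\<forall>x\<ge>n. poly p x \<ge> lead_coeff p"
    using poly_pinfty_gt_lc[OF assms] by blast
  then have "poly p (max n (y+1)) \<ge> lead_coeff p" by simp
  then show thesis using assms by (intro that[of "max n (y+1)"]) auto
qed

text \<open>Above the largest root of \<open>a\<close> the quotients \<open>f1 / a\<close> and \<open>f2 / a\<close> increase to 1, so each changes sign at most
  once there, and the one that changes sign first does so no later than their sum.\<close>
lemma interlacing_choice:
  fixes f1 f2 a :: "real poly"
  assumes deg: "degree f1 = n" "degree f2 = n" "degree a = n"
    and lc: "lead_coeff f1 = c" "lead_coeff f2 = c" "lead_coeff a = c" "c > 0"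
    and pick: "\<And>z. Im z > 0 \<Longrightarrow> Im (cpoly f1 z / cpoly a z) \<ge> 0" "\<And>z. Im z > 0 \<Longrightarrow> Im (cpoly f2 z / cpoly a z) \<ge> 0"
    and pos: "\<And>x. x > \<rho> \<Longrightarrow> poly (f1 + f2) x > 0"
  shows "(\<forall>x>\<rho>. poly f1 x > 0) \<or> (\<forall>x>\<rho>. poly f2 x > 0)"
proof -
  have a0: "a \<noteq> 0" using lc by auto
  have above: "poly a x > 0" if "\<And>t. t > \<beta> \<Longrightarrow> poly a t \<noteq> 0" "x > \<beta>" for \<beta> x
  proof (rule ccontr)
    assume "\<not> poly a x > 0"
    then have "poly a x < 0" using that by (smt (verit))
    obtain y where y: "y > x" "poly a y > 0" using lead_coeff_pos_eventually[of a x] lc by auto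
    obtain t where "x < t" "t < y" "poly a t = 0"
      using poly_IVT_pos[OF y(1) \<open>poly a x < 0\<close> y(2)] by auto
    then show False using that by (smt (verit))
  qed
  have le: "poly f x \<le> poly a x"
    if f: "degree f = n" "lead_coeff f = c" and pf: "\<And>z. Im z > 0 \<Longrightarrow> Im (cpoly f z / cpoly a z) \<ge> 0"
      and b: "\<And>t. t > \<beta> \<Longrightarrow> poly a t \<noteq> 0" "x > \<beta>" for f \<beta> x
  proof (rule ccontr)
    assume "\<not> poly f x \<le> poly a x"
    moreover have ax: "poly a x > 0" by (rule above[OF b])
    ultimately obtain d where d: "d > 1" "poly f x / poly a x > d"
      using dense[of 1 "poly f x / poly a x"] by auto
    \<comment> \<open>This replaces the limit 1 at infinity: \<open>q\<close> has leading
      coefficient (d - 1) c > 0, so f/a drops below \<open>d\<close> somewhere to the right of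
      \<open>x\<close>, against monotonicity.\<close>
    define q where "q = Polynomial.smult d a - f"
    have "coeff q n = (d - 1) * c" using f lc deg by (simp add: q_def algebra_simps)
    moreover have "degree q \<le> n"
      unfolding q_def using f deg by (intro degree_diff_le) (auto intro: order_trans[OF degree_smult_le])
    ultimately have "lead_coeff q > 0"
      using d lc(4) by (metis diff_gt_0_iff_gt le_antisym le_degree less_numeral_extra(3) mult_pos_pos)
    then obtain y where y: "y > x" "poly q y > 0" by (rule lead_coeff_pos_eventually)
    have "poly f x / poly a x \<le> poly f y / poly a y"
      by (rule Pick_mono[OF pf]) (use y b in auto)
    then have "d < poly f y / poly a y" using d by simp
    moreover have "poly a y > 0" by (rule above[OF b(1)]) (use y b in auto)
    ultimately have "d * poly a y < poly f y" by (simp add: field_simps)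
    then show False using y(2) by (simp add: q_def)
  qed
  \<comment> \<open>If \<open>a\<close> had a root above \<rho>, then at its largest root both
    \<open>f1\<close> and \<open>f2\<close> would be at most 0, because they are at most
    \<open>a\<close> to the right of it; their sum is positive there.\<close>
  have a_nz: "poly a t \<noteq> 0" if "t > \<rho>" for t
  proof
    assume "poly a t = 0"
    define Z where "Z = {x. poly a x = 0}"
    have fin: "finite Z" unfolding Z_def by (rule poly_roots_finite[OF a0])
    define \<beta> where "\<beta> = Max Z"
    have "t \<in> Z" using \<open>poly a t = 0\<close> by (simp add: Z_def)
    then have "Z \<noteq> {}" by auto
    have "\<beta> \<in> Z" "t \<le> \<beta>"
      unfolding \<beta>_def using Max_in[OF fin \<open>Z \<noteq> {}\<close>] Max_ge[OF fin \<open>t \<in> Z\<close>] by auto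
    have b: "poly a s \<noteq> 0" if "s > \<beta>" for s
    proof
      assume "poly a s = 0"
      then have "s \<in> Z" by (simp add: Z_def)
      then show False using that Max_ge[OF fin \<open>s \<in> Z\<close>] by (simp add: \<beta>_def)
    qed
    have lef: "poly f \<beta> \<le> 0" if "\<And>x. x > \<beta> \<Longrightarrow> poly f x \<le> poly a x" for f
    proof -
      have "(poly p \<longlongrightarrow> poly p \<beta>) (at_right \<beta>)" for p
      proof -
        have "isCont (poly p) \<beta>" by simp
        then show ?thesis unfolding isCont_def filterlim_at_split by simp
      qed
      then have "poly f \<beta> \<le> poly a \<beta>"
        by (intro tendsto_le[of "at_right \<beta>" "poly a" _ "poly f"])
          (auto intro!: eventually_at_right_less[THEN eventually_mono] that)
      then show ?thesis using \<open>\<beta> \<in> Z\<close> by (simp add: Z_def)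
    qed
    have "poly f1 \<beta> \<le> 0" by (rule lef, rule le[OF deg(1) lc(1) pick(1) b])
    moreover have "poly f2 \<beta> \<le> 0" by (rule lef, rule le[OF deg(2) lc(2) pick(2) b])
    moreover have "poly (f1 + f2) \<beta> > 0" using pos \<open>t \<le> \<beta>\<close> \<open>t > \<rho>\<close> by simp
    ultimately show False by simp
  qed
  have a_pos: "poly a t > 0" if "t > \<rho>" for t by (rule above[OF a_nz that])
  show ?thesis
  proof (rule ccontr)
    assume "\<not> ?thesis"
    then obtain x1 x2 where x: "x1 > \<rho>" "poly f1 x1 \<le> 0" "x2 > \<rho>" "poly f2 x2 \<le> 0"
      by (auto simp: not_less)
    define x where "x = min x1 x2"
    have xr: "x > \<rho>" using x by (simp add: x_def)
    have "poly f1 x / poly a x \<le> poly f1 x1 / poly a x1"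
      by (rule Pick_mono[OF pick(1)]) (use a_nz x in \<open>auto simp: x_def\<close>)
    then have "poly f1 x / poly a x \<le> 0" using x a_pos[OF x(1)] by (smt (verit) divide_nonpos_pos)
    moreover have "poly f2 x / poly a x \<le> poly f2 x2 / poly a x2"
      by (rule Pick_mono[OF pick(2)]) (use a_nz x in \<open>auto simp: x_def\<close>)
    then have "poly f2 x / poly a x \<le> 0" using x a_pos[OF x(3)] by (smt (verit) divide_nonpos_pos)
    ultimately have "poly f1 x \<le> 0" "poly f2 x \<le> 0"
      using a_pos[OF xr] by (auto simp: divide_le_0_iff)
    then show False using pos[OF xr] by simp
  qed
qed

definition rank_one_sum :: "nat \<Rightarrow> ('e \<Rightarrow> bool \<Rightarrow> nat \<Rightarrow> real) \<Rightarrow> 'e set \<Rightarrow> 'e set \<Rightarrow> real mat" where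
  "rank_one_sum n r E X = mat n n (\<lambda>(i,j). \<Sum>e\<in>E. r e (e \<in> X) i * r e (e \<in> X) j)"

lemma rank_one_sum_carrier [simp]: "rank_one_sum n r E X \<in> carrier_mat n n"
  by (simp add: rank_one_sum_def)

lemma rank_one_sum_dim [simp]: "dim_row (rank_one_sum n r E X) = n" "dim_col (rank_one_sum n r E X) = n"
  by (simp_all add: rank_one_sum_def)

lemma rank_one_sum_insert:
  assumes "M \<in> carrier_mat n n" "finite E" "e \<notin> E" "X \<subseteq> E"
  shows "M + rank_one_sum n r (insert e E) X = M + outer n (r e False) + rank_one_sum n r E X"
    and "M + rank_one_sum n r (insert e E) (insert e X) = M + outer n (r e True) + rank_one_sum n r E X"
proof -
  have "(\<Sum>e'\<in>E. r e' (e' = e \<or> e' \<in> X) i * r e' (e' = e \<or> e' \<in> X) j) = (\<Sum>e'\<in>E. r e' (e' \<in> X) i * r e' (e' \<in> X) j)" for i j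
  proof (rule sum.cong[OF refl])
    fix e' assume "e' \<in> E"
    then have "(e' = e \<or> e' \<in> X) = (e' \<in> X)" using assms by auto
    then show "r e' (e' = e \<or> e' \<in> X) i * r e' (e' = e \<or> e' \<in> X) j = r e' (e' \<in> X) i * r e' (e' \<in> X) j"
      by simp
  qed
  then show "M + rank_one_sum n r (insert e E) (insert e X) = M + outer n (r e True) + rank_one_sum n r E X"
    using assms by (intro eq_matI) (auto simp: rank_one_sum_def outer_def)
  have "e \<notin> X" using assms by auto
  then show "M + rank_one_sum n r (insert e E) X = M + outer n (r e False) + rank_one_sum n r E X"
    using assms by (intro eq_matI) (auto simp: rank_one_sum_def outer_def)
qed

lemma mixed_poly_sum:
  assumes "M \<in> carrier_mat n n" "distinct es"
  shows "mixed_poly n r es M = (\<Sum>X\<in>Pow (set es). char_poly (M + rank_one_sum n r (set es) X))"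
  using assms
proof (induction es arbitrary: M)
  case Nil
  then have "M + rank_one_sum n r {} {} = M" by (intro eq_matI) (auto simp: rank_one_sum_def)
  then show ?case by simp
next
  case (Cons e es)
  let ?E = "set es" and ?f = "\<lambda>X. char_poly (M + rank_one_sum n r (set (e # es)) X)"
  have e: "e \<notin> ?E" using Cons.prems by simp
  have "sum ?f (Pow (insert e ?E)) = sum ?f (Pow ?E) + sum ?f (insert e ` Pow ?E)"
    unfolding Pow_insert using e by (intro sum.union_disjoint) auto
  also have "sum ?f (insert e ` Pow ?E) = (\<Sum>X\<in>Pow ?E. ?f (insert e X))"
    using e by (subst sum.reindex) (auto intro!: inj_onI)
  also have "\<dots> = mixed_poly n r es (M + outer n (r e True))"
    using Cons e rank_one_sum_insert(2)[OF Cons.prems(1) finite_set e] by (auto intro!: sum.cong)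
  also have "sum ?f (Pow ?E) = mixed_poly n r es (M + outer n (r e False))"
    using Cons e rank_one_sum_insert(1)[OF Cons.prems(1) finite_set e] by (auto intro!: sum.cong)
  finally show ?case by simp
qed

text \<open>Choices are fixed one at a time. The current polynomial is the sum of two branches, and
  both are compared with the polynomial for the same \<open>M\<close> with the current index
  dropped; \<open>interlacing_choice\<close> then preserves positivity above \<rho> on one
  branch.\<close>

lemma mixed_poly_choice:
  assumes "M \<in> carrier_mat n n" "transpose_mat M = M" "distinct es"
    and "\<And>x. x > \<rho> \<Longrightarrow> poly (mixed_poly n r es M) x > 0"
  shows "\<exists>X\<subseteq>set es. \<forall>x>\<rho>. poly (char_poly (M + rank_one_sum n r (set es) X)) x > 0"
  using assms
proof (induction es arbitrary: M)
  case Nil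
  then have "M + rank_one_sum n r {} {} = M" by (intro eq_matI) (auto simp: rank_one_sum_def)
  then show ?case using Nil by simp
next
  case (Cons e es)
  note M = Cons.prems(1,2)
  define M' where "M' b = M + outer n (r e b)" for b
  have M'c: "M' b \<in> carrier_mat n n" for b unfolding M'_def using M by auto
  have M's: "transpose_mat (M' b) = M' b" for b
    unfolding M'_def using M symmetric_index[OF M] by (intro eq_matI) (auto simp: outer_def)
  have pick: "Im (cpoly (mixed_poly n r es (M' b)) z / cpoly (mixed_poly n r es M) z) \<ge> 0" if "Im z > 0" for b z
  proof -
    have *: "z \<cdot>\<^sub>m 1\<^sub>m n - map_mat of_real (M' b)
      = z \<cdot>\<^sub>m 1\<^sub>m n - map_mat of_real M - outer n (\<lambda>i. of_real (r e b i))"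
      using M by (intro eq_matI) (auto simp: outer_def M'_def)
    show ?thesis unfolding mixed_poly_eval[OF M'c] mixed_poly_eval[OF M(1)] *
      by (rule mixed_Pick[OF siegel_resolvent[OF M that]])
  qed
  have "(\<forall>x>\<rho>. poly (mixed_poly n r es (M' False)) x > 0) \<or> (\<forall>x>\<rho>. poly (mixed_poly n r es (M' True)) x > 0)"
    by (rule interlacing_choice[where a = "mixed_poly n r es M" and n = n and c = "2 ^ length es"])
      (use mixed_poly_degree[OF M'c[of False], of r es] mixed_poly_degree[OF M'c[of True], of r es]
        mixed_poly_degree[OF M(1), of r es] pick Cons.prems(4) in \<open>auto simp: M'_def\<close>)
  then obtain b where b: "\<And>x. x > \<rho> \<Longrightarrow> poly (mixed_poly n r es (M' b)) x > 0" by blast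
  obtain X where X: "X \<subseteq> set es" "\<forall>x>\<rho>. poly (char_poly (M' b + rank_one_sum n r (set es) X)) x > 0"
    using Cons.IH[OF M'c M's _ b] Cons.prems(3) by auto
  have e: "e \<notin> set es" using Cons.prems by simp
  show ?case
  proof (cases b)
    case True
    then show ?thesis using X rank_one_sum_insert(2)[OF M(1) finite_set e X(1), of r]
      by (intro exI[of _ "insert e X"]) (auto simp: M'_def)
  next
    case False
    then show ?thesis using X rank_one_sum_insert(1)[OF M(1) finite_set e X(1), of r]
      by (intro exI[of _ X]) (auto simp: M'_def)
  qed
qed

theorem rank_one_choice:
  assumes E: "finite E"
    and pos: "\<And>x. x > \<rho> \<Longrightarrow> (\<Sum>X\<in>Pow E. poly (char_poly (rank_one_sum n r E X)) x) > 0"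
  shows "\<exists>X\<subseteq>E. \<forall>x>\<rho>. poly (char_poly (rank_one_sum n r E X)) x > 0"
proof -
  obtain es where es: "set es = E" "distinct es" using finite_distinct_list[OF E] by blast
  have z: "0\<^sub>m n n + rank_one_sum n r E X = rank_one_sum n r E X" for X
    by simp
  show ?thesis
    using mixed_poly_choice[OF zero_carrier_mat, of n es \<rho> r] mixed_poly_sum[OF zero_carrier_mat es(2), of n r] pos
    by (simp add: es poly_sum)
qed

subsection \<open>Ramanujan signings and bipartite expanders\<close>

lemma symmetric_adjoint:
  fixes a :: "nat \<Rightarrow> nat \<Rightarrow> real"
  assumes "\<And>i l. i < n \<Longrightarrow> l < n \<Longrightarrow> a i l = a l i"
  shows "(\<Sum>i<n. (\<Sum>l<n. a i l * x l) * y i) = (\<Sum>i<n. x i * (\<Sum>l<n. a i l * y l))"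
proof -
  have "(\<Sum>i<n. (\<Sum>l<n. a i l * x l) * y i) = (\<Sum>l<n. \<Sum>i<n. a i l * x l * y i)"
    unfolding sum_distrib_right by (rule sum.swap)
  also have "\<dots> = (\<Sum>l<n. \<Sum>i<n. x l * (a l i * y i))"
    by (intro sum.cong refl) (use assms in auto)
  finally show ?thesis by (simp add: sum_distrib_left)
qed

lemma real_symmetric_spectral_resolution:
  fixes A :: "real mat"
  assumes A: "A \<in> carrier_mat n n" "transpose_mat A = A"
  shows "\<exists>(p :: nat \<Rightarrow> nat \<Rightarrow> real) \<epsilon>.
    (\<forall>j<n. \<forall>k<n. (\<Sum>i<n. p j i * p k i) = (if j = k then 1 else 0)) \<and>
    (\<forall>x y. (\<Sum>i<n. x i * y i) = (\<Sum>j<n. (\<Sum>i<n. x i * p j i) * (\<Sum>i<n. y i * p j i))) \<and>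
    (\<forall>i<n. \<forall>j<n. (\<Sum>l<n. A $$ (i,l) * p j l) = \<epsilon> j * p j i) \<and>
    char_poly A = (\<Prod>j<n. [:- \<epsilon> j, 1:])"
proof -
  obtain q \<epsilon> where q: "\<And>j. j < n \<Longrightarrow> q j \<in> carrier_vec n" "\<And>j. j < n \<Longrightarrow> A *\<^sub>v q j = \<epsilon> j \<cdot>\<^sub>v q j"
    "\<And>j k. j < n \<Longrightarrow> k < n \<Longrightarrow> q j \<bullet> q k = (if j = k then 1 else 0)"
    "char_poly A = (\<Prod>j<n. [:- \<epsilon> j, 1:])"
    using real_symmetric_diagonalization[OF A] by metis
  define p where "p j i = q j $ i" for j i
  have orth: "(\<Sum>i<n. p j i * p k i) = (if j = k then 1 else 0)" if "j < n" "k < n" for j k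
    using q(3)[OF that] q(1)[OF that(2)] by (simp add: p_def scalar_prod_def atLeast0LessThan)
  define P where "P = mat n n (\<lambda>(j,i). p j i)"
  have P: "P \<in> carrier_mat n n" by (simp add: P_def)
  have "P * transpose_mat P = 1\<^sub>m n"
    by (rule eq_matI) (auto simp: P_def scalar_prod_def orth atLeast0LessThan)
  then have PP: "transpose_mat P * P = 1\<^sub>m n"
    using mat_mult_left_right_inverse[OF P] P by simp
  have complete: "(\<Sum>j<n. p j i * p j l) = (if i = l then 1 else 0)" if "i < n" "l < n" for i l
    using arg_cong[OF PP, of "\<lambda>T. T $$ (i,l)"] that
    by (simp add: P_def scalar_prod_def atLeast0LessThan)
  have eig: "(\<Sum>l<n. A $$ (i,l) * p j l) = \<epsilon> j * p j i" if "i < n" "j < n" for i j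
    using mult_mat_vec_sum[OF A(1) q(1)[OF that(2)] that(1)] q(1,2)[OF that(2)] that(1)
    by (simp add: p_def)
  have parseval: "(\<Sum>i<n. x i * y i) = (\<Sum>j<n. (\<Sum>i<n. x i * p j i) * (\<Sum>i<n. y i * p j i))"
    for x y :: "nat \<Rightarrow> real"
  proof -
    have "(\<Sum>j<n. (\<Sum>i<n. x i * p j i) * (\<Sum>i<n. y i * p j i))
      = (\<Sum>j<n. \<Sum>i<n. \<Sum>l<n. x i * y l * (p j i * p j l))"
      by (simp add: sum_product mult_ac)
    also have "\<dots> = (\<Sum>i<n. \<Sum>j<n. \<Sum>l<n. x i * y l * (p j i * p j l))" by (rule sum.swap)
    also have "\<dots> = (\<Sum>i<n. \<Sum>l<n. \<Sum>j<n. x i * y l * (p j i * p j l))"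
      by (rule sum.cong[OF refl], rule sum.swap)
    also have "\<dots> = (\<Sum>i<n. \<Sum>l<n. if i = l then x i * y i else 0)"
      by (intro sum.cong refl) (auto simp: complete simp flip: sum_distrib_left)
    finally show ?thesis by simp
  qed
  show ?thesis by (intro exI conjI allI impI) (fact orth | fact parseval | fact eig | fact q(4))+
qed

lemma quadratic_form_le:
  fixes A :: "real mat"
  assumes A: "A \<in> carrier_mat n n" "transpose_mat A = A"
    and roots: "\<And>t. t > \<rho> \<Longrightarrow> poly (char_poly A) t \<noteq> 0"
  shows "(\<Sum>i<n. \<Sum>l<n. A $$ (i,l) * (x i * x l)) \<le> \<rho> * (\<Sum>i<n. (x i)\<^sup>2)"
proof -
  obtain p \<epsilon> where
    "\<forall>x y. (\<Sum>i<n. x i * y i) = (\<Sum>j<n. (\<Sum>i<n. x i * p j i) * (\<Sum>i<n. y i * p j i))"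
    "\<forall>i<n. \<forall>j<n. (\<Sum>l<n. A $$ (i,l) * p j l) = \<epsilon> j * p j i"
    "char_poly A = (\<Prod>j<n. [:- \<epsilon> j, 1:])"
    using real_symmetric_spectral_resolution[OF A] by (elim exE conjE)
  note p = this[rule_format]
  define c where "c j = (\<Sum>i<n. x i * p j i)" for j
  have "(\<Sum>i<n. \<Sum>l<n. A $$ (i,l) * (x i * x l)) = (\<Sum>i<n. (\<Sum>l<n. A $$ (i,l) * x l) * x i)"
    by (simp add: sum_distrib_left mult_ac)
  also have "\<dots> = (\<Sum>j<n. (\<Sum>i<n. (\<Sum>l<n. A $$ (i,l) * x l) * p j i) * c j)"
    unfolding c_def by (rule p(1))
  also have "\<dots> = (\<Sum>j<n. \<epsilon> j * (c j)\<^sup>2)"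
  proof (rule sum.cong[OF refl])
    fix j assume j: "j \<in> {..<n}"
    have "(\<Sum>i<n. (\<Sum>l<n. A $$ (i,l) * x l) * p j i) = (\<Sum>i<n. x i * (\<Sum>l<n. A $$ (i,l) * p j l))"
      by (rule symmetric_adjoint) (rule symmetric_index[OF A])
    also have "\<dots> = (\<Sum>i<n. x i * (\<epsilon> j * p j i))" using j by (simp add: p(2))
    also have "\<dots> = \<epsilon> j * c j" by (simp add: c_def sum_distrib_left mult_ac)
    finally show "(\<Sum>i<n. (\<Sum>l<n. A $$ (i,l) * x l) * p j i) * c j = \<epsilon> j * (c j)\<^sup>2"
      by (simp add: power2_eq_square)
  qed
  also have "\<dots> \<le> (\<Sum>j<n. \<rho> * (c j)\<^sup>2)"
  proof (rule sum_mono)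
    fix j assume "j \<in> {..<n}"
    then have "poly (char_poly A) (\<epsilon> j) = 0" unfolding p(3) poly_prod by auto
    then have "\<epsilon> j \<le> \<rho>" using roots[of "\<epsilon> j"] by force
    then show "\<epsilon> j * (c j)\<^sup>2 \<le> \<rho> * (c j)\<^sup>2" by (rule mult_right_mono) simp
  qed
  also have "\<dots> = \<rho> * (\<Sum>i<n. (x i)\<^sup>2)"
    using p(1)[of x x] by (simp add: c_def power2_eq_square sum_distrib_left)
  finally show ?thesis .
qed

lemma det_detS:
  assumes "A \<in> carrier_mat n n"
  shows "det A = detS {..<n} (\<lambda>i j. A $$ (i,j))"
  unfolding det_def'[OF assms] detS_def atLeast0LessThan by simp

text \<open>The outer square of this vector is a signed edge plus 1 in the diagonal at both ends.
  Over an \<open>h\<close>-regular graph the diagonal adds up to \<open>h\<close> times the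
  identity, which turns a random signing into a sum of independent rank-one matrices.\<close>

definition edge_vec :: "nat \<times> nat \<Rightarrow> bool \<Rightarrow> nat \<Rightarrow> real" where
  "edge_vec e s i = (if i = fst e then 1 else if i = snd e then (if s then -1 else 1) else 0)"

lemma rank_one_sum_edge_vec:
  assumes E: "finite E" "\<And>i j. (i,j) \<in> E \<Longrightarrow> (j,i) \<notin> E" "\<And>i. (i,i) \<notin> E"
    and "i < n" "j < n" and deg: "card {w. (i,w) \<in> E \<or> (w,i) \<in> E} = h"
  shows "rank_one_sum n edge_vec E X $$ (i,j) = (if i = j then real h else 0) + signing E X i j"
proof (cases "i = j")
  case True
  let ?N = "{w. (i,w) \<in> E \<or> (w,i) \<in> E}"
  let ?I = "{e \<in> E. i = fst e \<or> i = snd e}"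
  let ?O = "{w. (i,w) \<in> E}" and ?P = "{w. (w,i) \<in> E}"
  have fin: "finite ?O" "finite ?P"
    using E(1) finite_subset[of ?O "snd ` E"] finite_subset[of ?P "fst ` E"] by (force+)
  have "?N = ?O \<union> ?P" "?O \<inter> ?P = {}" using E(2) by blast+
  then have "h = card ?O + card ?P" using deg card_Un_disjoint[OF fin] by simp
  moreover have "?I = Pair i ` ?O \<union> (\<lambda>w. (w,i)) ` ?P" by force
  moreover have "Pair i ` ?O \<inter> (\<lambda>w. (w,i)) ` ?P = {}" using E(3) by auto
  ultimately have "card ?I = h"
    using fin by (simp add: card_Un_disjoint card_image inj_on_def)
  have "(\<Sum>e\<in>E. edge_vec e (e \<in> X) i * edge_vec e (e \<in> X) i) = (\<Sum>e\<in>E. if i = fst e \<or> i = snd e then 1 else 0)"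
    by (rule sum.cong) (auto simp: edge_vec_def)
  also have "\<dots> = real (card ?I)" using E(1) by (simp add: sum.If_cases Int_def conj_commute)
  also have "\<dots> = real h" using \<open>card ?I = h\<close> by simp
  finally show ?thesis using True assms by (simp add: rank_one_sum_def signing_def E(3))
next
  case False
  have *: "edge_vec e (e \<in> X) i * edge_vec e (e \<in> X) j = (if e = (i,j) \<or> e = (j,i) then (if e \<in> X then -1 else 1) else 0)"
    for e using False by (cases e) (auto simp: edge_vec_def)
  have "(\<Sum>e\<in>E. edge_vec e (e \<in> X) i * edge_vec e (e \<in> X) j)
    = (\<Sum>e\<in>E. if e = (i,j) \<or> e = (j,i) then (if e \<in> X then -1 else 1) else 0)"
    by (simp only: *)
  also have "\<dots> = (\<Sum>e\<in>E \<inter> {(i,j),(j,i)}. if e \<in> X then -1 else 1)"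
    using E(1) by (subst sum.inter_restrict) (auto intro!: sum.cong)
  also have "\<dots> = signing E X i j"
  proof -
    consider "(i,j) \<in> E" "(j,i) \<notin> E" | "(i,j) \<notin> E" "(j,i) \<in> E" | "(i,j) \<notin> E" "(j,i) \<notin> E"
      using E(2) by blast
    then show ?thesis
    proof cases
      case 1
      then have "E \<inter> {(i,j),(j,i)} = {(i,j)}" by auto
      then show ?thesis using 1 by (simp add: signing_def)
    next
      case 2
      then have "E \<inter> {(i,j),(j,i)} = {(j,i)}" by auto
      then show ?thesis using 2 by (simp add: signing_def)
    next
      case 3
      then have "E \<inter> {(i,j),(j,i)} = {}" by auto
      then show ?thesis using 3 by (simp add: signing_def)
    qed
  qed
  finally show ?thesis using False assms by (simp add: rank_one_sum_def)
qed

text \<open>The signing shifted by \<open>h\<close> times the identity is a sum of rank-one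
  matrices, hence the threshold \<rho> = h + 2 \<theta>. Beyond it the summed characteristic
  polynomial is positive by the matching bound with k = h - 1; h \<ge> 3 gives \<theta> > 1.\<close>

theorem exists_good_signing:
  assumes E: "finite E" "\<And>i j. (i,j) \<in> E \<Longrightarrow> (j,i) \<notin> E" "\<And>i. (i,i) \<notin> E"
    and En: "E \<subseteq> {..<n} \<times> {..<n}" and deg: "\<And>v. v < n \<Longrightarrow> card {w. (v,w) \<in> E \<or> (w,v) \<in> E} = h"
    and h: "h \<ge> 3"
  obtains X where "X \<subseteq> E" "\<And>x. (\<Sum>i<n. \<Sum>j<n. signing E X i j * (x i * x j)) \<le> 2 * sqrt (real (h - 1)) * (\<Sum>i<n. (x i)\<^sup>2)"
proof -
  define \<theta> where "\<theta> = sqrt (real (h - 1))"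
  have \<theta>: "\<theta> > 1" "\<theta>\<^sup>2 = real (h - 1)" unfolding \<theta>_def using h by auto
  define \<rho> where "\<rho> = real h + 2 * \<theta>"
  let ?R = "rank_one_sum n edge_vec E"
  have degle: "card {w. (v,w) \<in> E \<or> (w,v) \<in> E} \<le> Suc (h - 1)" for v
  proof (cases "v < n")
    case True
    then show ?thesis using deg[OF True] by simp
  next
    case False
    then have "{w. (v,w) \<in> E \<or> (w,v) \<in> E} = {}" using En by auto
    then show ?thesis by simp
  qed
  have Rij: "?R X $$ (i,j) = (if i = j then real h else 0) + signing E X i j" if "i < n" "j < n" for X i j
    by (rule rank_one_sum_edge_vec[OF E that deg[OF that(1)]])
  have symR: "transpose_mat (?R X) = ?R X" for X
    by (rule eq_matI) (auto simp: rank_one_sum_def mult.commute)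
  have cp: "poly (char_poly (?R X)) t = detS {..<n} (\<lambda>i j. (if i = j then t - real h else 0) - signing E X i j)" for X t
  proof -
    have "poly (char_poly (?R X)) t = det (- char_matrix (?R X) t)"
      by (rule char_poly_matrix[OF rank_one_sum_carrier])
    also have "\<dots> = detS {..<n} (\<lambda>i j. (- char_matrix (?R X) t) $$ (i,j))"
      by (rule det_detS) simp
    also have "\<dots> = detS {..<n} (\<lambda>i j. (if i = j then t - real h else 0) - signing E X i j)"
      unfolding detS_def
    proof (intro sum.cong refl arg_cong2[of _ _ _ _ "(*)"] prod.cong)
      fix p i assume "p \<in> {p. p permutes {..<n}}" "i \<in> {..<n}"
      then have "i < n" "p i < n" using permutes_in_image[of p "{..<n}" i] by auto
      then show "(- char_matrix (?R X) t) $$ (i, p i) = (if i = p i then t - real h else 0) - signing E X i (p i)"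
        using Rij[of i "p i" X] rank_one_sum_carrier[of n edge_vec E X]
        by (auto simp: char_matrix_def)
    qed
    finally show ?thesis .
  qed
  have "(\<Sum>X\<in>Pow E. poly (char_poly (?R X)) t) > 0" if "t > \<rho>" for t
    using expected_char_ratio[OF E degle \<theta>, of "t - real h" "{..<n}"] that
    unfolding cp expected_char_def[symmetric] \<rho>_def by simp
  from rank_one_choice[OF E(1) this] obtain X where X: "X \<subseteq> E" "\<forall>t>\<rho>. poly (char_poly (?R X)) t > 0"
    by blast
  show thesis
  proof (rule that[OF X(1)])
    fix x :: "nat \<Rightarrow> real"
    have "(\<Sum>i<n. \<Sum>l<n. ?R X $$ (i,l) * (x i * x l)) \<le> \<rho> * (\<Sum>i<n. (x i)\<^sup>2)"
      by (rule quadratic_form_le[OF rank_one_sum_carrier symR]) (use X(2) in force)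
    moreover have "(\<Sum>i<n. \<Sum>l<n. ?R X $$ (i,l) * (x i * x l))
      = (\<Sum>i<n. \<Sum>l<n. (if i = l then real h * (x i)\<^sup>2 else 0) + signing E X i l * (x i * x l))"
      by (intro sum.cong refl) (auto simp: Rij algebra_simps power2_eq_square)
    moreover have "\<dots> = real h * (\<Sum>i<n. (x i)\<^sup>2) + (\<Sum>i<n. \<Sum>l<n. signing E X i l * (x i * x l))"
      by (simp add: sum.distrib sum_distrib_left)
    ultimately show "(\<Sum>i<n. \<Sum>j<n. signing E X i j * (x i * x j)) \<le> 2 * sqrt (real (h - 1)) * (\<Sum>i<n. (x i)\<^sup>2)"
      unfolding \<rho>_def \<theta>_def by (simp add: algebra_simps)
  qed
qed

section \<open>Bipartite expanders by repeated 2-lifts\<close>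

lemma sum_lessThan_add:
  fixes f :: "nat \<Rightarrow> 'a::comm_monoid_add"
  shows "(\<Sum>i<m+n. f i) = (\<Sum>i<m. f i) + (\<Sum>i<n. f (m + i))"
  by (induction n) (auto simp: add.assoc)

text \<open>The residue condition, inherited from the complete bipartite graph by all its lifts, allows labels that
  depend only on \<open>z mod h\<close> to distinguish the neighbours of a vertex.\<close>
definition bip_expander :: "nat \<Rightarrow> nat \<Rightarrow> (nat \<times> nat) set \<Rightarrow> bool" where
  "bip_expander h N B \<longleftrightarrow> B \<subseteq> {..<N} \<times> {..<N} \<and>
    (\<forall>y<N. \<forall>c<h. \<exists>!z. (y,z) \<in> B \<and> z mod h = c) \<and>
    (\<forall>z<N. card {y. (y,z) \<in> B} = h) \<and>
    (\<forall>x. (\<Sum>y<N. x y) = 0 \<longrightarrow>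
      (\<Sum>z<N. (\<Sum>y<N. if (y,z) \<in> B then x y else 0)\<^sup>2) \<le> 4 * real (h - 1) * (\<Sum>y<N. (x y)\<^sup>2))"

lemma bip_expander_left_degree:
  assumes "bip_expander h N B" "y < N" "h > 0"
  shows "bij_betw (\<lambda>z. z mod h) {z. (y,z) \<in> B} {..<h}" "card {z. (y,z) \<in> B} = h"
proof -
  show b: "bij_betw (\<lambda>z. z mod h) {z. (y,z) \<in> B} {..<h}"
    using assms unfolding bip_expander_def bij_betw_def inj_on_def
    by (auto simp: image_iff) (metis mod_less_divisor)+
  then show "card {z. (y,z) \<in> B} = h" using bij_betw_same_card by fastforce
qed

text \<open>A bound on the top eigenvalue alone suffices: the graph on the two sides, numbered below
  \<open>N\<close> and from \<open>N\<close> on, is bipartite, and its top eigenvalue is the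
  operator norm of the signed biadjacency matrix.\<close>

lemma bip_expander_signing:
  assumes B: "bip_expander h N B" and h: "h \<ge> 3"
  obtains X where "X \<subseteq> B"
    "\<And>x. (\<Sum>z<N. (\<Sum>y<N. if (y,z) \<in> B then if (y,z) \<in> X then - x y else x y else 0)\<^sup>2) \<le> 4 * real (h - 1) * (\<Sum>y<N. (x y)\<^sup>2)"
proof -
  have BN: "B \<subseteq> {..<N} \<times> {..<N}" using B by (simp add: bip_expander_def)
  define E where "E = (\<lambda>(y,z). (y, N + z)) ` B"
  have Eiff: "(i,j) \<in> E \<longleftrightarrow> N \<le> j \<and> (i, j - N) \<in> B" for i j
    unfolding E_def by (auto simp: image_iff Bex_def intro!: exI[of _ "j - N"])
  have EN: "i < N \<and> N \<le> j \<and> j < N + N" if "(i,j) \<in> E" for i j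
    using that BN unfolding Eiff by auto
  have fin: "finite E" unfolding E_def using BN finite_subset by blast
  have deg: "card {w. (v,w) \<in> E \<or> (w,v) \<in> E} = h" if v: "v < N + N" for v
  proof (cases "v < N")
    case True
    then have "{w. (v,w) \<in> E \<or> (w,v) \<in> E} = (+) N ` {z. (v,z) \<in> B}"
      using EN by (auto simp: Eiff image_iff) (metis le_add_diff_inverse)
    then show ?thesis
      using bip_expander_left_degree(2)[OF B True] h by (simp add: card_image)
  next
    case False
    then have "{w. (v,w) \<in> E \<or> (w,v) \<in> E} = {y. (y, v - N) \<in> B}"
      using EN by (auto simp: Eiff)
    moreover have "v - N < N" using v False by simp
    ultimately show ?thesis using B by (simp add: bip_expander_def)
  qed
  obtain X' where X': "X' \<subseteq> E" "\<And>x. (\<Sum>i<N+N. \<Sum>j<N+N. signing E X' i j * (x i * x j)) \<le> 2 * sqrt (real (h - 1)) * (\<Sum>i<N+N. (x i)\<^sup>2)"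
  proof (rule exists_good_signing[OF fin _ _ _ deg h])
    show "(j,i) \<notin> E" if "(i,j) \<in> E" for i j using EN[OF that] EN[of j i] by auto
    show "(i,i) \<notin> E" for i using EN[of i i] by auto
    show "E \<subseteq> {..<N+N} \<times> {..<N+N}" using EN by fastforce
  qed auto
  define X where "X = {(y,z). (y, N + z) \<in> X'}"
  have XB: "X \<subseteq> B" using X'(1) by (auto simp: X_def Eiff)
  define s where "s y z = (if (y,z) \<in> B then if (y,z) \<in> X then -1 else 1 else 0 :: real)" for y z
  have sg: "signing E X' y (N + z) = s y z" "signing E X' (N + z) y = s y z"
    "signing E X' y z = 0" "signing E X' (N + y) (N + z) = 0" if "y < N" "z < N" for y z
  proof -
    have e1: "(y, N + z) \<in> E \<longleftrightarrow> (y,z) \<in> B" for y z by (simp add: Eiff)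
    have e2: "(N + z, j) \<notin> E" for z j using EN[of "N + z" j] by auto
    have e3: "(i, j) \<notin> E" if "j < N" for i j using EN[of i j] that by auto
    have x1: "(y, N + z) \<in> X' \<longleftrightarrow> (y,z) \<in> X" for y z by (simp add: X_def)
    have b1: "(N + z, j) \<notin> B" for z j using BN by auto
    show "signing E X' y (N + z) = s y z" "signing E X' (N + z) y = s y z"
      "signing E X' y z = 0" "signing E X' (N + y) (N + z) = 0"
      using that by (simp_all add: signing_def s_def e1 e2 e3 x1 b1)
  qed
  show thesis
  proof (rule that[OF XB])
    fix x :: "nat \<Rightarrow> real"
    define \<rho> where "\<rho> = 2 * sqrt (real (h - 1))"
    have \<rho>: "\<rho> > 0" "\<rho>\<^sup>2 = 4 * real (h - 1)" using h by (auto simp: \<rho>_def power_mult_distrib)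
    define g where "g z = (\<Sum>y<N. s y z * x y)" for z
    \<comment> \<open>Test vector for a singular value: \<open>x\<close> on the left and its image
      on the right, scaled by 1/\<rho>. It gives 2 G/\<rho> \<le> \<rho> |x|^2 + G/\<rho>, that is,
      G \<le> \<rho>^2 |x|^2.\<close>
    define w where "w i = (if i < N then x i else g (i - N) / \<rho>)" for i
    define G where "G = (\<Sum>z<N. (g z)\<^sup>2)"
    have "(\<Sum>j<N+N. signing E X' y j * (w y * w j)) = (\<Sum>z<N. s y z * (x y * (g z / \<rho>)))" if "y < N" for y
      unfolding sum_lessThan_add using that sg by (simp add: w_def)
    moreover have "(\<Sum>j<N+N. signing E X' (N + z) j * (w (N + z) * w j)) = (\<Sum>y<N. s y z * ((g z / \<rho>) * x y))" if "z < N" for z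
      unfolding sum_lessThan_add using that sg by (simp add: w_def)
    ultimately have "(\<Sum>i<N+N. \<Sum>j<N+N. signing E X' i j * (w i * w j))
      = (\<Sum>y<N. \<Sum>z<N. s y z * (x y * (g z / \<rho>))) + (\<Sum>z<N. \<Sum>y<N. s y z * ((g z / \<rho>) * x y))"
      unfolding sum_lessThan_add[of _ N N] by simp
    also have "(\<Sum>y<N. \<Sum>z<N. s y z * (x y * (g z / \<rho>))) = (\<Sum>z<N. \<Sum>y<N. s y z * (x y * (g z / \<rho>)))"
      by (rule sum.swap)
    also have "\<dots> = G / \<rho>"
      unfolding G_def sum_divide_distrib
      by (rule sum.cong) (auto simp: g_def power2_eq_square sum_distrib_left sum_distrib_right sum_divide_distrib mult_ac)
    also have "(\<Sum>z<N. \<Sum>y<N. s y z * ((g z / \<rho>) * x y)) = G / \<rho>"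
      unfolding G_def sum_divide_distrib
      by (rule sum.cong) (auto simp: g_def power2_eq_square sum_distrib_left sum_distrib_right sum_divide_distrib mult_ac)
    finally have "(\<Sum>i<N+N. \<Sum>j<N+N. signing E X' i j * (w i * w j)) = 2 * G / \<rho>" by simp
    moreover have "(\<Sum>i<N+N. (w i)\<^sup>2) = (\<Sum>y<N. (x y)\<^sup>2) + G / \<rho>\<^sup>2"
      unfolding sum_lessThan_add G_def by (simp add: w_def power_divide sum_divide_distrib)
    ultimately have "2 * G / \<rho> \<le> \<rho> * ((\<Sum>y<N. (x y)\<^sup>2) + G / \<rho>\<^sup>2)"
      using X'(2)[of w] by (simp add: \<rho>_def)
    then have "2 * G \<le> \<rho>\<^sup>2 * (\<Sum>y<N. (x y)\<^sup>2) + G"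
      using \<rho>(1) by (simp add: field_simps power2_eq_square)
    then have "G \<le> 4 * real (h - 1) * (\<Sum>y<N. (x y)\<^sup>2)" using \<rho>(2) by simp
    moreover have "g z = (\<Sum>y<N. if (y,z) \<in> B then if (y,z) \<in> X then - x y else x y else 0)" for z
      unfolding g_def s_def by (rule sum.cong) auto
    ultimately show "(\<Sum>z<N. (\<Sum>y<N. if (y,z) \<in> B then if (y,z) \<in> X then - x y else x y else 0)\<^sup>2) \<le> 4 * real (h - 1) * (\<Sum>y<N. (x y)\<^sup>2)"
      unfolding G_def by simp
  qed
qed

lemma bip_expander_base:
  assumes "h > 0"
  shows "bip_expander h h ({..<h} \<times> {..<h})"
proof -
  have "\<exists>!z. (y,z) \<in> {..<h} \<times> {..<h} \<and> z mod h = c" if "y < h" "c < h" for y c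
    by (rule ex1I[of _ c]) (use that in auto)
  moreover have "{y. (y,z) \<in> {..<h} \<times> {..<h}} = {..<h}" if "z < h" for z using that by auto
  moreover have "(\<Sum>y<h. if (y,z) \<in> {..<h} \<times> {..<h} then x y else 0) = (\<Sum>y<h. x y)" if "z < h" for z and x :: "nat \<Rightarrow> real"
    by (rule sum.cong) (use that in auto)
  ultimately show ?thesis unfolding bip_expander_def by (auto intro!: mult_nonneg_nonneg sum_nonneg)
qed

text \<open>The sheets are y and N + y; the edges in the signing \<open>X\<close> cross between
  them. Sums over the two sheets see the old expander, differences see the signed one, and the
  parallelogram law recombines the bounds. Since \<open>h\<close> divides \<open>N\<close>, the
  vertices z and N + z have the same residue, which preserves the residue condition.\<close>

lemma bip_expander_lift:
  assumes B: "bip_expander h N B" and h: "h \<ge> 3" and dvd: "h dvd N"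
  shows "\<exists>B'. bip_expander h (2 * N) B'"
proof -
  have BN: "B \<subseteq> {..<N} \<times> {..<N}" using B by (simp add: bip_expander_def)
  obtain X where X: "X \<subseteq> B"
    "\<And>x. (\<Sum>z<N. (\<Sum>y<N. if (y,z) \<in> B then if (y,z) \<in> X then - x y else x y else 0)\<^sup>2) \<le> 4 * real (h - 1) * (\<Sum>y<N. (x y)\<^sup>2)"
    using bip_expander_signing[OF B h] by blast
  define lo where "lo y = (if y < N then y else y - N)" for y
  define B' where "B' = {(y,z). y < 2 * N \<and> z < 2 * N \<and> (lo y, lo z) \<in> B \<and>
    ((y < N) = (z < N)) = ((lo y, lo z) \<notin> X)}"
  have loN: "lo y < N" if "y < 2 * N" for y using that by (auto simp: lo_def)
  have lomod: "lo z mod h = z mod h" for z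
    using dvd by (auto simp: lo_def mod_diff_right_eq elim!: dvdE)
      (metis le_add_diff_inverse2 mod_mult_self2 mult.commute not_less)
  have up: "\<exists>!z. (y,z) \<in> B' \<and> z mod h = c" if y: "y < 2 * N" and c: "c < h" for y c
  proof -
    have ex1: "\<exists>!z. (lo y, z) \<in> B \<and> z mod h = c"
      using B loN[OF y] c by (auto simp: bip_expander_def)
    then obtain z0 where z0: "(lo y, z0) \<in> B" "z0 mod h = c" by blast
    then have uniq: "z = z0" if "(lo y, z) \<in> B" "z mod h = c" for z using ex1 that by blast
    have z0N: "z0 < N" using z0 BN by auto
    define z1 where "z1 = (if (y < N) = ((lo y, z0) \<notin> X) then z0 else N + z0)"
    have lo1: "lo z1 = z0" using z0N by (auto simp: z1_def lo_def)
    show ?thesis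
    proof (rule ex1I[of _ z1])
      show "(y,z1) \<in> B' \<and> z1 mod h = c"
        using y z0 z0N lo1 lomod[of z1] by (auto simp: B'_def z1_def)
      fix z assume z: "(y,z) \<in> B' \<and> z mod h = c"
      then have "lo z = z0" using uniq[of "lo z"] lomod[of z] by (auto simp: B'_def)
      then show "z = z1" using z z0N by (auto simp: B'_def z1_def lo_def split: if_splits)
    qed
  qed
  have right: "card {y. (y,z) \<in> B'} = h" if z: "z < 2 * N" for z
  proof -
    have yN: "y < N" if "(y,w) \<in> B" for y w using that BN by auto
    have XN: "y < N" if "(y,w) \<in> X" for y w using that X(1) yN by auto
    have lolo: "lo y = y" "lo (N + y) = y" if "y < N" for y using that by (auto simp: lo_def)
    have "bij_betw lo {y. (y,z) \<in> B'} {y. (y, lo z) \<in> B}"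
    proof (rule bij_betwI[of _ _ _ "\<lambda>y. if (z < N) = ((y, lo z) \<notin> X) then y else N + y"])
      show "lo \<in> {y. (y,z) \<in> B'} \<rightarrow> {y. (y, lo z) \<in> B}" by (auto simp: B'_def)
      show "(\<lambda>y. if (z < N) = ((y, lo z) \<notin> X) then y else N + y) \<in> {y. (y, lo z) \<in> B} \<rightarrow> {y. (y,z) \<in> B'}"
      proof (rule Pi_I)
        fix y assume "y \<in> {y. (y, lo z) \<in> B}"
        then have "(y, lo z) \<in> B" "y < N" using yN by auto
        then show "(if (z < N) = ((y, lo z) \<notin> X) then y else N + y) \<in> {y. (y,z) \<in> B'}"
          using z lolo[of y]
          by (cases "z < N"; cases "(y, lo z) \<in> X") (simp_all add: B'_def)
      qed
      show "(if (z < N) = ((lo y, lo z) \<notin> X) then lo y else N + lo y) = y" if "y \<in> {y. (y,z) \<in> B'}" for y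
        using that by (cases "y < N"; cases "z < N"; cases "(lo y, lo z) \<in> X") (simp_all add: B'_def, simp_all add: lo_def)
      show "lo (if (z < N) = ((y, lo z) \<notin> X) then y else N + y) = y" if "y \<in> {y. (y, lo z) \<in> B}" for y
      proof -
        have "y < N" using that yN by simp
        then show ?thesis using lolo[of y] by simp
      qed
    qed
    then show ?thesis using B loN[OF z] by (auto simp: bip_expander_def dest: bij_betw_same_card)
  qed
  have norm: "(\<Sum>z<2*N. (\<Sum>y<2*N. if (y,z) \<in> B' then x y else 0)\<^sup>2) \<le> 4 * real (h - 1) * (\<Sum>y<2*N. (x y)\<^sup>2)"
    if x0: "(\<Sum>y<2*N. x y) = 0" for x :: "nat \<Rightarrow> real"
  proof -
    define f where "f z = (\<Sum>y<2*N. if (y,z) \<in> B' then x y else 0)" for z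
    define s a where "s y = x y + x (N + y)" and "a y = x y - x (N + y)" for y
    define S A where "S z = (\<Sum>y<N. if (y,z) \<in> B then s y else 0)"
      and "A z = (\<Sum>y<N. if (y,z) \<in> B then if (y,z) \<in> X then - a y else a y else 0)" for z
    have fz: "f z = (\<Sum>y<N. if (y,z) \<in> B then if (y,z) \<in> X then x (N + y) else x y else 0)"
      "f (N + z) = (\<Sum>y<N. if (y,z) \<in> B then if (y,z) \<in> X then x y else x (N + y) else 0)" if "z < N" for z
      unfolding f_def mult_2 sum_lessThan_add sum.distrib[symmetric]
      by (intro sum.cong refl; use that in \<open>auto simp: B'_def lo_def\<close>)+
    have "f z + f (N + z) = S z" "f z - f (N + z) = A z" if "z < N" for z
      unfolding fz[OF that] S_def A_def sum.distrib[symmetric] sum_subtractf[symmetric]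
      by (intro sum.cong refl; auto simp: s_def a_def)+
    moreover have "2 * ((f z)\<^sup>2 + (f (N + z))\<^sup>2) = (f z + f (N + z))\<^sup>2 + (f z - f (N + z))\<^sup>2" for z
      by (simp add: power2_eq_square algebra_simps)
    ultimately have "2 * ((f z)\<^sup>2 + (f (N + z))\<^sup>2) = (S z)\<^sup>2 + (A z)\<^sup>2" if "z < N" for z
      using that by simp
    then have "2 * (\<Sum>z<2*N. (f z)\<^sup>2) = (\<Sum>z<N. (S z)\<^sup>2) + (\<Sum>z<N. (A z)\<^sup>2)"
      unfolding mult_2[of N] sum_lessThan_add sum.distrib[symmetric] sum_distrib_left by simp
    also have "(\<Sum>z<N. (S z)\<^sup>2) \<le> 4 * real (h - 1) * (\<Sum>y<N. (s y)\<^sup>2)"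
    proof -
      have "(\<Sum>y<N. s y) = 0"
        using x0 unfolding s_def mult_2 sum_lessThan_add sum.distrib .
      then show ?thesis using B unfolding bip_expander_def S_def by blast
    qed
    also have "(\<Sum>z<N. (A z)\<^sup>2) \<le> 4 * real (h - 1) * (\<Sum>y<N. (a y)\<^sup>2)"
      unfolding A_def by (rule X(2))
    also have "4 * real (h - 1) * (\<Sum>y<N. (s y)\<^sup>2) + 4 * real (h - 1) * (\<Sum>y<N. (a y)\<^sup>2)
      = 4 * real (h - 1) * (\<Sum>y<N. (s y)\<^sup>2 + (a y)\<^sup>2)"
      by (simp add: sum.distrib distrib_left)
    also have "(\<Sum>y<N. (s y)\<^sup>2 + (a y)\<^sup>2) = 2 * (\<Sum>y<2*N. (x y)\<^sup>2)"
      unfolding mult_2[of N] sum_lessThan_add sum.distrib[symmetric] sum_distrib_left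
      by (rule sum.cong) (auto simp: s_def a_def power2_eq_square algebra_simps)
    finally show ?thesis unfolding f_def by simp
  qed
  have "B' \<subseteq> {..<2*N} \<times> {..<2*N}" by (auto simp: B'_def)
  then have "bip_expander h (2 * N) B'"
    unfolding bip_expander_def
    by (intro conjI allI impI) (assumption | erule (1) up | erule right | erule norm)+
  then show ?thesis ..
qed

theorem bip_expander_exists:
  assumes "h \<ge> 3"
  shows "\<exists>B. bip_expander h (h * 2 ^ j) B"
proof (induction j)
  case 0
  then show ?case using bip_expander_base[of h] assms by auto
next
  case (Suc j)
  then obtain B where "bip_expander h (h * 2 ^ j) B" by blast
  from bip_expander_lift[OF this assms] show ?case by (simp add: mult.left_commute)
qed

subsection \<open>Second eigenvalues of graphs\<close>

lemma nth_1_rev_sort: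
  fixes xs :: "real list"
  assumes "length (filter (\<lambda>x. x > c) xs) = 1" "length (filter (\<lambda>x. x \<ge> c) xs) \<ge> 2"
  shows "rev (sort xs) ! 1 = c"
proof -
  let ?L = "rev (sort xs)"
  have len: "length (filter P ?L) = length (filter P xs)" for P
    by (simp add: rev_filter[symmetric] filter_sort)
  have cnt: "length (filter P ?L) = card {i. i < length ?L \<and> P (?L ! i)}" for P
    by (rule length_filter_conv_card)
  have dec: "?L ! j \<le> ?L ! i" if "i \<le> j" "j < length ?L" for i j
    using that sorted_rev_nth_mono[of ?L i j] by simp
  have "length ?L \<ge> 2"
    using order_trans[OF assms(2) length_filter_le] by simp
  have "\<not> ?L ! 1 > c"
  proof
    assume a: "?L ! 1 > c"
    have "{0,1} \<subseteq> {i. i < length ?L \<and> ?L ! i > c}"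
      using a dec[of 0 1] \<open>length ?L \<ge> 2\<close> by auto
    then have "card {0,1::nat} \<le> card {i. i < length ?L \<and> ?L ! i > c}"
      by (intro card_mono) auto
    then show False using cnt[of "\<lambda>x. x > c"] len[of "\<lambda>x. x > c"] assms(1) by simp
  qed
  moreover have "\<not> ?L ! 1 < c"
  proof
    assume a: "?L ! 1 < c"
    have "{i. i < length ?L \<and> ?L ! i \<ge> c} \<subseteq> {0}"
    proof
      fix i assume i: "i \<in> {i. i < length ?L \<and> ?L ! i \<ge> c}"
      then have "\<not> 1 \<le> i" using dec[of 1 i] a by auto
      then show "i \<in> {0}" by simp
    qed
    then have "card {i. i < length ?L \<and> ?L ! i \<ge> c} \<le> card {0::nat}"
      by (intro card_mono) auto
    then show False using cnt[of "\<lambda>x. x \<ge> c"] len[of "\<lambda>x. x \<ge> c"] assms(2) by simp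
  qed
  ultimately show ?thesis by simp
qed

text \<open>The assumption \<open>top\<close> speaks only of eigenvectors with sum zero, so the
  graph need not be shown connected separately: exactly one eigenvalue exceeds \<tau>, at least
  \<open>k\<close> equal it, and this fixes position 1 of the sorted list.\<close>

lemma second_eigenvalueI:
  fixes a :: "nat \<Rightarrow> nat \<Rightarrow> real"
  assumes sym: "\<And>i j. i < n \<Longrightarrow> j < n \<Longrightarrow> a i j = a j i"
    and const: "\<And>i. i < n \<Longrightarrow> (\<Sum>j<n. a i j) = d"
    and top: "\<And>x \<mu>. (\<And>i. i < n \<Longrightarrow> (\<Sum>j<n. a i j * x j) = \<mu> * x i) \<Longrightarrow> (\<Sum>i<n. x i) = 0 \<Longrightarrow>
      (\<exists>i<n. x i \<noteq> 0) \<Longrightarrow> \<mu> \<le> \<tau>"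
    and "\<tau> < d" "n > 0" "k \<ge> 1"
    and f: "\<And>m i. m < k \<Longrightarrow> i < n \<Longrightarrow> (\<Sum>j<n. a i j * f m j) = \<tau> * f m i"
      "\<And>m l. m < k \<Longrightarrow> l < k \<Longrightarrow> (\<Sum>i<n. f m i * f l i) = (if m = l then 1 else 0)"
  shows "second_eigenvalue (mat n n (\<lambda>(i,j). a i j)) = \<tau> \<and>
    eigenvalue_multiplicity (mat n n (\<lambda>(i,j). a i j)) \<tau> \<ge> k"
proof -
  define A where "A = mat n n (\<lambda>(i,j). a i j)"
  have A: "A \<in> carrier_mat n n" "transpose_mat A = A"
    using sym by (auto simp: A_def intro!: eq_matI)
  obtain p \<epsilon> where
    "\<forall>j<n. \<forall>k<n. (\<Sum>i<n. p j i * p k i) = (if j = k then 1 else 0)"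
    "\<forall>x y. (\<Sum>i<n. x i * y i) = (\<Sum>j<n. (\<Sum>i<n. x i * p j i) * (\<Sum>i<n. y i * p j i))"
    "\<forall>i<n. \<forall>j<n. (\<Sum>l<n. A $$ (i,l) * p j l) = \<epsilon> j * p j i"
    "char_poly A = (\<Prod>j<n. [:- \<epsilon> j, 1:])"
    using real_symmetric_spectral_resolution[OF A] by (elim exE conjE)
  note p = this[rule_format]
  have eig: "(\<Sum>l<n. a i l * p j l) = \<epsilon> j * p j i" if "i < n" "j < n" for i j
    using p(3)[OF that] that by (simp add: A_def)
  define xs where "xs = map \<epsilon> [0..<n]"
  have "proots (char_poly A) = mset xs"
  proof -
    have "proots (\<Prod>j<m. [:- \<epsilon> j, 1:]) = mset (map \<epsilon> [0..<m])" for m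
    proof (induction m)
      case (Suc m)
      have "(\<Prod>j<m. [:- \<epsilon> j, 1:]) \<noteq> 0" by simp
      then have "proots ((\<Prod>j<m. [:- \<epsilon> j, 1:]) * [:- \<epsilon> m, 1:]) = proots (\<Prod>j<m. [:- \<epsilon> j, 1:]) + proots [:- \<epsilon> m, 1:]"
        by (intro proots_mult) auto
      then show ?case using Suc by (simp only: prod.lessThan_Suc) simp
    qed simp
    then show ?thesis unfolding p(4) xs_def .
  qed
  then have L: "eigenvalue_list A = rev (sort xs)"
    unfolding eigenvalue_list_def by simp
  have cnt: "length (filter P xs) = card {j. j < n \<and> P (\<epsilon> j)}" for P
    unfolding length_filter_conv_card by (rule arg_cong[of _ _ card]) (auto simp: xs_def)

  have ortho: "(\<Sum>i<n. x i * p j i) = 0"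
    if "j < n" "\<And>i. i < n \<Longrightarrow> (\<Sum>l<n. a i l * x l) = \<mu> * x i" "\<epsilon> j \<noteq> \<mu>" for x j \<mu>
  proof -
    have "\<mu> * (\<Sum>i<n. x i * p j i) = (\<Sum>i<n. (\<Sum>l<n. a i l * x l) * p j i)"
      unfolding sum_distrib_left by (rule sum.cong) (use that in auto)
    also have "\<dots> = (\<Sum>i<n. x i * (\<Sum>l<n. a i l * p j l))"
      by (rule symmetric_adjoint[OF sym])
    also have "\<dots> = (\<Sum>i<n. x i * (\<epsilon> j * p j i))"
      by (rule sum.cong) (use that eig in auto)
    also have "\<dots> = \<epsilon> j * (\<Sum>i<n. x i * p j i)" by (simp add: sum_distrib_left mult_ac)
    finally show ?thesis using that(3) by simp
  qed
  have parseval: "(\<Sum>i<n. (x i)\<^sup>2) = (\<Sum>j<n. (\<Sum>i<n. x i * p j i)\<^sup>2)" for x :: "nat \<Rightarrow> real"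
    using p(2)[of x x] by (simp add: power2_eq_square)
  define \<sigma> where "\<sigma> j = (\<Sum>i<n. p j i)" for j
  have nz: "\<exists>i<n. p j i \<noteq> 0" if "j < n" for j
  proof (rule ccontr)
    assume "\<not> ?thesis"
    then have "(\<Sum>i<n. p j i * p j i) = 0" by simp
    then show False using p(1)[OF that that] by simp
  qed
  have big: "\<sigma> j \<noteq> 0 \<and> \<epsilon> j = d" if j: "j < n" "\<epsilon> j > \<tau>" for j
  proof
    show "\<sigma> j \<noteq> 0"
    proof
      assume "\<sigma> j = 0"
      then have "\<epsilon> j \<le> \<tau>"
        by (intro top[of "p j"]) (use eig j nz in \<open>auto simp: \<sigma>_def\<close>)
      then show False using j by simp
    qed
    then show "\<epsilon> j = d"
      using ortho[OF j(1), of "\<lambda>_. 1" d] const by (auto simp: \<sigma>_def)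
  qed
  have card1: "card {j. j < n \<and> \<epsilon> j > \<tau>} = 1"
  proof -
    have "\<exists>j<n. \<epsilon> j > \<tau>"
    proof (rule ccontr)
      assume "\<not> ?thesis"
      then have "(\<Sum>i<n. 1 * p j i) = 0" if "j < n" for j
        using that \<open>\<tau> < d\<close> const by (intro ortho[of j "\<lambda>_. 1" d]) force+
      then have "(\<Sum>i<n. (1::real)\<^sup>2) = 0" using parseval[of "\<lambda>_. 1"] by simp
      then show False using \<open>n > 0\<close> by simp
    qed
    then obtain j where j: "j < n" "\<epsilon> j > \<tau>" by blast
    moreover have "l = j" if l: "l < n" "\<epsilon> l > \<tau>" for l
    proof (rule ccontr)
      assume "l \<noteq> j"
      \<comment> \<open>Two basis vectors with eigenvalue above \<tau> both belong to
        \<open>d\<close>; this combination has sum zero and still eigenvalue \<open>d\<close>,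
        contradicting \<open>top\<close>.\<close>
      define y where "y i = \<sigma> l * p j i - \<sigma> j * p l i" for i
      have "d \<le> \<tau>"
      proof (rule top)
        show "(\<Sum>m<n. a i m * y m) = d * y i" if "i < n" for i
        proof -
          have "(\<Sum>m<n. a i m * y m) = \<sigma> l * (\<Sum>m<n. a i m * p j m) - \<sigma> j * (\<Sum>m<n. a i m * p l m)"
            unfolding y_def by (simp add: right_diff_distrib sum_subtractf sum_distrib_left mult_ac)
          then show ?thesis using that eig j l big[OF j] big[OF l] by (simp add: y_def algebra_simps)
        qed
        show "(\<Sum>i<n. y i) = 0"
          unfolding y_def sum_subtractf sum_distrib_left[symmetric] \<sigma>_def[symmetric] by simp
        show "\<exists>i<n. y i \<noteq> 0"
        proof (rule ccontr)
          assume "\<not> ?thesis"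
          then have "(\<Sum>i<n. y i * p j i) = 0" by simp
          moreover have "(\<Sum>i<n. y i * p j i) = \<sigma> l * (\<Sum>i<n. p j i * p j i) - \<sigma> j * (\<Sum>i<n. p l i * p j i)"
            unfolding y_def by (simp add: algebra_simps sum_subtractf sum_distrib_left)
          ultimately show False using p(1) j l \<open>l \<noteq> j\<close> big[OF l] by simp
        qed
      qed
      then show False using \<open>\<tau> < d\<close> by simp
    qed
    ultimately have "{j. j < n \<and> \<epsilon> j > \<tau>} = {j}" by blast
    then show ?thesis by simp
  qed
  define J where "J = {j. j < n \<and> \<epsilon> j = \<tau>}"
  \<comment> \<open>Double counting of squared coefficients: for each \<open>m\<close> they sum to 1
    over \<open>J\<close> by Parseval, and for each basis vector they sum to at most 1 over
    \<open>m\<close> by Bessel.\<close>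
  have cardJ: "k \<le> card J"
  proof -
    define c where "c m j = (\<Sum>i<n. f m i * p j i)" for m j
    have c0: "c m j = 0" if "m < k" "j < n" "j \<notin> J" for m j
      unfolding c_def by (rule ortho[of j "f m" \<tau>]) (use that f(1) in \<open>auto simp: J_def\<close>)
    have row: "(\<Sum>j\<in>J. (c m j)\<^sup>2) = 1" if "m < k" for m
    proof -
      have "(\<Sum>j\<in>J. (c m j)\<^sup>2) = (\<Sum>j<n. (c m j)\<^sup>2)"
        by (rule sum.mono_neutral_left) (use c0 that in \<open>auto simp: J_def\<close>)
      also have "\<dots> = (\<Sum>i<n. (f m i)\<^sup>2)" unfolding c_def by (rule parseval[symmetric])
      finally show ?thesis using f(2)[OF that that] by (simp add: power2_eq_square)
    qed
    have col: "(\<Sum>m<k. (c m j)\<^sup>2) \<le> 1" if "j < n" for j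
    proof -
      define g where "g i = (\<Sum>m<k. c m j * f m i)" for i
      have pg: "(\<Sum>i<n. p j i * g i) = (\<Sum>m<k. (c m j)\<^sup>2)"
      proof -
        have "(\<Sum>i<n. p j i * g i) = (\<Sum>i<n. \<Sum>m<k. c m j * (f m i * p j i))"
          unfolding g_def by (simp add: sum_distrib_left mult_ac)
        also have "\<dots> = (\<Sum>m<k. \<Sum>i<n. c m j * (f m i * p j i))" by (rule sum.swap)
        finally show ?thesis by (simp add: c_def power2_eq_square flip: sum_distrib_left)
      qed
      have gg: "(\<Sum>i<n. g i * g i) = (\<Sum>m<k. (c m j)\<^sup>2)"
      proof -
        have "(\<Sum>i<n. g i * g i) = (\<Sum>i<n. \<Sum>m<k. \<Sum>l<k. c m j * c l j * (f m i * f l i))"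
          unfolding g_def by (simp add: sum_product mult_ac)
        also have "\<dots> = (\<Sum>m<k. \<Sum>i<n. \<Sum>l<k. c m j * c l j * (f m i * f l i))" by (rule sum.swap)
        also have "\<dots> = (\<Sum>m<k. \<Sum>l<k. \<Sum>i<n. c m j * c l j * (f m i * f l i))"
          by (rule sum.cong[OF refl], rule sum.swap)
        also have "\<dots> = (\<Sum>m<k. \<Sum>l<k. if m = l then (c m j)\<^sup>2 else 0)"
          by (intro sum.cong refl) (auto simp: f(2) power2_eq_square simp flip: sum_distrib_left)
        finally show ?thesis by simp
      qed
      have "0 \<le> (\<Sum>i<n. (p j i - g i)\<^sup>2)" by (rule sum_nonneg) simp
      also have "\<dots> = (\<Sum>i<n. p j i * p j i) - 2 * (\<Sum>i<n. p j i * g i) + (\<Sum>i<n. g i * g i)"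
      proof -
        have "(\<Sum>i<n. (p j i - g i)\<^sup>2) = (\<Sum>i<n. p j i * p j i - 2 * (p j i * g i) + g i * g i)"
          by (rule sum.cong) (auto simp: power2_eq_square algebra_simps)
        then show ?thesis by (simp add: sum.distrib sum_subtractf sum_distrib_left)
      qed
      also have "\<dots> = 1 - (\<Sum>m<k. (c m j)\<^sup>2)" unfolding pg gg using p(1)[OF that that] by simp
      finally show ?thesis by simp
    qed
    have "real k = (\<Sum>m<k. \<Sum>j\<in>J. (c m j)\<^sup>2)" using row by simp
    also have "\<dots> = (\<Sum>j\<in>J. \<Sum>m<k. (c m j)\<^sup>2)" by (rule sum.swap)
    also have "\<dots> \<le> (\<Sum>j\<in>J. 1)" by (rule sum_mono) (use col in \<open>auto simp: J_def\<close>)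
    finally show ?thesis by simp
  qed
  have "card {j. j < n \<and> \<epsilon> j \<ge> \<tau>} = card {j. j < n \<and> \<epsilon> j > \<tau>} + card J"
    by (subst card_Un_disjoint[symmetric]) (auto simp: J_def intro!: arg_cong[of _ _ card])
  then have "rev (sort xs) ! 1 = \<tau>"
    using card1 cardJ \<open>k \<ge> 1\<close> by (intro nth_1_rev_sort) (simp_all add: cnt)
  moreover have "count_list (rev (sort xs)) \<tau> = card J"
  proof -
    have "count_list (rev (sort xs)) \<tau> = count (mset xs) \<tau>" by (simp add: count_mset[symmetric])
    also have "\<dots> = length (filter (\<lambda>x. x = \<tau>) xs)"
      by (simp add: count_mset count_list_eq_length_filter) (metis (mono_tags, lifting))
    finally show ?thesis unfolding cnt J_def .
  qed
  ultimately show ?thesis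
    using cardJ unfolding A_def[symmetric] second_eigenvalue_def eigenvalue_multiplicity_def L by simp
qed

text \<open>Moves the criterion to the vertex set {..<n}, where the increasing enumeration used by
  \<open>adjacency_matrix\<close> is the identity. The eigenvectors \<open>f\<close> may be
  unnormalised; the factors \<nu> take care of that.\<close>

theorem graph_on_nat:
  fixes U :: "'a set" and adj :: "'a \<Rightarrow> 'a \<Rightarrow> bool"
  assumes U: "finite U" "U \<noteq> {}"
    and sym: "\<And>p q. p \<in> U \<Longrightarrow> q \<in> U \<Longrightarrow> adj p q \<Longrightarrow> adj q p"
    and irrefl: "\<And>p. p \<in> U \<Longrightarrow> \<not> adj p p"
    and deg: "\<And>p. p \<in> U \<Longrightarrow> card {q\<in>U. adj p q} = d"
    and top: "\<And>x \<mu>. (\<And>p. p \<in> U \<Longrightarrow> (\<Sum>q | q \<in> U \<and> adj p q. x q) = \<mu> * x p) \<Longrightarrow> (\<Sum>p\<in>U. x p) = 0 \<Longrightarrow>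
      (\<exists>p\<in>U. x p \<noteq> 0) \<Longrightarrow> \<mu> \<le> \<tau>"
    and "\<tau> < real d" "k \<ge> 1"
    and f: "\<And>m p. m < k \<Longrightarrow> p \<in> U \<Longrightarrow> (\<Sum>q | q \<in> U \<and> adj p q. f m q) = \<tau> * f m p"
      "\<And>m l. m < k \<Longrightarrow> l < k \<Longrightarrow> m \<noteq> l \<Longrightarrow> (\<Sum>p\<in>U. f m p * f l p) = 0"
      "\<And>m. m < k \<Longrightarrow> (\<Sum>p\<in>U. (f m p)\<^sup>2) > 0"
  shows "\<exists>G :: nat pair_pre_digraph. pair_graph G \<and> card (pverts G) = card U \<and> regular d G \<and>
    second_eigenvalue (adjacency_matrix G) = \<tau> \<and>
    eigenvalue_multiplicity (adjacency_matrix G) \<tau> \<ge> k"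
proof -
  define n where "n = card U"
  obtain h where h: "bij_betw h {..<n} U"
    using ex_bij_betw_nat_finite[OF U(1)] unfolding n_def atLeast0LessThan by blast
  have hU: "h i \<in> U" if "i < n" for i using h that by (auto simp: bij_betw_def)
  define g where "g = the_inv_into {..<n} h"
  have gh: "g (h i) = i" if "i < n" for i
    unfolding g_def using h that by (simp add: bij_betw_def the_inv_into_f_f)
  have hg: "h (g p) = p" "g p < n" if "p \<in> U" for p
    using h that f_the_inv_into_f_bij_betw[OF h] the_inv_into_into[of h "{..<n}" p "{..<n}"]
    unfolding g_def by (auto simp: bij_betw_def)
  define a where "a i j = (if adj (h i) (h j) then 1 else 0 :: real)" for i j
  define G where "G = \<lparr>pverts = {..<n}, parcs = {(i,j). i < n \<and> j < n \<and> adj (h i) (h j)}\<rparr>"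
  have a_sum: "(\<Sum>j<n. a i j * x j) = (\<Sum>q | q \<in> U \<and> adj (h i) q. x (g q))" for i x
  proof -
    have "(\<Sum>j<n. a i j * x j) = (\<Sum>j<n. if adj (h i) (h j) then x (g (h j)) else 0)"
      by (rule sum.cong) (auto simp: a_def gh)
    also have "\<dots> = (\<Sum>q\<in>U. if adj (h i) q then x (g q) else 0)"
      by (rule sum.reindex_bij_betw[OF h])
    also have "\<dots> = (\<Sum>q | q \<in> U \<and> adj (h i) q. x (g q))"
      using U(1) by (simp add: sum.inter_filter)
    finally show ?thesis .
  qed
  have parc: "finite (parcs G)"
    by (rule finite_subset[of _ "{..<n} \<times> {..<n}"]) (auto simp: G_def)
  have pg: "pair_graph G"
  proof
    show "finite (pverts G)" by (simp add: G_def)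
    show "finite (parcs G)" by (rule parc)
    show "fst e \<in> pverts G" "snd e \<in> pverts G" "fst e \<noteq> snd e" if "e \<in> parcs G" for e
      using that irrefl hU by (auto simp: G_def)
    show "symmetric (with_proj G)"
      unfolding symmetric_def by (auto simp: G_def sym_def hU intro: sym)
  qed
  have am: "adjacency_matrix G = mat n n (\<lambda>(i,j). a i j)"
    unfolding adjacency_matrix_def Let_def
    by (rule eq_matI) (auto simp: G_def a_def atLeast0LessThan[symmetric] sorted_list_of_set_range)
  have reg: "regular d G"
    unfolding regular_def
  proof
    fix i assume "i \<in> pverts G"
    then have i: "i < n" by (simp add: G_def)
    have "out_arcs (with_proj G) i = (\<lambda>q. (i, g q)) ` {q \<in> U. adj (h i) q}"
      using i hU hg gh by (auto simp: out_arcs_def G_def image_iff) metis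
    moreover have "inj_on (\<lambda>q. (i, g q)) {q \<in> U. adj (h i) q}"
      by (rule inj_onI) (metis (no_types, lifting) hg(1) mem_Collect_eq prod.inject)
    ultimately show "out_degree (with_proj G) i = d"
      unfolding out_degree_def using deg[OF hU[OF i]] by (simp add: card_image)
  qed
  define \<nu> where "\<nu> m = sqrt (\<Sum>p\<in>U. (f m p)\<^sup>2)" for m
  have \<nu>: "\<nu> m > 0" "\<nu> m * \<nu> m = (\<Sum>p\<in>U. (f m p)\<^sup>2)" if "m < k" for m
    using f(3)[OF that] by (auto simp: \<nu>_def)
  have "second_eigenvalue (mat n n (\<lambda>(i,j). a i j)) = \<tau> \<and> eigenvalue_multiplicity (mat n n (\<lambda>(i,j). a i j)) \<tau> \<ge> k"
  proof (rule second_eigenvalueI[where d = "real d" and f = "\<lambda>m i. f m (h i) / \<nu> m"])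
    show "a i j = a j i" if "i < n" "j < n" for i j
      using that sym hU by (auto simp: a_def)
    show "(\<Sum>j<n. a i j) = real d" if "i < n" for i
      using a_sum[of i "\<lambda>_. 1"] deg[OF hU[OF that]] by simp
    show "\<tau> < real d" "1 \<le> k" by fact+
    show "0 < n" using U by (simp add: n_def card_gt_0_iff)
    show "(\<Sum>j<n. a i j * (f m (h j) / \<nu> m)) = \<tau> * (f m (h i) / \<nu> m)" if "m < k" "i < n" for m i
    proof -
      have "(\<Sum>j<n. a i j * (f m (h j) / \<nu> m)) = (\<Sum>q | q \<in> U \<and> adj (h i) q. f m q) / \<nu> m"
        unfolding a_sum sum_divide_distrib by (rule sum.cong) (auto simp: hg)
      then show ?thesis using f(1)[OF that(1) hU[OF that(2)]] by simp
    qed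
    show "(\<Sum>i<n. f m (h i) / \<nu> m * (f l (h i) / \<nu> l)) = (if m = l then 1 else 0)" if "m < k" "l < k" for m l
    proof -
      have "(\<Sum>i<n. f m (h i) / \<nu> m * (f l (h i) / \<nu> l)) = (\<Sum>p\<in>U. f m p / \<nu> m * (f l p / \<nu> l))"
        by (rule sum.reindex_bij_betw[OF h])
      also have "\<dots> = (\<Sum>p\<in>U. f m p * f l p) / (\<nu> m * \<nu> l)"
        by (simp add: sum_divide_distrib)
      finally show ?thesis using f(2) that \<nu>[OF that(1)]
        by (auto simp: power2_eq_square)
    qed
    fix x \<mu>
    assume x: "\<And>i. i < n \<Longrightarrow> (\<Sum>j<n. a i j * x j) = \<mu> * x i" "(\<Sum>i<n. x i) = 0" "\<exists>i<n. x i \<noteq> 0"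
    show "\<mu> \<le> \<tau>"
    proof (rule top[of "\<lambda>q. x (g q)"])
      show "(\<Sum>q | q \<in> U \<and> adj p q. x (g q)) = \<mu> * x (g p)" if "p \<in> U" for p
        using x(1)[of "g p"] a_sum[of "g p" x] hg[OF that] by simp
      have "(\<Sum>p\<in>U. x (g p)) = (\<Sum>i<n. x (g (h i)))" by (rule sum.reindex_bij_betw[OF h, symmetric])
      then show "(\<Sum>p\<in>U. x (g p)) = 0" using x(2) by (simp add: gh)
      show "\<exists>p\<in>U. x (g p) \<noteq> 0" using x(3) hU gh by metis
    qed
  qed
  then show ?thesis
    using pg reg am by (intro exI[of _ G]) (simp add: G_def n_def)
qed

subsection \<open>Words over four letters\<close>

lemma sum_lessThan_times:
  fixes f :: "nat \<Rightarrow> 'a::comm_monoid_add"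
  shows "(\<Sum>i<m*n. f i) = (\<Sum>a<m. \<Sum>b<n. f (a * n + b))"
proof (induction m)
  case (Suc m)
  have "(\<Sum>i<k+n. f i) = (\<Sum>i<k. f i) + (\<Sum>b<n. f (k + b))" for k
    by (induction n) (auto simp: add.assoc)
  then show ?case using Suc by (simp add: add.commute[of n])
qed simp

lemma sum_mult_le:
  fixes f g :: "'a \<Rightarrow> real"
  shows "\<bar>\<Sum>i\<in>A. f i * g i\<bar> \<le> ((\<Sum>i\<in>A. (f i)\<^sup>2) + (\<Sum>i\<in>A. (g i)\<^sup>2)) / 2"
proof -
  have "\<bar>\<Sum>i\<in>A. f i * g i\<bar> \<le> (\<Sum>i\<in>A. \<bar>f i * g i\<bar>)" by (rule sum_abs)
  also have "\<dots> \<le> (\<Sum>i\<in>A. ((f i)\<^sup>2 + (g i)\<^sup>2) / 2)"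
  proof (rule sum_mono)
    fix i
    have "0 \<le> (\<bar>f i\<bar> - \<bar>g i\<bar>)\<^sup>2" by simp
    then show "\<bar>f i * g i\<bar> \<le> ((f i)\<^sup>2 + (g i)\<^sup>2) / 2"
      by (simp add: power2_diff abs_mult)
  qed
  finally show ?thesis by (simp add: sum.distrib flip: sum_divide_distrib)
qed

text \<open>States \<open>0, 1, 2, 3\<close> stand for \<open>(1,+), (1,-), (2,+), (2,-)\<close>, a part and a sign.\<close>
definition flip2 :: "nat \<Rightarrow> nat" where "flip2 q = [0,1,3,2] ! q"
definition flip_all :: "nat \<Rightarrow> nat" where "flip_all q = [1,0,3,2] ! q"
definition swap_parts :: "nat \<Rightarrow> nat" where "swap_parts q = [2,3,0,1] ! q"
definition swap_flip :: "nat \<Rightarrow> nat" where "swap_flip q = [3,2,1,0] ! q"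

text \<open>With \<open>flip2\<close> listed twice, the sum of the four permutation matrices is the
  all-ones matrix plus f f^T minus g g^T, for f = (1,-1,0,0) and g = (0,0,1,-1). Its eigenvalues are
  4, 2, -2 and 0.\<close>

definition move :: "nat \<Rightarrow> nat \<Rightarrow> nat" where
  "move b = [flip2, flip2, swap_parts, swap_flip] ! b"

lemma less4_cases: "(q::nat) < 4 \<longleftrightarrow> q = 0 \<or> q = 1 \<or> q = 2 \<or> q = 3"
  by auto

lemma sum_less4: "(\<Sum>q<4::nat. f q) = f 0 + f 1 + f 2 + (f 3 :: 'a::comm_monoid_add)"
  by (simp add: eval_nat_numeral add_ac)

lemmas move_defs = move_def flip2_def flip_all_def swap_parts_def swap_flip_def

lemma involutions:
  assumes "q < 4"
  shows "flip2 q < 4" "flip2 (flip2 q) = q" "flip_all q < 4" "flip_all (flip_all q) = q"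
    "swap_parts q < 4" "swap_parts (swap_parts q) = q" "swap_flip q < 4" "swap_flip (swap_flip q) = q"
  using assms by (auto simp: less4_cases move_defs)

lemma move_involution:
  assumes "q < 4" "b < 4"
  shows "move b q < 4" "move b (move b q) = q"
  using assms by (auto simp: less4_cases move_defs)

definition words :: "nat \<Rightarrow> nat list set" where
  "words k = {v. set v \<subseteq> {..<4} \<and> length v = k}"

lemma finite_words [simp]: "finite (words k)"
  unfolding words_def by (rule finite_lists_length_eq) simp

lemma card_words: "card (words k) = 4 ^ k"
  unfolding words_def by (simp add: card_lists_length_eq)

lemma words_0: "words 0 = {[]}" by (auto simp: words_def)

lemma words_Cons: "q # v \<in> words (Suc k) \<longleftrightarrow> q < 4 \<and> v \<in> words k"
  by (auto simp: words_def)

lemma sum_words_Suc: "(\<Sum>v\<in>words (Suc k). f v) = (\<Sum>v\<in>words k. \<Sum>q<4. f (q # v))"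
proof -
  have eq: "words (Suc k) = (\<lambda>(v,q). q # v) ` (words k \<times> {..<4})"
  proof (rule Set.set_eqI)
    fix w show "w \<in> words (Suc k) \<longleftrightarrow> w \<in> (\<lambda>(v,q). q # v) ` (words k \<times> {..<4})"
      by (cases w) (auto simp: words_def image_iff)
  qed
  show ?thesis
    unfolding eq sum.cartesian_product
    by (subst sum.reindex) (auto intro!: inj_onI sum.cong)
qed

text \<open>The base-4 digits of \<open>w\<close> select, for each letter, a shift of the four moves.\<close>
fun act :: "nat \<Rightarrow> nat \<Rightarrow> nat list \<Rightarrow> nat list" where
  "act w b [] = []"
| "act w b (q # v) = move ((b + w) mod 4) q # act (w div 4) b v"

lemma act_words: "v \<in> words k \<Longrightarrow> act w b v \<in> words k"
proof (induction v arbitrary: w k)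
  case (Cons q v)
  then obtain k' where "k = Suc k'" by (cases k) (auto simp: words_def)
  with Cons show ?case by (auto simp: words_Cons move_involution)
qed simp

lemma act_act: "v \<in> words k \<Longrightarrow> act w b (act w b v) = v"
proof (induction v arbitrary: w k)
  case (Cons q v)
  then obtain k' where "k = Suc k'" by (cases k) (auto simp: words_def)
  with Cons show ?case by (auto simp: words_Cons move_involution)
qed simp

lemma act_nth: "j < length v \<Longrightarrow> act w b v ! j = move ((b + w div 4 ^ j) mod 4) (v ! j)"
proof (induction v arbitrary: w j)
  case (Cons q v)
  then show ?case by (cases j) (auto simp: div_mult2_eq)
qed simp

lemma sum_act: "(\<Sum>v\<in>words k. f (act w b v)) = (\<Sum>v\<in>words k. f v)"
  by (rule sum.reindex_bij_witness[of _ "act w b" "act w b"]) (auto simp: act_words act_act)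

text \<open>Used in two ways: over \<open>b\<close> at a fixed middle vertex, which makes one-letter
  functions exact, and over one digit of \<open>w\<close> at a fixed \<open>b\<close>, which makes
  the letters independent.\<close>

lemma sum_shift4: "(\<Sum>r<4. f (move ((b + r) mod 4) q)) = (\<Sum>r<4. f (move r q))"
proof -
  have "(\<Sum>r<4. f (move ((c + r) mod 4) q)) = (\<Sum>r<4. f (move r q))" if "c < 4" for c
    using that unfolding less4_cases
    by (elim disjE) (simp_all add: sum_less4 add_ac numeral_2_eq_2[symmetric] del: One_nat_def)
  from this[of "b mod 4"] show ?thesis by (simp add: mod_add_left_eq)
qed

lemma sum_act_shift:
  "(\<Sum>w<4^k. f (act w b v)) = (\<Sum>w<4^k. f (act w 0 v))" if "v \<in> words k" for f :: "nat list \<Rightarrow> real"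
  using that
proof (induction v arbitrary: k f)
  case Nil
  then show ?case by simp
next
  case (Cons q v)
  then obtain k' where k': "k = Suc k'" by (cases k) (auto simp: words_def)
  then have v: "v \<in> words k'" using Cons.prems by (simp add: words_Cons)
  have *: "(\<Sum>w<4^k. f (act w b (q # v))) = (\<Sum>r<4. \<Sum>w<4^k'. f (move r q # act w b v))" for b
  proof -
    have "(\<Sum>w<4^k. f (act w b (q # v))) = (\<Sum>w<4^k'. \<Sum>r<4. f (act (w * 4 + r) b (q # v)))"
      unfolding k' power_Suc2 by (rule sum_lessThan_times)
    also have "\<dots> = (\<Sum>w<4^k'. \<Sum>r<4. f (move ((b + r) mod 4) q # act w b v))"
      by (intro sum.cong refl) (auto simp: mod_add_right_eq[symmetric, of b "_ * 4 + _"] div_add1_eq)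
    also have "\<dots> = (\<Sum>w<4^k'. \<Sum>r<4. f (move r q # act w b v))"
      by (rule sum.cong[OF refl], rule sum_shift4[of "\<lambda>q'. f (q' # _)"])
    also have "\<dots> = (\<Sum>r<4. \<Sum>w<4^k'. f (move r q # act w b v))" by (rule sum.swap)
    finally show ?thesis .
  qed
  show ?case unfolding * by (intro sum.cong refl Cons.IH v)
qed

section \<open>Norm bounds for the unnormalised tensor power\<close>

definition act_form :: "nat \<Rightarrow> (nat list \<Rightarrow> real) \<Rightarrow> real" where
  "act_form k x = (\<Sum>v\<in>words k. \<Sum>w<4^k. x v * x (act w 0 v))"

text \<open>The sum of the four moves is resolved on the first letter into its rank-one terms: the
  all-ones matrix acts through the letter sum, and the two difference terms enter with opposite
  signs.\<close>

lemma act_form_Suc: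
  "act_form (Suc k) x = act_form k (\<lambda>v. \<Sum>q<4. x (q # v))
    + act_form k (\<lambda>v. x (0 # v) - x (1 # v)) - act_form k (\<lambda>v. x (2 # v) - x (3 # v))"
proof -
  have inner: "(\<Sum>w<4^Suc k. x (q # v) * x (act w 0 (q # v)))
    = (\<Sum>w<4^k. \<Sum>r<4. x (q # v) * x (move r q # act w 0 v))" for q v
  proof -
    have "(\<Sum>w<4^Suc k. x (q # v) * x (act w 0 (q # v)))
      = (\<Sum>w<4^k. \<Sum>r<4. x (q # v) * x (act (w * 4 + r) 0 (q # v)))"
      unfolding power_Suc2 by (rule sum_lessThan_times)
    also have "\<dots> = (\<Sum>w<4^k. \<Sum>r<4. x (q # v) * x (move r q # act w 0 v))"
      by (intro sum.cong refl) auto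
    finally show ?thesis .
  qed
  have "act_form (Suc k) x = (\<Sum>v\<in>words k. \<Sum>q<4. \<Sum>w<4^k. \<Sum>r<4. x (q # v) * x (move r q # act w 0 v))"
    unfolding act_form_def sum_words_Suc inner ..
  also have "\<dots> = (\<Sum>v\<in>words k. \<Sum>w<4^k. \<Sum>q<4. \<Sum>r<4. x (q # v) * x (move r q # act w 0 v))"
    by (intro sum.cong refl sum.swap)
  also have "\<dots> = (\<Sum>v\<in>words k. \<Sum>w<4^k.
      (\<Sum>q<4. x (q # v)) * (\<Sum>q<4. x (q # act w 0 v))
      + (x (0 # v) - x (1 # v)) * (x (0 # act w 0 v) - x (1 # act w 0 v))
      - (x (2 # v) - x (3 # v)) * (x (2 # act w 0 v) - x (3 # act w 0 v)))"
    by (intro sum.cong refl) (simp add: sum_less4 move_defs algebra_simps)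
  also have "\<dots> = act_form k (\<lambda>v. \<Sum>q<4. x (q # v))
    + act_form k (\<lambda>v. x (0 # v) - x (1 # v)) - act_form k (\<lambda>v. x (2 # v) - x (3 # v))"
    by (simp add: act_form_def sum.distrib sum_subtractf)
  finally show ?thesis .
qed

definition sqnorm :: "nat \<Rightarrow> (nat list \<Rightarrow> real) \<Rightarrow> real" where
  "sqnorm k x = (\<Sum>v\<in>words k. (x v)\<^sup>2)"

text \<open>Bessel's inequality on four states for (1,1,1,1), (1,-1,0,0) and (0,0,1,-1), whose
  squared norms 4, 2, 2 are the denominators.\<close>

lemma sqnorm_Suc:
  "sqnorm k (\<lambda>v. \<Sum>q<4. x (q # v)) / 4 + sqnorm k (\<lambda>v. x (0 # v) - x (1 # v)) / 2
    + sqnorm k (\<lambda>v. x (2 # v) - x (3 # v)) / 2 \<le> sqnorm (Suc k) x"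
proof -
  have "(a+b+c+d)\<^sup>2 / 4 + (a-b)\<^sup>2 / 2 + (c-d)\<^sup>2 / 2 \<le> a\<^sup>2 + b\<^sup>2 + c\<^sup>2 + d\<^sup>2" for a b c d :: real
  proof -
    have "0 \<le> (a + b - c - d)\<^sup>2" by simp
    then show ?thesis by (simp add: power2_eq_square field_simps)
  qed
  then show ?thesis
    unfolding sqnorm_def sum_words_Suc sum_divide_distrib sum.distrib[symmetric]
    by (intro sum_mono) (simp add: sum_less4)
qed

lemma act_form_le: "\<bar>act_form k x\<bar> \<le> 4 ^ k * sqnorm k x"
proof -
  have "act_form k x = (\<Sum>w<4^k. \<Sum>v\<in>words k. x v * x (act w 0 v))"
    unfolding act_form_def by (rule sum.swap)
  also have "\<bar>\<dots>\<bar> \<le> (\<Sum>w<4^k. \<bar>\<Sum>v\<in>words k. x v * x (act w 0 v)\<bar>)" by (rule sum_abs)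
  also have "\<dots> \<le> (\<Sum>w<(4::nat)^k. sqnorm k x)"
  proof (rule sum_mono)
    fix w
    have "\<bar>\<Sum>v\<in>words k. x v * x (act w 0 v)\<bar> \<le> (sqnorm k x + (\<Sum>v\<in>words k. (x (act w 0 v))\<^sup>2)) / 2"
      unfolding sqnorm_def by (rule sum_mult_le)
    also have "(\<Sum>v\<in>words k. (x (act w 0 v))\<^sup>2) = sqnorm k x"
      unfolding sqnorm_def by (rule sum_act)
    finally show "\<bar>\<Sum>v\<in>words k. x v * x (act w 0 v)\<bar> \<le> sqnorm k x" by simp
  qed
  finally show ?thesis by simp
qed

text \<open>Peel off the first letter. The letter sum still has mean zero; the two differences get
  only the trivial bound, but with eigenvalue 2 in place of 4, which is the factor 1/2.\<close>

lemma act_form_le_mean_zero: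
  "(\<Sum>v\<in>words k. x v) = 0 \<Longrightarrow> \<bar>act_form k x\<bar> \<le> 4 ^ k / 2 * sqnorm k x"
proof (induction k arbitrary: x)
  case 0
  then show ?case by (simp add: words_0 act_form_def sqnorm_def)
next
  case (Suc k)
  let ?s = "\<lambda>v. \<Sum>q<4. x (q # v)" and ?f = "\<lambda>v. x (0 # v) - x (1 # v)" and ?g = "\<lambda>v. x (2 # v) - x (3 # v)"
  have "\<bar>act_form k ?s\<bar> \<le> 4 ^ k / 2 * sqnorm k ?s" using Suc by (simp add: sum_words_Suc)
  moreover note act_form_le[of k ?f] act_form_le[of k ?g]
  ultimately have "\<bar>act_form (Suc k) x\<bar> \<le> 4 ^ k / 2 * sqnorm k ?s + 4 ^ k * sqnorm k ?f + 4 ^ k * sqnorm k ?g"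
    unfolding act_form_Suc by linarith
  also have "\<dots> = 4 ^ k * 2 * (sqnorm k ?s / 4 + sqnorm k ?f / 2 + sqnorm k ?g / 2)" by (simp add: algebra_simps)
  also have "\<dots> \<le> 4 ^ k * 2 * sqnorm (Suc k) x" by (intro mult_left_mono sqnorm_Suc) simp
  finally show ?case by simp
qed

text \<open>With vanishing one-letter marginals at least two nontrivial eigenvalues are multiplied:
  the differences in the first letter now have mean zero themselves, so they gain a second factor
  1/2.\<close>

lemma act_form_le_letters_zero:
  assumes "(\<Sum>v\<in>words k. x v) = 0" "\<And>j q. j < k \<Longrightarrow> q < 4 \<Longrightarrow> (\<Sum>v\<in>words k. if v ! j = q then x v else 0) = 0"
  shows "\<bar>act_form k x\<bar> \<le> 4 ^ k / 4 * sqnorm k x"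
  using assms
proof (induction k arbitrary: x)
  case 0
  then show ?case by (simp add: words_0 act_form_def sqnorm_def)
next
  case (Suc k)
  let ?s = "\<lambda>v. \<Sum>q<4. x (q # v)" and ?f = "\<lambda>v. x (0 # v) - x (1 # v)" and ?g = "\<lambda>v. x (2 # v) - x (3 # v)"
  have "\<bar>act_form k ?s\<bar> \<le> 4 ^ k / 4 * sqnorm k ?s"
  proof (rule Suc.IH)
    show "(\<Sum>v\<in>words k. ?s v) = 0" using Suc.prems(1) by (simp add: sum_words_Suc)
    fix j q :: nat assume "j < k" "q < 4"
    then have "(\<Sum>v\<in>words (Suc k). if v ! Suc j = q then x v else 0) = 0" using Suc.prems(2) by simp
    moreover have "(\<Sum>v\<in>words k. if v ! j = q then ?s v else 0) = (\<Sum>v\<in>words (Suc k). if v ! Suc j = q then x v else 0)"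
      unfolding sum_words_Suc by (intro sum.cong refl) (auto simp: sum_less4)
    ultimately show "(\<Sum>v\<in>words k. if v ! j = q then ?s v else 0) = 0" by simp
  qed
  moreover have first: "(\<Sum>v\<in>words k. x (q # v)) = 0" if "q < 4" for q
  proof -
    have "(\<Sum>v\<in>words k. x (q # v)) = (\<Sum>v\<in>words (Suc k). if v ! 0 = q then x v else 0)"
      unfolding sum_words_Suc using that by (intro sum.cong refl) (auto simp: sum_less4 less4_cases)
    then show ?thesis using Suc.prems(2)[of 0 q] that by simp
  qed
  have "\<bar>act_form k ?f\<bar> \<le> 4 ^ k / 2 * sqnorm k ?f"
    using first[of 0] first[of 1] by (intro act_form_le_mean_zero) (simp add: sum_subtractf)
  moreover have "\<bar>act_form k ?g\<bar> \<le> 4 ^ k / 2 * sqnorm k ?g"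
    using first[of 2] first[of 3] by (intro act_form_le_mean_zero) (simp add: sum_subtractf)
  ultimately have "\<bar>act_form (Suc k) x\<bar> \<le> 4 ^ k / 4 * sqnorm k ?s + 4 ^ k / 2 * sqnorm k ?f + 4 ^ k / 2 * sqnorm k ?g"
    unfolding act_form_Suc by linarith
  also have "\<dots> = 4 ^ k * (sqnorm k ?s / 4 + sqnorm k ?f / 2 + sqnorm k ?g / 2)" by (simp add: algebra_simps)
  also have "\<dots> \<le> 4 ^ k * sqnorm (Suc k) x" by (intro mult_left_mono sqnorm_Suc) simp
  finally show ?case by simp
qed

subsection \<open>Adding a fibre of labels\<close>

lemma xor_nat_less:
  fixes i l :: nat
  assumes "i < 2 ^ m" "l < 2 ^ m"
  shows "xor i l < 2 ^ m"
proof -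
  have "take_bit m (xor i l) = xor i l"
    using assms by (simp add: take_bit_xor take_bit_nat_eq_self)
  then show ?thesis by (metis take_bit_nat_less_exp)
qed

lemma xor_nat_cancel: "xor (xor i l) l = (i::nat)" "xor i (xor i l) = (l::nat)"
  by (simp_all add: xor.assoc) (simp add: xor.assoc[symmetric])

lemma sum_xor:
  fixes f :: "nat \<Rightarrow> 'a::comm_monoid_add"
  assumes "l < 2 ^ m"
  shows "(\<Sum>i<2^m. f (xor i l)) = (\<Sum>i<2^m. f i)"
  by (rule sum.reindex_bij_witness[of _ "\<lambda>i. xor i l" "\<lambda>i. xor i l"])
    (auto simp: xor_nat_cancel xor_nat_less assms)

lemma sum_xor':
  fixes f :: "nat \<Rightarrow> 'a::comm_monoid_add"
  assumes "i < 2 ^ m"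
  shows "(\<Sum>l<2^m. f (xor i l)) = (\<Sum>l<2^m. f l)"
  using sum_xor[OF assms, of f] by (simp add: xor.commute)

text \<open>The labels used are those outside \<open>{..<256 * u}\<close>: the blocks \<open>\<beta> < u\<close> are moved to \<open>\<beta> + u\<close>,
  which leaves room for the labels of the remaining edges and hardly disturbs uniformity.\<close>
definition label :: "nat \<Rightarrow> nat \<Rightarrow> nat \<Rightarrow> nat \<Rightarrow> nat" where
  "label u \<beta> c b = 256 * (if \<beta> < u then \<beta> + u else \<beta>) + (4 * c + b)"

lemma label_less:
  assumes "\<beta> < 2 ^ a" "2 * u \<le> 2 ^ a" "c < 64" "b < 4"
  shows "label u \<beta> c b < 2 ^ (a + 8)" "256 * u \<le> label u \<beta> c b"
proof -
  let ?\<beta> = "if \<beta> < u then \<beta> + u else \<beta>"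
  have "?\<beta> < 2 ^ a" using assms by auto
  then have "?\<beta> + 1 \<le> 2 ^ a" by simp
  then have "256 * (?\<beta> + 1) \<le> 256 * 2 ^ a" by (rule mult_le_mono2)
  then show "label u \<beta> c b < 2 ^ (a + 8)" using assms by (simp add: label_def power_add)
  show "256 * u \<le> label u \<beta> c b" by (simp add: label_def)
qed

text \<open>Only \<open>c\<close> and \<open>b\<close> are read off, modulo 256. That is enough to
  recover a neighbour \<open>z\<close>, since \<open>c\<close> will be its residue modulo 64, while
  \<beta> serves to spread the labels over the group.\<close>

lemma label_inj:
  assumes "label u \<beta> c b = label u \<beta>' c' b'" "c < 64" "b < 4" "c' < 64" "b' < 4"
  shows "c = c' \<and> b = b'"
proof -
  have "label u \<beta> c b mod 256 = 4 * c + b" "label u \<beta>' c' b' mod 256 = 4 * c' + b'"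
    using assms(2-) by (simp_all add: label_def)
  then have e: "4 * c + b = 4 * c' + b'" using assms(1) by simp
  then have "(4 * c + b) div 4 = (4 * c' + b') div 4" by simp
  then have "c = c'" using assms by simp
  then show ?thesis using e by simp
qed

definition fibre_sq :: "nat \<Rightarrow> nat \<Rightarrow> (nat list \<Rightarrow> nat \<Rightarrow> real) \<Rightarrow> real" where
  "fibre_sq k m y = (\<Sum>v\<in>words k. \<Sum>i<2^m. (y v i)\<^sup>2)"

lemma fibre_pair_le:
  assumes "l < 2 ^ m"
  shows "\<bar>\<Sum>v\<in>words k. \<Sum>i<2^m. x v i * y (act w b v) (xor i l)\<bar> \<le> (fibre_sq k m x + fibre_sq k m y) / 2"
proof -
  let ?P = "words k \<times> {..<2^m::nat}"
  have pair: "(\<Sum>v\<in>words k. \<Sum>i<2^m. g v i) = (\<Sum>p\<in>?P. g (fst p) (snd p))" for g :: "nat list \<Rightarrow> nat \<Rightarrow> real"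
    by (simp add: sum.cartesian_product case_prod_unfold)
  have "(\<Sum>v\<in>words k. \<Sum>i<2^m. (y (act w b v) (xor i l))\<^sup>2) = (\<Sum>v\<in>words k. \<Sum>i<2^m. (y (act w b v) i)\<^sup>2)"
    by (rule sum.cong[OF refl], rule sum_xor[OF assms])
  then have "(\<Sum>v\<in>words k. \<Sum>i<2^m. (y (act w b v) (xor i l))\<^sup>2) = fibre_sq k m y"
    unfolding fibre_sq_def sum_act[of "\<lambda>v. \<Sum>i<2^m. (y v i)\<^sup>2"] .
  then show ?thesis
    using sum_mult_le[of "\<lambda>p. x (fst p) (snd p)" "\<lambda>p. y (act w b (fst p)) (xor (snd p) l)" ?P]
    unfolding fibre_sq_def[of k m x] pair by simp
qed

lemma sum_block:
  fixes f :: "nat \<Rightarrow> 'a::comm_monoid_add"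
  shows "(\<Sum>\<beta><K. \<Sum>c<64. \<Sum>b<4. f (256 * \<beta> + (4 * c + b))) = (\<Sum>l<256 * K. f l)"
proof -
  have "(\<Sum>l<256 * K. f l) = (\<Sum>\<beta><K. \<Sum>t<64 * 4. f (\<beta> * 256 + t))"
    using sum_lessThan_times[of f K 256] by (simp add: mult.commute)
  also have "\<dots> = (\<Sum>\<beta><K. \<Sum>c<64. \<Sum>b<4. f (\<beta> * 256 + (c * 4 + b)))"
    by (rule sum.cong[OF refl], rule sum_lessThan_times)
  finally show ?thesis by (simp add: mult.commute)
qed

lemma sum_power2_le:
  fixes f :: "nat \<Rightarrow> real"
  assumes "n > 0"
  shows "(\<Sum>i<n. f i)\<^sup>2 \<le> real n * (\<Sum>i<n. (f i)\<^sup>2)"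
proof -
  define s where "s = (\<Sum>i<n. f i)"
  have "0 \<le> (\<Sum>i<n. (real n * f i - s)\<^sup>2)" by (rule sum_nonneg) simp
  also have "\<dots> = (\<Sum>i<n. (real n)\<^sup>2 * (f i)\<^sup>2 - 2 * real n * s * f i + s\<^sup>2)"
    by (rule sum.cong) (auto simp: power2_eq_square algebra_simps)
  also have "\<dots> = real n * (real n * (\<Sum>i<n. (f i)\<^sup>2) - s\<^sup>2)"
    by (simp add: sum.distrib sum_subtractf flip: sum_distrib_left s_def) (simp add: power2_eq_square algebra_simps)
  finally show ?thesis using assms unfolding s_def by (simp add: zero_le_mult_iff)
qed

text \<open>The indices \<open>w\<close>, \<beta>, \<open>c\<close> are the mixed-radix digits of a
  middle vertex z = (w * 2^a + \<beta>) * 64 + c. This is the path part of the adjacency form, up to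
  a factor, for functions that do not depend on \<open>y\<close>.\<close>

definition fibre_form :: "nat \<Rightarrow> nat \<Rightarrow> nat \<Rightarrow> (nat list \<Rightarrow> nat \<Rightarrow> real) \<Rightarrow> real" where
  "fibre_form k a u y = (\<Sum>w<4^k. \<Sum>\<beta><2^a. \<Sum>c<64. \<Sum>b<4.
     \<Sum>v\<in>words k. \<Sum>i<2^(a+8). y v i * y (act w b v) (xor i (label u \<beta> c b)))"

lemma sum_rotate6:
  fixes f :: "nat \<Rightarrow> nat \<Rightarrow> nat \<Rightarrow> nat \<Rightarrow> 'v \<Rightarrow> nat \<Rightarrow> real"
  shows "(\<Sum>w<n0. \<Sum>\<beta><n1. \<Sum>c<n2. \<Sum>b<n3. \<Sum>v\<in>V. \<Sum>i<n4. f w \<beta> c b v i)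
    = (\<Sum>v\<in>V. \<Sum>i<n4. \<Sum>\<beta><n1. \<Sum>c<n2. \<Sum>b<n3. \<Sum>w<n0. f w \<beta> c b v i)"
proof -
  define T where "T = {..<n1} \<times> {..<n2} \<times> {..<n3}"
  have triple: "(\<Sum>\<beta><n1. \<Sum>c<n2. \<Sum>b<n3. g \<beta> c b) = (\<Sum>t\<in>T. g (fst t) (fst (snd t)) (snd (snd t)))"
    for g :: "nat \<Rightarrow> nat \<Rightarrow> nat \<Rightarrow> real"
    unfolding T_def by (simp add: sum.cartesian_product case_prod_unfold)
  have pair: "(\<Sum>v\<in>V. \<Sum>i<n4. g v i) = (\<Sum>p\<in>V \<times> {..<n4}. g (fst p) (snd p))" for g :: "'v \<Rightarrow> nat \<Rightarrow> real"
    by (simp add: sum.cartesian_product case_prod_unfold)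
  have "(\<Sum>w<n0. \<Sum>t\<in>T. \<Sum>p\<in>P. F w t p) = (\<Sum>p\<in>P. \<Sum>t\<in>T. \<Sum>w<n0. F w t p)"
    for F and P :: "('v \<times> nat) set"
  proof -
    have "(\<Sum>w<n0. \<Sum>t\<in>T. \<Sum>p\<in>P. F w t p) = (\<Sum>w<n0. \<Sum>p\<in>P. \<Sum>t\<in>T. F w t p)"
      by (rule sum.cong[OF refl], rule sum.swap)
    also have "\<dots> = (\<Sum>p\<in>P. \<Sum>w<n0. \<Sum>t\<in>T. F w t p)" by (rule sum.swap)
    also have "\<dots> = (\<Sum>p\<in>P. \<Sum>t\<in>T. \<Sum>w<n0. F w t p)" by (rule sum.cong[OF refl], rule sum.swap)
    finally show ?thesis .
  qed
  then show ?thesis unfolding pair triple .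
qed

text \<open>Uniform labels would average over the fibre and leave \<open>act_form\<close> of the
  fibre sums: a quarter of the trivial bound 4^k * 2^(a+8). The moved blocks are at most 1/64 of
  all; losing the old labels and gaining the new ones costs at most 2/64, and 1/4 + 1/32 =
  9/32.\<close>

lemma fibre_form_le:
  assumes zero: "(\<Sum>v\<in>words k. \<Sum>i<2^(a+8). y v i) = 0"
    "\<And>j q. j < k \<Longrightarrow> q < 4 \<Longrightarrow> (\<Sum>v\<in>words k. \<Sum>i<2^(a+8). if v ! j = q then y v i else 0) = 0"
    and a: "64 * u \<le> 2 ^ a"
  shows "fibre_form k a u y \<le> 4 ^ k * 2 ^ (a + 8) * (9 / 32) * fibre_sq k (a + 8) y"
proof -
  let ?M = "2 ^ (a + 8) :: nat"
  have M: "256 * 2 ^ a = ?M" by (simp add: power_add)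
  have u2: "2 * u \<le> 2 ^ a" using a by simp
  let ?d = "\<lambda>w \<beta> c b v i. y v i * y (act w 0 v) (xor i (256 * (\<beta> + u) + (4 * c + b))) - y v i * y (act w 0 v) (xor i (256 * \<beta> + (4 * c + b)))"
  define s where "s v = (\<Sum>i<?M. y v i)" for v
  define S where "S v i l = (\<Sum>w<4^k. y (act w 0 v) (xor i l))" for v i l
  \<comment> \<open>Contribution of the labels gained minus those lost when the first
    \<open>u\<close> blocks are moved.\<close>
  define D where "D v i = (\<Sum>\<beta><u. \<Sum>c<64. \<Sum>b<4. S v i (256 * (\<beta> + u) + (4 * c + b)) - S v i (256 * \<beta> + (4 * c + b)))" for v i
  have total: "(\<Sum>l<?M. S v i l) = (\<Sum>w<4^k. s (act w 0 v))" if "i < ?M" for v i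
  proof -
    have "(\<Sum>l<?M. S v i l) = (\<Sum>w<4^k. \<Sum>l<?M. y (act w 0 v) (xor i l))"
      unfolding S_def by (rule sum.swap)
    also have "\<dots> = (\<Sum>w<4^k. s (act w 0 v))"
      unfolding s_def by (rule sum.cong[OF refl], rule sum_xor'[OF that])
    finally show ?thesis .
  qed
  have lab: "(\<Sum>\<beta><2^a. \<Sum>c<64. \<Sum>b<4. S v i (label u \<beta> c b)) = (\<Sum>w<4^k. s (act w 0 v)) + D v i" if "i < ?M" for v i
  proof -
    have "(\<Sum>\<beta><2^a. \<Sum>c<64. \<Sum>b<4. S v i (label u \<beta> c b))
      = (\<Sum>\<beta><2^a. (\<Sum>c<64. \<Sum>b<4. S v i (256 * \<beta> + (4 * c + b))) +
         (if \<beta> < u then \<Sum>c<64. \<Sum>b<4. S v i (256 * (\<beta> + u) + (4 * c + b)) - S v i (256 * \<beta> + (4 * c + b)) else 0))"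
      by (rule sum.cong) (auto simp: label_def sum_subtractf)
    also have "\<dots> = (\<Sum>\<beta><2^a. \<Sum>c<64. \<Sum>b<4. S v i (256 * \<beta> + (4 * c + b))) +
      (\<Sum>\<beta><2^a. if \<beta> < u then \<Sum>c<64. \<Sum>b<4. S v i (256 * (\<beta> + u) + (4 * c + b)) - S v i (256 * \<beta> + (4 * c + b)) else 0)"
      by (rule sum.distrib)
    also have "(\<Sum>\<beta><2^a. \<Sum>c<64. \<Sum>b<4. S v i (256 * \<beta> + (4 * c + b))) = (\<Sum>w<4^k. s (act w 0 v))"
      unfolding sum_block M by (rule total[OF that])
    also have "(\<Sum>\<beta><2^a. if \<beta> < u then \<Sum>c<64. \<Sum>b<4. S v i (256 * (\<beta> + u) + (4 * c + b)) - S v i (256 * \<beta> + (4 * c + b)) else 0) = D v i"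
    proof -
      have "{\<beta> \<in> {..<2^a}. \<beta> < u} = {..<u}" using u2 by auto
      then show ?thesis unfolding D_def by (simp flip: sum.inter_filter)
    qed
    finally show ?thesis .
  qed
  have "fibre_form k a u y = (\<Sum>v\<in>words k. \<Sum>i<?M. \<Sum>\<beta><2^a. \<Sum>c<64. \<Sum>b<4. \<Sum>w<4^k. y v i * y (act w b v) (xor i (label u \<beta> c b)))"
    unfolding fibre_form_def by (rule sum_rotate6)
  also have "\<dots> = (\<Sum>v\<in>words k. \<Sum>i<?M. y v i * (\<Sum>\<beta><2^a. \<Sum>c<64. \<Sum>b<4. S v i (label u \<beta> c b)))"
    unfolding sum_distrib_left[symmetric] S_def
    by (rule sum.cong[OF refl], rule sum.cong[OF refl], rule arg_cong2[of _ _ _ _ "(*)", OF refl],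
      rule sum.cong[OF refl], rule sum.cong[OF refl], rule sum.cong[OF refl], rule sum_act_shift)
  also have "\<dots> = (\<Sum>v\<in>words k. \<Sum>i<?M. y v i * (\<Sum>w<4^k. s (act w 0 v)) + y v i * D v i)"
    by (intro sum.cong refl) (simp add: lab distrib_left)
  also have "\<dots> = (\<Sum>v\<in>words k. \<Sum>i<?M. y v i * (\<Sum>w<4^k. s (act w 0 v))) + (\<Sum>v\<in>words k. \<Sum>i<?M. y v i * D v i)"
    by (simp add: sum.distrib)
  also have "(\<Sum>v\<in>words k. \<Sum>i<?M. y v i * (\<Sum>w<4^k. s (act w 0 v))) = act_form k s"
  proof -
    have "(\<Sum>i<?M. y v i * c) = s v * c" for v c by (simp add: s_def sum_distrib_right)
    then show ?thesis unfolding act_form_def sum_distrib_left[symmetric] by (simp only:)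
  qed
  finally have F: "fibre_form k a u y = act_form k s + (\<Sum>v\<in>words k. \<Sum>i<?M. y v i * D v i)" .
  have "act_form k s \<le> 4 ^ k / 4 * sqnorm k s"
  proof -
    have "(\<Sum>v\<in>words k. if v ! j = q then s v else 0) = 0" if "j < k" "q < 4" for j q
    proof -
      have "(\<Sum>v\<in>words k. if v ! j = q then s v else 0) = (\<Sum>v\<in>words k. \<Sum>i<?M. if v ! j = q then y v i else 0)"
        by (rule sum.cong) (auto simp: s_def)
      then show ?thesis using zero(2)[OF that] by simp
    qed
    moreover have "(\<Sum>v\<in>words k. s v) = 0" using zero(1) by (simp add: s_def)
    ultimately show ?thesis by (intro abs_le_D1[OF act_form_le_letters_zero])
  qed
  also have "sqnorm k s \<le> real ?M * fibre_sq k (a + 8) y"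
    unfolding sqnorm_def fibre_sq_def sum_distrib_left
  proof (rule sum_mono)
    fix v
    have "(s v)\<^sup>2 \<le> real ?M * (\<Sum>i<?M. (y v i)\<^sup>2)"
      unfolding s_def by (rule sum_power2_le) simp
    then show "(s v)\<^sup>2 \<le> (\<Sum>i<?M. real ?M * (y v i)\<^sup>2)" by (simp add: sum_distrib_left)
  qed
  finally have 1: "act_form k s \<le> 4 ^ k / 4 * (real ?M * fibre_sq k (a + 8) y)"
    by (simp add: mult_left_mono)
  have "(\<Sum>v\<in>words k. \<Sum>i<?M. y v i * D v i)
    = (\<Sum>v\<in>words k. \<Sum>i<?M. \<Sum>\<beta><u. \<Sum>c<64. \<Sum>b<4. \<Sum>w<4^k. ?d w \<beta> c b v i)"
    unfolding D_def S_def by (simp add: sum_distrib_left right_diff_distrib sum_subtractf)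
  also have "\<dots> = (\<Sum>w<4^k. \<Sum>\<beta><u. \<Sum>c<64. \<Sum>b<4. \<Sum>v\<in>words k. \<Sum>i<?M. ?d w \<beta> c b v i)"
    by (rule sum_rotate6[symmetric])
  also have "\<dots> \<le> (\<Sum>w<(4::nat)^k. \<Sum>\<beta><u. \<Sum>c<64::nat. \<Sum>b<4::nat. 2 * fibre_sq k (a + 8) y)"
  proof (intro sum_mono)
    fix w \<beta> c b :: nat
    assume "\<beta> \<in> {..<u}" "c \<in> {..<64}" "b \<in> {..<4}"
    then have "256 * (\<beta> + u) + (4 * c + b) < ?M" "256 * \<beta> + (4 * c + b) < ?M" using a M by auto
    have diff_le: "p - q \<le> 2 * f" if "\<bar>p\<bar> \<le> (f + f) / 2" "\<bar>q\<bar> \<le> (f + f) / 2" for p q f :: real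
    proof -
      have "\<bar>p\<bar> \<le> f" "\<bar>q\<bar> \<le> f" using that by simp_all
      then show ?thesis by linarith
    qed
    from \<open>256 * (\<beta> + u) + (4 * c + b) < ?M\<close> \<open>256 * \<beta> + (4 * c + b) < ?M\<close>
    show "(\<Sum>v\<in>words k. \<Sum>i<?M. ?d w \<beta> c b v i) \<le> 2 * fibre_sq k (a + 8) y"
      unfolding sum_subtractf by (intro diff_le fibre_pair_le)
  qed
  also have "\<dots> = 4 ^ k * (8 * (64 * real u)) * fibre_sq k (a + 8) y" by simp
  also have "\<dots> \<le> 4 ^ k * (8 * 2 ^ a) * fibre_sq k (a + 8) y"
  proof -
    have "64 * real u \<le> 2 ^ a" using a by (metis of_nat_le_iff of_nat_mult of_nat_numeral of_nat_power)
    moreover have "fibre_sq k (a + 8) y \<ge> 0" unfolding fibre_sq_def by (intro sum_nonneg) simp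
    ultimately show ?thesis by (intro mult_right_mono mult_left_mono) auto
  qed
  finally show ?thesis using 1 unfolding F by (simp add: power_add algebra_simps)
qed

subsection \<open>The sparsified product\<close>

locale sparse_product =
  fixes k u a :: nat and B :: "(nat \<times> nat) set"
  assumes B: "bip_expander 64 (4 ^ k * 2 ^ a * 64) B"
    and a: "64 * u \<le> 2 ^ a" and u: "u \<ge> 10 ^ 5"
begin

definition N where "N = 4 ^ k * 2 ^ a * (64::nat)"
definition M where "M = (2::nat) ^ (a + 8)"
text \<open>Paths already use \<open>flip2\<close> with weight 2 * 64^2 = 8192, so 2u - 8192 more
  copies bring it to 2u. The other three edges are one \<open>flip_all\<close>, for the -1 on the
  diagonal of the odd block of \<open>Q\<close>, and two \<open>swap_parts\<close>, for its
  off-diagonal 2. By the bound on \<open>u\<close> the subtraction does not truncate.\<close>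

definition r where "r = 2 * u - 8192 + 3"
definition zlab where "zlab z b = label u (z div 64 mod 2 ^ a) (z mod 64) b"
definition zact where "zact z = act (z div 64 div 2 ^ a)"
definition rho where "rho c = (if c < 2 * u - 8192 then flip2 else if c = 2 * u - 8192 then flip_all else swap_parts)"

definition V :: "(nat list \<times> nat \<times> nat) set" where "V = words k \<times> {..<M} \<times> {..<N}"

definition paths :: "nat \<Rightarrow> (nat \<times> nat \<times> nat) set" where
  "paths y = {(z,b,y'). (y,z) \<in> B \<and> b < 4 \<and> (y',z) \<in> B}"

definition step :: "nat list \<times> nat \<times> nat \<Rightarrow> nat \<times> nat \<times> nat \<Rightarrow> nat list \<times> nat \<times> nat" where
  "step = (\<lambda>(v,i,y) (z,b,y'). (zact z b v, xor i (zlab z b), y'))"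

text \<open>The label is \<open>Suc c\<close> because label 0 would keep \<open>i\<close>, and a
  word fixed by \<open>rho c\<close> would then be adjacent to itself.\<close>

definition loop :: "nat list \<times> nat \<times> nat \<Rightarrow> nat \<Rightarrow> nat list \<times> nat \<times> nat" where
  "loop = (\<lambda>(v,i,y) c. (map (rho c) v, xor i (Suc c), y))"

definition adj where "adj p q \<longleftrightarrow> q \<in> step p ` paths (snd (snd p)) \<or> q \<in> loop p ` {..<r}"

lemma BN: "B \<subseteq> {..<N} \<times> {..<N}"
  using B by (simp add: bip_expander_def N_def)

lemma degR: "z < N \<Longrightarrow> card {y. (y,z) \<in> B} = 64"
  using B by (simp add: bip_expander_def N_def)

lemma degL: "y < N \<Longrightarrow> card {z. (y,z) \<in> B} = 64"
  using bip_expander_left_degree(2)[OF B] by (simp add: N_def)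

lemma nbr_inj:
  assumes "(y,z) \<in> B" "(y,z') \<in> B" "z mod 64 = z' mod 64"
  shows "z = z'"
proof -
  have "y < N" using assms BN by auto
  then have "inj_on (\<lambda>z. z mod 64) {z. (y,z) \<in> B}"
    using bip_expander_left_degree(1)[OF B] by (simp add: N_def bij_betw_def)
  then show ?thesis using assms by (auto simp: inj_on_def)
qed

text \<open>Moved blocks start at 256 u, beyond all labels 1, ..., r of \<open>loop\<close>. So path
  labels are nonzero and no path edge coincides with an edge that fixes \<open>y\<close>.\<close>

lemma zlab_bounds:
  assumes "b < 4"
  shows "zlab z b < M" "r < zlab z b"
proof -
  have *: "z div 64 mod 2 ^ a < 2 ^ a" "2 * u \<le> 2 ^ a" "z mod 64 < 64" using a by auto
  show "zlab z b < M" unfolding zlab_def M_def using label_less(1)[OF * assms] .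
  have "256 * u \<le> zlab z b" unfolding zlab_def using label_less(2)[OF * assms] .
  then show "r < zlab z b" using u by (simp add: r_def)
qed

lemma rM: "r < M"
  using zlab_bounds[of 0 0] by simp

lemma rho_words:
  assumes "v \<in> words k"
  shows "map (rho c) v \<in> words k" "map (rho c) (map (rho c) v) = v"
proof -
  have v: "q < 4" if "q \<in> set v" for q using that assms by (auto simp: words_def)
  have rho: "rho c q < 4" "rho c (rho c q) = q" if "q < 4" for q
    using involutions[OF that] by (auto simp: rho_def)
  show "map (rho c) v \<in> words k" using assms v rho by (auto simp: words_def)
  show "map (rho c) (map (rho c) v) = v" using v rho by (simp add: map_idI)
qed

lemma V_closed:
  assumes "p \<in> V"
  shows "t \<in> paths (snd (snd p)) \<Longrightarrow> step p t \<in> V" "c < r \<Longrightarrow> loop p c \<in> V"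
  using assms BN rM zlab_bounds(1)
  by (auto simp: V_def step_def loop_def paths_def zact_def act_words rho_words M_def intro!: xor_nat_less)

lemma xor_eq_iff: "xor i l = xor i l' \<longleftrightarrow> l = (l'::nat)"
  by (metis xor_nat_cancel(2))

text \<open>The target shows y' and, by cancelling \<open>i\<close>, the label. The label reveals
  \<open>b\<close> and z mod 64, and the residue condition of the expander then determines
  \<open>z\<close> among the neighbours of \<open>y\<close>.\<close>

lemma step_inj: "inj_on (step p) (paths (snd (snd p)))"
proof (rule inj_onI)
  fix s t assume st: "s \<in> paths (snd (snd p))" "t \<in> paths (snd (snd p))" "step p s = step p t"
  obtain v i y where p: "p = (v,i,y)" by (cases p)
  obtain z b y' where s: "s = (z,b,y')" by (cases s)
  obtain z' b' y'' where t: "t = (z',b',y'')" by (cases t)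
  have l: "zlab z b = zlab z' b'" "y' = y''"
    using st(3) by (auto simp: p s t step_def xor_eq_iff)
  then have "z mod 64 = z' mod 64" "b = b'"
    using label_inj[of u "z div 64 mod 2 ^ a" "z mod 64" b "z' div 64 mod 2 ^ a" "z' mod 64" b'] st(1,2)
    by (auto simp: zlab_def s t paths_def)
  moreover have "z = z'" using nbr_inj[of y z z'] st(1,2) calculation by (auto simp: p s t paths_def)
  ultimately show "s = t" using l s t by simp
qed

lemma loop_inj: "inj_on (loop p) {..<r}"
  by (rule inj_onI) (auto simp: loop_def xor_eq_iff split: prod.splits)

lemma step_loop_disjoint: "step p ` paths (snd (snd p)) \<inter> loop p ` {..<r} = {}"
proof -
  have "step p t \<noteq> loop p c" if "t \<in> paths (snd (snd p))" "c < r" for t c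
  proof
    assume eq: "step p t = loop p c"
    obtain z b y' where t: "t = (z,b,y')" by (cases t)
    have "zlab z b = Suc c" using eq by (auto simp: t step_def loop_def xor_eq_iff split: prod.splits)
    moreover have "b < 4" using that by (simp add: t paths_def)
    ultimately show False using zlab_bounds(2)[of b z] that by simp
  qed
  note neq = this
  show ?thesis
  proof (rule Int_emptyI)
    fix q assume "q \<in> step p ` paths (snd (snd p))" "q \<in> loop p ` {..<r}"
    then obtain t c where "t \<in> paths (snd (snd p))" "q = step p t" "c < r" "q = loop p c"
      by blast
    then show False using neq[of t c] by simp
  qed
qed

lemma adj_sym:
  assumes "p \<in> V" "adj p q"
  shows "adj q p"
proof -
  obtain v i y where p: "p = (v,i,y)" by (cases p)
  have v: "v \<in> words k" using assms by (simp add: p V_def)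
  from assms(2) consider z b y' where "q = step p (z,b,y')" "(y,z) \<in> B" "b < 4" "(y',z) \<in> B"
    | c where "q = loop p c" "c < r"
    by (auto simp: adj_def paths_def p)
  then show ?thesis
  proof cases
    case 1
    then have "p = step q (z,b,y)"
      using act_act[OF v] by (simp add: p step_def zact_def xor_nat_cancel)
    moreover have "(z,b,y) \<in> paths (snd (snd q))" using 1 by (simp add: paths_def step_def p)
    ultimately show ?thesis by (auto simp: adj_def)
  next
    case 2
    then have "p = loop q c"
      using rho_words(2)[OF v] by (simp add: p loop_def xor_nat_cancel)
    then show ?thesis using 2 by (auto simp: adj_def)
  qed
qed

lemma adj_irrefl: "\<not> adj p p"
proof
  assume "adj p p"
  obtain v i y where p: "p = (v,i,y)" by (cases p)
  have nz: "xor i l \<noteq> i" if "l > 0" for l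
    using xor_eq_iff[of i l 0] that by simp
  from \<open>adj p p\<close> consider z b y' where "p = step p (z,b,y')" "b < 4" | c where "p = loop p c"
    by (auto simp: adj_def paths_def)
  then show False
  proof cases
    case 1
    then show False using nz[of "zlab z b"] zlab_bounds(2)[of b z] by (simp add: p step_def)
  next
    case 2
    then show False using nz[of "Suc c"] by (simp add: p loop_def)
  qed
qed

lemma sum_adj:
  fixes f :: "nat list \<times> nat \<times> nat \<Rightarrow> real"
  assumes p: "(v,i,y) \<in> V"
  shows "(\<Sum>q | q \<in> V \<and> adj (v,i,y) q. f q)
    = (\<Sum>z<N. if (y,z) \<in> B then \<Sum>b<4. \<Sum>y'<N. if (y',z) \<in> B then f (zact z b v, xor i (zlab z b), y') else 0 else 0)
      + (\<Sum>c<r. f (map (rho c) v, xor i (Suc c), y))"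
proof -
  let ?p = "(v,i,y)"
  have fin: "finite (paths y)"
    by (rule finite_subset[of _ "{..<N} \<times> {..<4} \<times> {..<N}"]) (use BN in \<open>auto simp: paths_def\<close>)
  have "{q. q \<in> V \<and> adj ?p q} = step ?p ` paths y \<union> loop ?p ` {..<r}"
    using V_closed[OF p] by (auto simp: adj_def)
  then have "(\<Sum>q | q \<in> V \<and> adj ?p q. f q) = sum f (step ?p ` paths y) + sum f (loop ?p ` {..<r})"
    using fin step_loop_disjoint[of ?p] by (simp add: sum.union_disjoint)
  also have "sum f (loop ?p ` {..<r}) = (\<Sum>c<r. f (map (rho c) v, xor i (Suc c), y))"
    by (subst sum.reindex[OF loop_inj]) (simp add: loop_def)
  also have "sum f (step ?p ` paths y) = (\<Sum>t\<in>paths y. f (step ?p t))"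
    using sum.reindex[OF step_inj[of ?p]] by simp
  also have "\<dots> = (\<Sum>t\<in>{..<N} \<times> {..<4} \<times> {..<N}. if t \<in> paths y then f (step ?p t) else 0)"
    by (subst sum.inter_filter[symmetric]) (use BN in \<open>auto intro!: sum.cong simp: paths_def\<close>)
  also have "\<dots> = (\<Sum>(z,b,y')\<in>{..<N} \<times> {..<4} \<times> {..<N}. if (z,b,y') \<in> paths y then f (step ?p (z,b,y')) else 0)"
    by (rule sum.cong) auto
  also have "\<dots> = (\<Sum>z<N. \<Sum>b<4. \<Sum>y'<N. if (z,b,y') \<in> paths y then f (step ?p (z,b,y')) else 0)"
    by (simp add: sum.cartesian_product)
  also have "\<dots> = (\<Sum>z<N. if (y,z) \<in> B then \<Sum>b<4. \<Sum>y'<N. if (y',z) \<in> B then f (zact z b v, xor i (zlab z b), y') else 0 else 0)"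
    by (intro sum.cong refl) (auto simp: paths_def step_def intro!: sum.cong)
  finally show ?thesis .
qed

lemma sum_B_left: "y < N \<Longrightarrow> (\<Sum>z<N. if (y,z) \<in> B then c else 0) = 64 * (c::real)"
proof -
  assume y: "y < N"
  have "{z \<in> {..<N}. (y,z) \<in> B} = {z. (y,z) \<in> B}" using BN by auto
  then have "(\<Sum>z<N. if (y,z) \<in> B then c else 0) = (\<Sum>z | (y,z) \<in> B. c)"
    by (simp flip: sum.inter_filter)
  then show ?thesis using degL[OF y] by simp
qed

lemma sum_B_right: "z < N \<Longrightarrow> (\<Sum>y<N. if (y,z) \<in> B then c else 0) = 64 * (c::real)"
proof -
  assume z: "z < N"
  have "{y \<in> {..<N}. (y,z) \<in> B} = {y. (y,z) \<in> B}" using BN by auto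
  then have "(\<Sum>y<N. if (y,z) \<in> B then c else 0) = (\<Sum>y | (y,z) \<in> B. c)"
    by (simp flip: sum.inter_filter)
  then show ?thesis using degR[OF z] by simp
qed

lemma sum_rho: "(\<Sum>c<r. \<phi> (rho c q)) = (2 * real u - 8192) * \<phi> (flip2 q) + \<phi> (flip_all q) + 2 * (\<phi> (swap_parts q) :: real)"
proof -
  have "(\<Sum>c<r. \<phi> (rho c q)) = (\<Sum>c<2 * u - 8192. \<phi> (rho c q)) + (\<Sum>c<3. \<phi> (rho (2 * u - 8192 + c) q))"
    unfolding r_def by (rule sum_lessThan_add)
  also have "(\<Sum>c<2 * u - 8192. \<phi> (rho c q)) = (\<Sum>c<2 * u - 8192. \<phi> (flip2 q))"
    by (rule sum.cong) (auto simp: rho_def)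
  also have "(\<Sum>c<3. \<phi> (rho (2 * u - 8192 + c) q)) = \<phi> (flip_all q) + 2 * \<phi> (swap_parts q)"
    by (simp add: rho_def numeral_3_eq_3)
  finally show ?thesis using u by (simp add: of_nat_diff)
qed

text \<open>The coefficients are the weights of \<open>Q\<close>: each of the four moves contributes \<open>64\<^sup>2 = 4096\<close>, with \<^const>\<open>flip2\<close>
  occurring twice, and the rest comes from the edges that fix \<open>y\<close>.\<close>
definition letter_op :: "(nat \<Rightarrow> real) \<Rightarrow> nat \<Rightarrow> real" where
  "letter_op \<phi> q = 2 * real u * \<phi> (flip2 q) + \<phi> (flip_all q) + 4098 * \<phi> (swap_parts q) + 4096 * \<phi> (swap_flip q)"

text \<open>At each of the 64 middle vertices the four values of \<open>b\<close> apply every move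
  once to letter \<open>j\<close>, each with 64 end points y'. Hence 64^2 copies of each move, with
  no error term, whatever the spectrum of \<open>B\<close>.\<close>

lemma sum_adj_letter:
  assumes p: "p \<in> V" and j: "j < k"
  shows "(\<Sum>q | q \<in> V \<and> adj p q. \<phi> (fst q ! j)) = letter_op \<phi> (fst p ! j)"
proof -
  obtain v i y where pv: "p = (v,i,y)" by (cases p)
  have v: "length v = k" "y < N" using p by (auto simp: pv V_def words_def)
  have "(\<Sum>b<4. \<Sum>y'<N. if (y',z) \<in> B then \<phi> (zact z b v ! j) else 0) = 64 * (\<Sum>b<4. \<phi> (move b (v ! j)))" if "z < N" for z
  proof -
    have "(\<Sum>b<4. \<Sum>y'<N. if (y',z) \<in> B then \<phi> (zact z b v ! j) else 0) = 64 * (\<Sum>b<4. \<phi> (zact z b v ! j))"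
      using sum_B_right[OF that] by (simp add: sum_distrib_left)
    also have "(\<Sum>b<4. \<phi> (zact z b v ! j)) = (\<Sum>b<4. \<phi> (move ((z div 64 div 2 ^ a div 4 ^ j + b) mod 4) (v ! j)))"
      using v j by (simp add: zact_def act_nth add.commute)
    also have "\<dots> = (\<Sum>b<4. \<phi> (move b (v ! j)))" by (rule sum_shift4)
    finally show ?thesis .
  qed
  then have "(\<Sum>z<N. if (y,z) \<in> B then \<Sum>b<4. \<Sum>y'<N. if (y',z) \<in> B then \<phi> (zact z b v ! j) else 0 else 0)
    = (\<Sum>z<N. if (y,z) \<in> B then 64 * (\<Sum>b<4. \<phi> (move b (v ! j))) else 0)"
    by (intro sum.cong) auto
  also have "\<dots> = 4096 * (\<Sum>b<4. \<phi> (move b (v ! j)))"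
    using sum_B_left[OF v(2)] by simp
  finally have main: "(\<Sum>z<N. if (y,z) \<in> B then \<Sum>b<4. \<Sum>y'<N. if (y',z) \<in> B then \<phi> (zact z b v ! j) else 0 else 0)
    = 4096 * (\<Sum>b<4. \<phi> (move b (v ! j)))" .
  have rho: "(\<Sum>c<r. \<phi> (map (rho c) v ! j)) = (\<Sum>c<r. \<phi> (rho c (v ! j)))"
    using v j by simp
  have "(\<Sum>q | q \<in> V \<and> adj p q. \<phi> (fst q ! j)) = 4096 * (\<Sum>b<4. \<phi> (move b (v ! j))) + (\<Sum>c<r. \<phi> (rho c (v ! j)))"
    using sum_adj[of v i y "\<lambda>q. \<phi> (fst q ! j)"] p unfolding pv fst_conv main rho by simp
  then show ?thesis
    unfolding sum_rho by (simp add: pv letter_op_def sum_less4 move_def algebra_simps)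
qed

lemma degree: "p \<in> V \<Longrightarrow> card {q \<in> V. adj p q} = 2 * u + 8195"
proof -
  assume p: "p \<in> V"
  obtain v i y where pv: "p = (v,i,y)" by (cases p)
  have y: "y < N" using p by (auto simp: pv V_def)
  have "real (card {q \<in> V. adj p q}) = (\<Sum>q | q \<in> V \<and> adj p q. 1)" by simp
  also have "\<dots> = (\<Sum>z<N. if (y,z) \<in> B then \<Sum>b<4::nat. \<Sum>y'<N. if (y',z) \<in> B then 1 else 0 else 0) + real r"
    using sum_adj[of v i y "\<lambda>_. 1"] p by (simp add: pv)
  also have "(\<Sum>z<N. if (y,z) \<in> B then \<Sum>b<4::nat. \<Sum>y'<N. if (y',z) \<in> B then 1 else 0 else 0)
    = (\<Sum>z<N. if (y,z) \<in> B then 256 else (0::real))"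
    by (rule sum.cong) (auto simp: sum_B_right[of _ 1, simplified])
  also have "\<dots> = 16384" using sum_B_left[OF y, of 256] by simp
  also have "16384 + real r = real (2 * u + 8195)" using u by (simp add: r_def of_nat_diff)
  finally show ?thesis by linarith
qed

lemma sum_V: "(\<Sum>p\<in>V. f p) = (\<Sum>v\<in>words k. \<Sum>i<M. \<Sum>y<N. f (v,i,y))"
  unfolding V_def by (simp add: sum.cartesian_product case_prod_unfold)

lemma finite_V: "finite V" by (simp add: V_def)

lemma card_V: "card V = 4 ^ k * M * N"
  by (simp add: V_def card_words)

abbreviation Adj :: "(nat list \<times> nat \<times> nat \<Rightarrow> real) \<Rightarrow> nat list \<times> nat \<times> nat \<Rightarrow> real" where
  "Adj x p \<equiv> \<Sum>q | q \<in> V \<and> adj p q. x q"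

lemma adj_selfadjoint:
  fixes x g :: "nat list \<times> nat \<times> nat \<Rightarrow> real"
  shows "(\<Sum>p\<in>V. Adj x p * g p) = (\<Sum>p\<in>V. x p * Adj g p)"
proof -
  have "(\<Sum>p\<in>V. Adj x p * g p) = (\<Sum>p\<in>V. \<Sum>q\<in>V. if adj p q then x q * g p else 0)"
    using finite_V by (simp add: sum.inter_filter sum_distrib_right if_distrib[of "\<lambda>t. t * _"] cong: if_cong)
  also have "\<dots> = (\<Sum>q\<in>V. \<Sum>p\<in>V. if adj p q then x q * g p else 0)" by (rule sum.swap)
  also have "\<dots> = (\<Sum>q\<in>V. \<Sum>p\<in>V. if adj q p then x q * g p else 0)"
    by (intro sum.cong refl) (use adj_sym in auto)
  also have "\<dots> = (\<Sum>p\<in>V. x p * Adj g p)"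
    using finite_V by (simp add: sum.inter_filter sum_distrib_left if_distrib[of "\<lambda>t. _ * t"] cong: if_cong)
  finally show ?thesis .
qed

lemma ortho_letter:
  assumes x: "\<And>p. p \<in> V \<Longrightarrow> Adj x p = \<mu> * x p"
    and j: "j < k" and \<phi>: "\<And>q. q < 4 \<Longrightarrow> letter_op \<phi> q = \<theta> * \<phi> q" and ne: "\<mu> \<noteq> \<theta>"
  shows "(\<Sum>p\<in>V. x p * \<phi> (fst p ! j)) = 0"
proof -
  have "\<mu> * (\<Sum>p\<in>V. x p * \<phi> (fst p ! j)) = (\<Sum>p\<in>V. Adj x p * \<phi> (fst p ! j))"
    unfolding sum_distrib_left by (rule sum.cong) (use x in auto)
  also have "\<dots> = (\<Sum>p\<in>V. x p * (\<Sum>q | q \<in> V \<and> adj p q. \<phi> (fst q ! j)))"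
    by (rule adj_selfadjoint)
  also have "\<dots> = (\<Sum>p\<in>V. x p * (\<theta> * \<phi> (fst p ! j)))"
  proof (rule sum.cong[OF refl])
    fix p assume p: "p \<in> V"
    then have "fst p ! j < 4" using j by (auto simp: V_def words_def dest!: nth_mem)
    then show "x p * (\<Sum>q | q \<in> V \<and> adj p q. \<phi> (fst q ! j)) = x p * (\<theta> * \<phi> (fst p ! j))"
      using sum_adj_letter[OF p j, of \<phi>] \<phi> by simp
  qed
  also have "\<dots> = \<theta> * (\<Sum>p\<in>V. x p * \<phi> (fst p ! j))" by (simp add: sum_distrib_left mult_ac)
  finally show ?thesis using ne by simp
qed

end

section \<open>The adjacency form away from one-letter functions\<close>

lemma fibre_sq_nonneg: "fibre_sq k m x \<ge> 0"
  unfolding fibre_sq_def by (intro sum_nonneg) simp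

lemma fibre_sq_scale: "fibre_sq k m (\<lambda>v i. c * x v i) = c\<^sup>2 * fibre_sq k m x"
  unfolding fibre_sq_def by (simp add: power_mult_distrib sum_distrib_left)

text \<open>The mixed terms are split by AM-GM as \<open>(28 f) (16/7 e)\<close>.\<close>
lemma fibre_square_split:
  assumes l: "l < 2 ^ m"
  shows "(\<Sum>v\<in>words k. \<Sum>i<2^m. (64 * f v i + e v i) * (64 * f (act w b v) (xor i l) + e (act w b v) (xor i l)))
    \<le> 4096 * (\<Sum>v\<in>words k. \<Sum>i<2^m. f v i * f (act w b v) (xor i l)) + 784 * fibre_sq k m f + 305 / 49 * fibre_sq k m e"
proof -
  define F where "F x y = (\<Sum>v\<in>words k. \<Sum>i<2^m. x v i * y (act w b v) (xor i l))" for x y :: "nat list \<Rightarrow> nat \<Rightarrow> real"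
  have F: "F x y \<le> (fibre_sq k m x + fibre_sq k m y) / 2" for x y
    unfolding F_def using fibre_pair_le[OF l, where k = k and x = x and y = y and w = w and b = b] by simp
  let ?f = "\<lambda>v i. 28 * f v i" and ?e = "\<lambda>v i. 16 / 7 * e v i"
  have "(\<Sum>v\<in>words k. \<Sum>i<2^m. (64 * f v i + e v i) * (64 * f (act w b v) (xor i l) + e (act w b v) (xor i l)))
    = 4096 * F f f + F ?f ?e + F ?e ?f + F e e"
    unfolding F_def sum_distrib_left sum.distrib[symmetric]
    by (intro sum.cong refl) (simp add: algebra_simps)
  moreover have "F ?f ?e \<le> (784 * fibre_sq k m f + 256 / 49 * fibre_sq k m e) / 2"
    using F[of ?f ?e] unfolding fibre_sq_scale by (simp add: power2_eq_square)
  moreover have "F ?e ?f \<le> (256 / 49 * fibre_sq k m e + 784 * fibre_sq k m f) / 2"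
    using F[of ?e ?f] unfolding fibre_sq_scale by (simp add: power2_eq_square)
  moreover have "F e e \<le> fibre_sq k m e" using F[of e e] by simp
  ultimately show ?thesis unfolding F_def[symmetric] by simp
qed

lemma sum_swap_pairs:
  fixes f :: "'v \<Rightarrow> nat \<Rightarrow> nat \<Rightarrow> nat \<Rightarrow> real"
  shows "(\<Sum>v\<in>V. \<Sum>i<m. \<Sum>z<n. \<Sum>b<l. f v i z b) = (\<Sum>z<n. \<Sum>b<l. \<Sum>v\<in>V. \<Sum>i<m. f v i z b)"
proof -
  have "(\<Sum>v\<in>V. \<Sum>i<m. \<Sum>z<n. \<Sum>b<l. f v i z b) = (\<Sum>v\<in>V. \<Sum>z<n. \<Sum>i<m. \<Sum>b<l. f v i z b)"
    by (rule sum.cong[OF refl], rule sum.swap)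
  also have "\<dots> = (\<Sum>z<n. \<Sum>v\<in>V. \<Sum>i<m. \<Sum>b<l. f v i z b)" by (rule sum.swap)
  also have "\<dots> = (\<Sum>z<n. \<Sum>v\<in>V. \<Sum>b<l. \<Sum>i<m. f v i z b)"
    by (rule sum.cong[OF refl], rule sum.cong[OF refl], rule sum.swap)
  also have "\<dots> = (\<Sum>z<n. \<Sum>b<l. \<Sum>v\<in>V. \<Sum>i<m. f v i z b)"
    by (rule sum.cong[OF refl], rule sum.swap)
  finally show ?thesis .
qed

context sparse_product
begin

text \<open>Split \<open>x\<close> into its average \<open>m\<close> over \<open>y\<close> and a
  remainder. The average is charged 4096 * 9/8 from the tensor power and 4 * 784 from the cross
  terms, 7744 in all. The remainder is charged 4 * 305/49 times the expander bound 4 * 63 = 252,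
  less than 6275. The two squared norms add up to that of \<open>x\<close>.\<close>

lemma main_form_le:
  fixes x :: "nat list \<Rightarrow> nat \<Rightarrow> nat \<Rightarrow> real"
  assumes zero: "(\<Sum>v\<in>words k. \<Sum>i<M. \<Sum>y<N. x v i y) = 0"
    "\<And>j q. j < k \<Longrightarrow> q < 4 \<Longrightarrow> (\<Sum>v\<in>words k. \<Sum>i<M. \<Sum>y<N. if v ! j = q then x v i y else 0) = 0"
  defines "X \<equiv> \<lambda>v i z. \<Sum>y<N. if (y,z) \<in> B then x v i y else 0"
  shows "(\<Sum>z<N. \<Sum>b<4. \<Sum>v\<in>words k. \<Sum>i<M. X v i z * X (zact z b v) (xor i (zlab z b)) z)
    \<le> 7744 * (\<Sum>v\<in>words k. \<Sum>i<M. \<Sum>y<N. (x v i y)\<^sup>2)"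
proof -
  have Npos: "N > 0" by (simp add: N_def)
  define m where "m v i = (\<Sum>y<N. x v i y) / real N" for v i
  define e where "e z v i = X v i z - 64 * m v i" for z v i
  let ?X = "(\<Sum>z<N. \<Sum>b<4. \<Sum>v\<in>words k. \<Sum>i<M. X v i z * X (zact z b v) (xor i (zlab z b)) z)"
  let ?P = "\<lambda>z b. (\<Sum>v\<in>words k. \<Sum>i<M. m v i * m (zact z b v) (xor i (zlab z b)))"
  define Q where "Q = fibre_sq k (a + 8) m"
  define S where "S = (\<Sum>v\<in>words k. \<Sum>i<M. \<Sum>y<N. (x v i y)\<^sup>2)"
  define R where "R = (\<Sum>z<N. fibre_sq k (a + 8) (e z))"
  have "X v i z = 64 * m v i + e z v i" for v i z by (simp add: e_def)
  then have "(\<Sum>v\<in>words k. \<Sum>i<M. X v i z * X (zact z b v) (xor i (zlab z b)) z)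
    \<le> 4096 * ?P z b + 784 * Q + 305 / 49 * fibre_sq k (a + 8) (e z)"
    if "b < 4" for z b
    using fibre_square_split[OF zlab_bounds(1)[OF that, unfolded M_def],
        where f = m and e = "e z" and w = "z div 64 div 2 ^ a" and b = b and k = k]
    unfolding Q_def M_def zact_def by simp
  then have "?X
    \<le> (\<Sum>z<N. \<Sum>b<4::nat. 4096 * ?P z b + 784 * Q + 305 / 49 * fibre_sq k (a + 8) (e z))"
    by (intro sum_mono) auto
  also have "\<dots> = 4096 * (\<Sum>z<N. \<Sum>b<4. \<Sum>v\<in>words k. \<Sum>i<M. m v i * m (zact z b v) (xor i (zlab z b)))
     + 3136 * real N * Q + 1220 / 49 * R"
    unfolding R_def by (simp add: sum.distrib sum_distrib_left)
  also have "(\<Sum>z<N. \<Sum>b<4. \<Sum>v\<in>words k. \<Sum>i<M. m v i * m (zact z b v) (xor i (zlab z b))) = fibre_form k a u m"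
  proof -
    have "(\<Sum>z<N. \<Sum>b<4. \<Sum>v\<in>words k. \<Sum>i<M. m v i * m (zact z b v) (xor i (zlab z b)))
      = (\<Sum>w<4^k. \<Sum>\<beta><2^a. \<Sum>c<64. (\<lambda>z. \<Sum>b<4. \<Sum>v\<in>words k. \<Sum>i<M. m v i * m (zact z b v) (xor i (zlab z b))) ((w * 2 ^ a + \<beta>) * 64 + c))"
      unfolding N_def sum_lessThan_times ..
    also have "\<dots> = fibre_form k a u m"
      unfolding fibre_form_def M_def
    proof (intro sum.cong refl)
      fix w \<beta> c b :: nat and v i
      assume *: "\<beta> \<in> {..<2^a}" "c \<in> {..<64}"
      define q where "q = w * 2 ^ a + \<beta>"
      define z where "z = q * 64 + c"
      have "z div 64 = q" "z mod 64 = c" using * by (auto simp: z_def)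
      moreover have "q div 2 ^ a = w" "q mod 2 ^ a = \<beta>" using * by (auto simp: q_def)
      ultimately
      have "z div 64 div 2 ^ a = w" "z div 64 mod 2 ^ a = \<beta>" "z mod 64 = c" by auto
      then show "m v i * m (zact ((w * 2 ^ a + \<beta>) * 64 + c) b v) (xor i (zlab ((w * 2 ^ a + \<beta>) * 64 + c) b))
        = m v i * m (act w b v) (xor i (label u \<beta> c b))"
        unfolding q_def[symmetric] z_def[symmetric] zact_def zlab_def by simp
    qed
    finally show ?thesis .
  qed
  also have "fibre_form k a u m \<le> 4 ^ k * 2 ^ (a + 8) * (9 / 32) * Q"
    unfolding Q_def
  proof (rule fibre_form_le[OF _ _ a])
    show "(\<Sum>v\<in>words k. \<Sum>i<2^(a+8). m v i) = 0"
      using zero(1) unfolding m_def M_def by (simp flip: sum_divide_distrib)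
    fix j q :: nat assume "j < k" "q < 4"
    have "(\<Sum>v\<in>words k. \<Sum>i<2^(a+8). if v ! j = q then m v i else 0)
      = (\<Sum>v\<in>words k. \<Sum>i<M. (\<Sum>y<N. if v ! j = q then x v i y else 0) / real N)"
      unfolding M_def m_def by (intro sum.cong refl) auto
    also have "\<dots> = 0" using zero(2)[OF \<open>j < k\<close> \<open>q < 4\<close>] by (simp flip: sum_divide_distrib)
    finally show "(\<Sum>v\<in>words k. \<Sum>i<2^(a+8). if v ! j = q then m v i else 0) = 0" .
  qed
  also have "4 ^ k * 2 ^ (a + 8) * (9 / 32) * Q = 9 / 8 * real N * Q"
    unfolding N_def by (simp add: power_add)
  finally have main: "?X
    \<le> 7744 * (real N * Q) + 1220 / 49 * R" by (simp add: mult_ac)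
  have "R \<le> 252 * (S - real N * Q)"
  proof -
    have local: "(\<Sum>z<N. (e z v i)\<^sup>2) \<le> 252 * ((\<Sum>y<N. (x v i y)\<^sup>2) - real N * (m v i)\<^sup>2)" for v i
    proof -
      define g where "g y = x v i y - m v i" for y
      have sx: "(\<Sum>y<N. x v i y) = real N * m v i" using Npos by (simp add: m_def)
      have "(\<Sum>y<N. g y) = 0" using sx by (simp add: g_def sum_subtractf)
      then have "(\<Sum>z<N. (\<Sum>y<N. if (y,z) \<in> B then g y else 0)\<^sup>2) \<le> 4 * real (64 - 1) * (\<Sum>y<N. (g y)\<^sup>2)"
        using B unfolding bip_expander_def N_def[symmetric] by blast
      moreover have "(\<Sum>y<N. if (y,z) \<in> B then g y else 0) = e z v i" if "z < N" for z
      proof -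
        have "(\<Sum>y<N. if (y,z) \<in> B then g y else 0) = (\<Sum>y<N. (if (y,z) \<in> B then x v i y else 0) - (if (y,z) \<in> B then m v i else 0))"
          by (rule sum.cong) (auto simp: g_def)
        then show ?thesis using sum_B_right[OF that, of "m v i"] by (simp add: sum_subtractf e_def X_def)
      qed
      moreover have "(\<Sum>y<N. (g y)\<^sup>2) = (\<Sum>y<N. (x v i y)\<^sup>2) - real N * (m v i)\<^sup>2"
      proof -
        have "(\<Sum>y<N. (g y)\<^sup>2) = (\<Sum>y<N. (x v i y)\<^sup>2 - 2 * m v i * x v i y + (m v i)\<^sup>2)"
          by (rule sum.cong) (auto simp: g_def power2_eq_square algebra_simps)
        also have "\<dots> = (\<Sum>y<N. (x v i y)\<^sup>2) - 2 * m v i * (\<Sum>y<N. x v i y) + real N * (m v i)\<^sup>2"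
          by (simp add: sum.distrib sum_subtractf sum_distrib_left)
        finally show ?thesis unfolding sx by (simp add: power2_eq_square)
      qed
      ultimately show ?thesis by simp
    qed
    have "R = (\<Sum>v\<in>words k. \<Sum>i<M. \<Sum>z<N. (e z v i)\<^sup>2)"
    proof -
      have "R = (\<Sum>v\<in>words k. \<Sum>z<N. \<Sum>i<M. (e z v i)\<^sup>2)"
        unfolding R_def fibre_sq_def M_def by (rule sum.swap)
      also have "\<dots> = (\<Sum>v\<in>words k. \<Sum>i<M. \<Sum>z<N. (e z v i)\<^sup>2)"
        by (rule sum.cong[OF refl], rule sum.swap)
      finally show ?thesis .
    qed
    also have "\<dots> \<le> (\<Sum>v\<in>words k. \<Sum>i<M. 252 * ((\<Sum>y<N. (x v i y)\<^sup>2) - real N * (m v i)\<^sup>2))"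
      by (intro sum_mono local)
    also have "\<dots> = 252 * (S - real N * Q)"
      unfolding S_def Q_def fibre_sq_def M_def by (simp add: sum_subtractf sum_distrib_left right_diff_distrib)
    finally show ?thesis .
  qed
  \<comment> \<open>Makes S - N Q nonnegative, so that its coefficient may be raised to
    7744.\<close>
  moreover have "0 \<le> R" unfolding R_def by (intro sum_nonneg fibre_sq_nonneg)
  ultimately have "1220 / 49 * R \<le> 7744 * (S - real N * Q)" by linarith
  with main show ?thesis unfolding S_def[symmetric] by (simp add: algebra_simps)
qed

text \<open>A path y, z, y' factors through \<open>z\<close>, so the path part is a form in the
  neighbour sums \<open>X\<close> at each middle vertex. Each of the \<open>r\<close> edges fixing
  \<open>y\<close> is an involution on \<open>V\<close> and adds at most the squared norm.\<close>

lemma quadratic_form_adj_le: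
  fixes x :: "nat list \<times> nat \<times> nat \<Rightarrow> real"
  assumes zero: "(\<Sum>p\<in>V. x p) = 0" "\<And>j q. j < k \<Longrightarrow> q < 4 \<Longrightarrow> (\<Sum>p\<in>V. if fst p ! j = q then x p else 0) = 0"
  shows "(\<Sum>p\<in>V. x p * Adj x p) \<le> (7744 + real r) * (\<Sum>p\<in>V. (x p)\<^sup>2)"
proof -
  define g where "g v i y = x (v,i,y)" for v i y
  define X where "X v i z = (\<Sum>y<N. if (y,z) \<in> B then g v i y else 0)" for v i z
  let ?L = "(\<Sum>v\<in>words k. \<Sum>i<M. \<Sum>y<N. g v i y * (\<Sum>z<N. if (y,z) \<in> B then \<Sum>b<4. X (zact z b v) (xor i (zlab z b)) z else 0))"
  let ?R = "(\<Sum>v\<in>words k. \<Sum>i<M. \<Sum>y<N. g v i y * (\<Sum>c<r. g (map (rho c) v) (xor i (Suc c)) y))"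
  have "(\<Sum>p\<in>V. x p * Adj x p)
    = (\<Sum>v\<in>words k. \<Sum>i<M. \<Sum>y<N. x (v,i,y) * Adj x (v,i,y))"
    by (rule sum_V)
  also have "\<dots> = (\<Sum>v\<in>words k. \<Sum>i<M. \<Sum>y<N. g v i y *
       ((\<Sum>z<N. if (y,z) \<in> B then \<Sum>b<4. X (zact z b v) (xor i (zlab z b)) z else 0)
         + (\<Sum>c<r. g (map (rho c) v) (xor i (Suc c)) y)))"
    by (intro sum.cong refl) (subst sum_adj, simp add: V_def, simp only: g_def X_def)
  also have "\<dots> = ?L
     + ?R"
    by (simp add: distrib_left sum.distrib)
  finally have split: "(\<Sum>p\<in>V. x p * Adj x p) = \<dots>" .
  have "?L
    = (\<Sum>z<N. \<Sum>b<4. \<Sum>v\<in>words k. \<Sum>i<M. X v i z * X (zact z b v) (xor i (zlab z b)) z)"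
  proof -
    have "(\<Sum>y<N. g v i y * (\<Sum>z<N. if (y,z) \<in> B then h z else 0)) = (\<Sum>z<N. X v i z * h z)" for v i and h :: "nat \<Rightarrow> real"
    proof -
      have "(\<Sum>y<N. g v i y * (\<Sum>z<N. if (y,z) \<in> B then h z else 0)) = (\<Sum>y<N. \<Sum>z<N. (if (y,z) \<in> B then g v i y else 0) * h z)"
        unfolding sum_distrib_left by (intro sum.cong refl) auto
      also have "\<dots> = (\<Sum>z<N. \<Sum>y<N. (if (y,z) \<in> B then g v i y else 0) * h z)" by (rule sum.swap)
      finally show ?thesis unfolding X_def sum_distrib_right .
    qed
    then have "?L
      = (\<Sum>v\<in>words k. \<Sum>i<M. \<Sum>z<N. \<Sum>b<4. X v i z * X (zact z b v) (xor i (zlab z b)) z)"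
      by (simp add: sum_distrib_left)
    also have "\<dots> = (\<Sum>z<N. \<Sum>b<4. \<Sum>v\<in>words k. \<Sum>i<M. X v i z * X (zact z b v) (xor i (zlab z b)) z)"
      by (rule sum_swap_pairs)
    finally show ?thesis .
  qed
  also have "\<dots> \<le> 7744 * (\<Sum>v\<in>words k. \<Sum>i<M. \<Sum>y<N. (g v i y)\<^sup>2)"
    unfolding X_def[abs_def]
  proof (rule main_form_le)
    show "(\<Sum>v\<in>words k. \<Sum>i<M. \<Sum>y<N. g v i y) = 0" using zero(1) unfolding sum_V g_def .
    show "(\<Sum>v\<in>words k. \<Sum>i<M. \<Sum>y<N. if v ! j = q then g v i y else 0) = 0" if "j < k" "q < 4" for j q
      using zero(2)[OF that] unfolding sum_V g_def by simp
  qed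
  also have "(\<Sum>v\<in>words k. \<Sum>i<M. \<Sum>y<N. (g v i y)\<^sup>2) = (\<Sum>p\<in>V. (x p)\<^sup>2)"
    unfolding sum_V g_def ..
  finally have main: "?L
    \<le> 7744 * (\<Sum>p\<in>V. (x p)\<^sup>2)" .
  have "?R \<le> real r * (\<Sum>p\<in>V. (x p)\<^sup>2)"
  proof -
    have "?R
      = (\<Sum>p\<in>V. \<Sum>c<r. x p * x (loop p c))"
      unfolding sum_V g_def by (simp add: loop_def sum_distrib_left)
    also have "\<dots> = (\<Sum>c<r. \<Sum>p\<in>V. x p * x (loop p c))" by (rule sum.swap)
    also have "\<dots> \<le> (\<Sum>c<r. \<Sum>p\<in>V. (x p)\<^sup>2)"
    proof (rule sum_mono)
      fix c assume "c \<in> {..<r}"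
      then have c: "c < r" by simp
      have inv: "loop (loop p c) c = p" if "p \<in> V" for p
        using that rho_words(2) by (auto simp: V_def loop_def xor_nat_cancel)
      have "(\<Sum>p\<in>V. (x (loop p c))\<^sup>2) = (\<Sum>p\<in>V. (x p)\<^sup>2)"
        by (rule sum.reindex_bij_witness[of _ "\<lambda>p. loop p c" "\<lambda>p. loop p c"])
          (use inv V_closed(2)[OF _ c] in auto)
      then show "(\<Sum>p\<in>V. x p * x (loop p c)) \<le> (\<Sum>p\<in>V. (x p)\<^sup>2)"
        using sum_mult_le[of x "\<lambda>p. x (loop p c)" V] by simp
    qed
    finally show ?thesis by simp
  qed
  from add_mono[OF main this] show ?thesis unfolding split distrib_right .
qed

section \<open>The one-letter spectrum and the gap above \<tau>\<close>

definition \<tau> where "\<tau> = 2 * sqrt ((real u)\<^sup>2 + 1) - 1"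

lemma \<tau>: "(\<tau> + 1)\<^sup>2 = 4 * (real u)\<^sup>2 + 4" "\<tau> > 2 * real u - 1" "\<tau> < 2 * real u + 1"
proof -
  define s where "s = sqrt ((real u)\<^sup>2 + 1)"
  have s2: "s\<^sup>2 = (real u)\<^sup>2 + 1" by (simp add: s_def)
  show "(\<tau> + 1)\<^sup>2 = 4 * (real u)\<^sup>2 + 4" using s2 by (simp add: \<tau>_def s_def[symmetric] power_mult_distrib)
  have "real u < s" unfolding s_def by (rule real_less_rsqrt) simp
  then show "\<tau> > 2 * real u - 1" by (simp add: \<tau>_def s_def[symmetric])
  have "s < real u + 1"
    unfolding s_def by (rule real_less_lsqrt) (use u in \<open>auto simp: power2_eq_square algebra_simps\<close>)
  then show "\<tau> < 2 * real u + 1" by (simp add: \<tau>_def s_def[symmetric])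
qed

text \<open>(1, \<sigma>) is the eigenvector of [[2u-1, 2], [2, -2u-1]] for its top eigenvalue
  \<tau>.\<close>

definition \<sigma> where "\<sigma> = sqrt ((real u)\<^sup>2 + 1) - real u"

lemma \<sigma>: "\<sigma>\<^sup>2 + 2 * real u * \<sigma> = 1" "2 * \<sigma> = \<tau> + 1 - 2 * real u"
  by (auto simp: \<sigma>_def \<tau>_def power2_eq_square algebra_simps)

definition eigenletter :: "nat \<Rightarrow> real" where "eigenletter q = [1, -1, \<sigma>, -\<sigma>] ! q"
definition coletter :: "nat \<Rightarrow> real" where "coletter q = [-\<sigma>, \<sigma>, 1, -1] ! q"
definition partletter :: "nat \<Rightarrow> real" where "partletter q = [1, 1, -1, -1] ! q"

text \<open>With the constant function these three form an orthogonal basis of the functions on four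
  states. The eigenvalue -2 - \<tau> comes from the trace -2 of the sign-odd block; 2u - 8193 is the
  weight inside the parts, 2u + 1, minus the weight 8194 between them.\<close>

lemma letter_eigen:
  assumes "q < 4"
  shows "letter_op eigenletter q = \<tau> * eigenletter q" "letter_op coletter q = (- 2 - \<tau>) * coletter q"
    "letter_op partletter q = (2 * real u - 8193) * partletter q"
proof -
  have t: "\<tau> = 2 * \<sigma> + 2 * real u - 1" using \<sigma>(2) by simp
  have s: "\<sigma> * (\<sigma> * 2) + real u * (\<sigma> * 4) = 2" using \<sigma>(1) by (simp add: power2_eq_square algebra_simps)
  show "letter_op eigenletter q = \<tau> * eigenletter q" "letter_op coletter q = (- 2 - \<tau>) * coletter q"
    "letter_op partletter q = (2 * real u - 8193) * partletter q"
    using assms unfolding less4_cases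
    by (auto simp: letter_op_def move_defs eigenletter_def coletter_def partletter_def t s algebra_simps)
qed

text \<open>If \<mu> > \<tau>, then \<mu> differs from all three eigenvalues in
  \<open>letter_eigen\<close>, and constants are excluded by the zero sum. So all one-letter
  marginals \<open>A\<close> vanish, and the form bound gives \<mu> \<le> 7744 + r = 2u - 445, which
  is below \<tau>.\<close>

lemma eigenvalue_le:
  assumes x: "\<And>p. p \<in> V \<Longrightarrow> Adj x p = \<mu> * x p"
    and x0: "(\<Sum>p\<in>V. x p) = 0" and nz: "\<exists>p\<in>V. x p \<noteq> 0"
  shows "\<mu> \<le> \<tau>"
proof (rule ccontr)
  assume "\<not> \<mu> \<le> \<tau>"
  then have \<mu>: "\<mu> > \<tau>" by simp
  define A where "A j q = (\<Sum>p\<in>V. if fst p ! j = q then x p else 0)" for j q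
  have expand: "(\<Sum>p\<in>V. x p * \<phi> (fst p ! j)) = (\<Sum>q<4. \<phi> q * A j q)" if "j < k" for j and \<phi> :: "nat \<Rightarrow> real"
  proof -
    have "(\<Sum>q<4. \<phi> q * A j q) = (\<Sum>q<4. \<Sum>p\<in>V. if fst p ! j = q then x p * \<phi> q else 0)"
      unfolding A_def sum_distrib_left by (intro sum.cong refl) auto
    also have "\<dots> = (\<Sum>p\<in>V. \<Sum>q<4. if fst p ! j = q then x p * \<phi> q else 0)" by (rule sum.swap)
    also have "\<dots> = (\<Sum>p\<in>V. x p * \<phi> (fst p ! j))"
    proof (rule sum.cong[OF refl])
      fix p assume "p \<in> V"
      then have "fst p ! j < 4" using that by (auto simp: V_def words_def dest!: nth_mem)
      then show "(\<Sum>q<4. if fst p ! j = q then x p * \<phi> q else 0) = x p * \<phi> (fst p ! j)" by simp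
    qed
    finally show ?thesis ..
  qed
  have A0: "A j q = 0" if j: "j < k" and q: "q < 4" for j q
  proof -
    have "A j 0 + A j 1 + A j 2 + A j 3 = 0"
      using expand[OF j, of "\<lambda>_. 1"] x0 by (simp add: sum_less4)
    moreover have "A j 0 + A j 1 - A j 2 - A j 3 = 0"
      using expand[OF j, of partletter] ortho_letter[OF x j letter_eigen(3)] \<mu> \<tau>(2)
      by (simp add: sum_less4 partletter_def)
    moreover have 1: "(A j 0 - A j 1) + \<sigma> * (A j 2 - A j 3) = 0"
      using expand[OF j, of eigenletter] ortho_letter[OF x j letter_eigen(1)] \<mu>
      by (simp add: sum_less4 eigenletter_def algebra_simps)
    moreover have 2: "(A j 2 - A j 3) - \<sigma> * (A j 0 - A j 1) = 0"
      using expand[OF j, of coletter] ortho_letter[OF x j letter_eigen(2)] \<mu> \<tau>(2) u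
      by (simp add: sum_less4 coletter_def algebra_simps)
    \<comment> \<open>The two sign-odd equations form a linear system with determinant 1 +
      \<sigma>^2.\<close>
    moreover have "A j 0 - A j 1 = 0"
    proof -
      have "(A j 0 - A j 1) * (1 + \<sigma> * \<sigma>) = ((A j 0 - A j 1) + \<sigma> * (A j 2 - A j 3)) - \<sigma> * ((A j 2 - A j 3) - \<sigma> * (A j 0 - A j 1))"
        by (simp add: algebra_simps)
      then have "(A j 0 - A j 1) * (1 + \<sigma> * \<sigma>) = 0" unfolding 1 2 by simp
      moreover have "1 + \<sigma> * \<sigma> > 0" by (simp add: add_pos_nonneg)
      ultimately show ?thesis by simp
    qed
    ultimately show ?thesis using q unfolding less4_cases by auto
  qed
  define Q where "Q = (\<Sum>p\<in>V. (x p)\<^sup>2)"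
  have "Q > 0" unfolding Q_def using nz finite_V by (auto intro: sum_pos2)
  have "\<mu> * Q = (\<Sum>p\<in>V. x p * Adj x p)"
    unfolding Q_def sum_distrib_left[of \<mu>] by (rule sum.cong[OF refl]) (simp add: x power2_eq_square)
  also have "\<dots> \<le> (7744 + real r) * Q"
    unfolding Q_def by (rule quadratic_form_adj_le[OF x0]) (use A0 in \<open>simp add: A_def\<close>)
  finally have "\<mu> \<le> 7744 + real r" using \<open>Q > 0\<close> by simp
  moreover have "real r = 2 * real u - 8189" using u by (simp add: r_def of_nat_diff)
  ultimately show False using \<mu> \<tau>(2) by linarith
qed

lemma eigenletter_sum: "(\<Sum>q<4. eigenletter q) = 0"
  by (simp add: sum_less4 eigenletter_def)

end

section \<open>Orthogonal coordinate eigenvectors and the final sequence of graphs\<close>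

lemma sum_words_letter:
  fixes \<phi> :: "nat \<Rightarrow> real"
  assumes "(\<Sum>q<4. \<phi> q) = 0"
  shows "j < k \<Longrightarrow> (\<Sum>v\<in>words k. \<phi> (v ! j)) = 0"
proof (induction k arbitrary: j)
  case (Suc k)
  show ?case
  proof (cases j)
    case 0
    then show ?thesis using assms by (simp add: sum_words_Suc)
  next
    case (Suc j')
    then have "(\<Sum>v\<in>words k. \<phi> (v ! j')) = 0" using Suc.IH Suc.prems by simp
    then show ?thesis using Suc by (simp add: sum_words_Suc flip: sum_distrib_left)
  qed
qed simp

lemma sum_words_two_letters:
  fixes \<phi> :: "nat \<Rightarrow> real"
  assumes "(\<Sum>q<4. \<phi> q) = 0"
  shows "j < k \<Longrightarrow> l < k \<Longrightarrow> j \<noteq> l \<Longrightarrow> (\<Sum>v\<in>words k. \<phi> (v ! j) * \<phi> (v ! l)) = 0"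
proof (induction k arbitrary: j l)
  case (Suc k)
  have z: "(\<Sum>v\<in>words k. \<phi> (v ! j') * c) = 0" if "j' < k" for j' c
    using sum_words_letter[OF assms that] by (simp flip: sum_distrib_right)
  show ?case
  proof (cases j; cases l)
    fix j' assume "j = Suc j'" "l = 0"
    then show ?thesis using Suc.prems assms by (simp add: sum_words_Suc flip: sum_distrib_left)
  next
    fix l' assume "j = 0" "l = Suc l'"
    then show ?thesis using Suc.prems assms by (simp add: sum_words_Suc flip: sum_distrib_right)
  next
    fix j' l' assume "j = Suc j'" "l = Suc l'"
    then show ?thesis using Suc by (simp add: sum_words_Suc flip: sum_distrib_left)
  qed (use Suc.prems in auto)
qed simp

text \<open>Each further letter adds one eigenvector and leaves the degree alone. It multiplies the
  vertex count by 16: a factor 4 for the letter, and a factor 4 for the digit of the middle vertex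
  that selects its moves.\<close>

theorem sparse_product_graph:
  assumes u: "u \<ge> 10 ^ 5" and a: "64 * u \<le> 2 ^ a" and k: "k \<ge> 1"
  shows "\<exists>G :: nat pair_pre_digraph. pair_graph G \<and> card (pverts G) = 2 ^ (2 * a + 14) * 16 ^ k \<and>
    regular (2 * u + 8195) G \<and>
    second_eigenvalue (adjacency_matrix G) = 2 * sqrt ((real u)\<^sup>2 + 1) - 1 \<and>
    eigenvalue_multiplicity (adjacency_matrix G) (2 * sqrt ((real u)\<^sup>2 + 1) - 1) \<ge> k"
proof -
  have "64 * 2 ^ (2 * k + a) = 4 ^ k * 2 ^ a * (64::nat)"
    by (simp add: power_add power_mult)
  moreover have "\<exists>B. bip_expander 64 (64 * 2 ^ (2 * k + a)) B" by (rule bip_expander_exists) simp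
  ultimately obtain B where "bip_expander 64 (4 ^ k * 2 ^ a * 64) B" by metis
  then interpret sparse_product k u a B
    using u a by unfold_locales
  have card: "card V = 2 ^ (2 * a + 14) * 16 ^ k"
  proof -
    have "(16::nat) ^ k = 4 ^ k * 4 ^ k" using power_mult_distrib[of "4::nat" 4 k] by simp
    moreover have "(2::nat) ^ (2 * a + 14) = 2 ^ a * 2 ^ a * 16384"
      unfolding power_add mult_2 by simp
    moreover have "(2::nat) ^ (a + 8) = 2 ^ a * 256" unfolding power_add by simp
    moreover have "x * (y * 256) * (x * y * 64) = y * y * 16384 * (x * x)" for x y :: nat
      by (simp add: mult_ac)
    ultimately show ?thesis unfolding card_V M_def N_def by (simp only:)
  qed
  have ne: "V \<noteq> {}" using card finite_V by auto
  have fV: "(\<Sum>p\<in>V. h (fst p)) = real (M * N) * (\<Sum>v\<in>words k. h v)" for h :: "nat list \<Rightarrow> real"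
    unfolding sum_V by (simp add: sum_distrib_left mult.assoc)
  have MN: "M * N > 0" by (simp add: M_def N_def)
  have "\<exists>G :: nat pair_pre_digraph. pair_graph G \<and> card (pverts G) = card V \<and> regular (2 * u + 8195) G \<and>
    second_eigenvalue (adjacency_matrix G) = \<tau> \<and> eigenvalue_multiplicity (adjacency_matrix G) \<tau> \<ge> k"
  proof (rule graph_on_nat[where adj = adj and f = "\<lambda>j p. eigenletter (fst p ! j)"])
    show "finite V" "V \<noteq> {}" by (rule finite_V, rule ne)
    show "adj q p" if "p \<in> V" "adj p q" for p q using adj_sym that .
    show "\<not> adj p p" for p by (rule adj_irrefl)
    show "card {q \<in> V. adj p q} = 2 * u + 8195" if "p \<in> V" for p by (rule degree[OF that])
    show "\<mu> \<le> \<tau>" if "\<And>p. p \<in> V \<Longrightarrow> (\<Sum>q | q \<in> V \<and> adj p q. x q) = \<mu> * x p" "(\<Sum>p\<in>V. x p) = 0" "\<exists>p\<in>V. x p \<noteq> 0" for x \<mu>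
      by (rule eigenvalue_le[OF that])
    show "\<tau> < real (2 * u + 8195)" using \<tau>(3) by simp
    show "1 \<le> k" by fact
    show "(\<Sum>q | q \<in> V \<and> adj p q. eigenletter (fst q ! j)) = \<tau> * eigenletter (fst p ! j)" if "j < k" "p \<in> V" for j p
    proof -
      have "fst p ! j < 4" using that by (auto simp: V_def words_def dest!: nth_mem)
      then show ?thesis using sum_adj_letter[OF that(2,1)] letter_eigen(1) by simp
    qed
    show "(\<Sum>p\<in>V. eigenletter (fst p ! j) * eigenletter (fst p ! l)) = 0" if "j < k" "l < k" "j \<noteq> l" for j l
      using fV[of "\<lambda>v. eigenletter (v ! j) * eigenletter (v ! l)"] sum_words_two_letters[OF eigenletter_sum that] by simp
    show "(\<Sum>p\<in>V. (eigenletter (fst p ! j))\<^sup>2) > 0" if "j < k" for j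
    proof -
      have "replicate k 0 \<in> words k" by (auto simp: words_def)
      moreover have "(eigenletter (replicate k 0 ! j))\<^sup>2 = 1" using that by (simp add: eigenletter_def)
      ultimately have "(\<Sum>v\<in>words k. (eigenletter (v ! j))\<^sup>2) > 0"
        by (intro sum_pos2[of _ "replicate k 0"]) auto
      then show ?thesis using fV[of "\<lambda>v. (eigenletter (v ! j))\<^sup>2"] MN by simp
    qed
  qed
  then show ?thesis unfolding \<tau>_def card by blast
qed

theorem theorem5p8:
  fixes u :: nat
  assumes "u \<ge> 10 ^ 5"
  shows "\<exists>(d::nat) (n :: nat \<Rightarrow> nat).
    real d \<le> 5 * real u / 2 \<and>
    strict_mono n \<and>
    (\<forall>i. 0 < n i) \<and>
    (\<forall>i. n (i + 1) \<le> 4 * n i ^ 9) \<and>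
    (\<forall>i\<ge>1. \<exists>G :: nat pair_pre_digraph.
       pair_graph G \<and> card (pverts G) = n i \<and> regular d G \<and>
       second_eigenvalue (adjacency_matrix G) = 2 * sqrt ((real u)\<^sup>2 + 1) - 1 \<and>
       eigenvalue_multiplicity (adjacency_matrix G) (2 * sqrt ((real u)\<^sup>2 + 1) - 1) \<ge> i) \<and>
    (\<lambda>i. real i) \<in> \<Omega>(\<lambda>i. ln (ln (real (n i))))"
proof -
  \<comment> \<open>A crude choice; it depends on \<open>u\<close> only, so the constant
    \<open>C\<close> is the same for all \<open>i\<close>.\<close>
  define a where "a = 64 * u"
  have a: "64 * u \<le> 2 ^ a" unfolding a_def by (rule less_imp_le) (rule less_exp)
  define C where "C = (2::nat) ^ (2 * a + 14)"
  have "(2::nat) ^ 2 \<le> C" unfolding C_def by (rule power_increasing) auto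
  then have C: "C \<ge> 4" by simp
  define n where "n i = C * 16 ^ i" for i
  have n4: "n i \<ge> 4" for i
    using mult_le_mono[OF C, of 1 "16 ^ i"] by (simp add: n_def)
  show ?thesis
  proof (intro exI[of _ "2 * u + 8195"] exI[of _ n] conjI allI impI)
    show "real (2 * u + 8195) \<le> 5 * real u / 2" using assms by simp
    show "strict_mono n" unfolding n_def using C by (intro strict_monoI) simp
    show "0 < n i" for i using n4[of i] by simp
    show "n (i + 1) \<le> 4 * n i ^ 9" for i
    proof -
      \<comment> \<open>The sequence grows only by the factor 16, while 4 * n^9 is at least 4^9 * n
        because n \<ge> 4.\<close>
      have "4 ^ 8 * n i \<le> n i ^ 8 * n i" by (intro mult_le_mono1 power_mono n4) simp
      also have "\<dots> = n i ^ 9" by (simp add: eval_nat_numeral)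
      finally show ?thesis by (simp add: n_def)
    qed
    show "\<exists>G :: nat pair_pre_digraph.
       pair_graph G \<and> card (pverts G) = n i \<and> regular (2 * u + 8195) G \<and>
       second_eigenvalue (adjacency_matrix G) = 2 * sqrt ((real u)\<^sup>2 + 1) - 1 \<and>
       eigenvalue_multiplicity (adjacency_matrix G) (2 * sqrt ((real u)\<^sup>2 + 1) - 1) \<ge> i" if "i \<ge> 1" for i
      using sparse_product_graph[OF assms a that] unfolding n_def C_def .
    show "(\<lambda>i. real i) \<in> \<Omega>(\<lambda>i. ln (ln (real (n i))))"
    proof (rule landau_omega.bigI)
      \<comment> \<open>Geometric growth gives ln (n i) \<le> K i from i = 1 on, a stronger
        statement than the one about the iterated logarithm.\<close>
      define K where "K = ln (real C) + ln 16"
      have lC: "ln (real C) \<ge> 0" using C by simp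
      then show "1 / K > 0" unfolding K_def by (simp add: add_nonneg_pos)
      then have K: "K > 0" by simp
      show "\<forall>\<^sub>F i in sequentially. norm (real i) \<ge> 1 / K * norm (ln (ln (real (n i))))"
        using eventually_ge_at_top[of 1]
      proof eventually_elim
        case (elim i)
        \<comment> \<open>n i exceeds e, so the iterated logarithm is nonnegative and its norm is
          the value itself.\<close>
        have "exp 1 \<le> (3::real)" by (rule exp_le)
        also have "\<dots> \<le> real (n i)" using n4[of i] by linarith
        finally have L: "1 \<le> ln (real (n i))" using n4[of i] by (subst ln_ge_iff) auto
        have "ln (real (n i)) = ln (real C) + real i * ln 16"
          unfolding n_def using C by (simp add: ln_mult ln_realpow)
        also have "\<dots> \<le> real i * ln (real C) + real i * ln 16"
          using elim lC by (simp add: mult_le_cancel_right1)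
        finally have "ln (real (n i)) \<le> K * real i" by (simp add: K_def algebra_simps)
        moreover have "0 \<le> ln (ln (real (n i)))" "ln (ln (real (n i))) \<le> ln (real (n i))"
          using L ln_bound[of "ln (real (n i))"] by auto
        ultimately show ?case using K by (simp add: field_simps)
      qed
    qed
  qed
qed

end
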